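(* Let $\beta\in\mathbb{R}\setminus\{0\}$, $\mu>0$, $s>\frac32$, $\gamma>0$ and $C_0>0$. Let $u_0:\mathbb{R}\to\mathbb{R}$ satisfy $u_0\in H^s(\mathbb{R})$ and $|u_0(x)|\le C_0(1+|x|)^{-(1+\gamma)}$ for all $x\in\mathbb{R}$. Let $u\in\mathcal{C}([0,T_0],H^s(\mathbb{R}))$ be the associated local solution, described in the context, of $$\partial_t u+u\,\partial_x u+(\mathcal{H}u)\,\partial_x(\mathcal{H}u)+\beta\,\mathcal{H}u-\mu\,\partial_x^2u=0,\qquad u(0,\cdot)=u_0,$$ let $T_0<T_*<+\infty$, and suppose that $u$ extends to a solution on $[0,T_*]$ with $$u,\ \mathcal{H}u\in\mathcal{C}\big([0,T_*],H^s(\mathbb{R})\cap L^1(\mathbb{R})\big).$$ Then there is a constant $C>0$, independent of $t$ and $x$, such that for all $0<t<T_*$ and all $x\in\mathbb{R}$, $$|u(t,x)|+|\mathcal{H}u(t,x)|\le\frac{C}{t^{1/2}(1+|x|)^{\min(1,\gamma)}} .$$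
   Context: $\mathcal{H}$ is the Hilbert transform in the spatial variable, defined by $\widehat{\mathcal{H}\varphi}(\xi)=-i\,\mathrm{sign}(\xi)\,\widehat{\varphi}(\xi)$, where $\mathrm{sign}(\xi)=-1,0,1$ for $\xi<0$, $\xi=0$, $\xi>0$ respectively. A solution on $[0,T]$ is a real-valued function $u\in\mathcal{C}([0,T],H^s(\mathbb{R}))$ with $u(0,\cdot)=u_0$ satisfying the equation in the sense of distributions on $(0,T)\times\mathbb{R}$ (equivalently, in Duhamel/mild form). Local theory: let $\beta\in\mathbb{R}\setminus\{0\}$, $\mu>0$, $s>\frac32$, $\gamma>0$ and $C_0>0$; if $u_0:\mathbb{R}\to\mathbb{R}$ satisfies $u_0\in H^s(\mathbb{R})$ and $|u_0(x)|\le C_0(1+|x|)^{-(1+\gamma)}$ for all $x\in\mathbb{R}$, then there exist a time $T_0=T_0(u_0)>0$ and a unique solution $u\in\mathcal{C}([0,T_0],H^s(\mathbb{R}))$ of $\partial_t u+u\,\partial_x u+(\mathcal{H}u)\,\partial_x(\mathcal{H}u)+\beta\,\mathcal{H}u-\mu\,\partial_x^2u=0$, $u(0,\cdot)=u_0$, and it satisfies $|u(t,x)|+|\mathcal{H}u(t,x)|\le C_1 t^{-1/2}(1+|x|)^{-\min(1,\gamma)}$ for all $0<t\le T_0$, $x\in\mathbb{R}$, with $C_1$ independent of $t$ and $x$. *)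

theory Defs
  imports "HOL-Analysis.Analysis"
begin

section \<open>The Fourier transform on $L^2$\<close>

definition L2 :: "(real \<Rightarrow> complex) \<Rightarrow> bool" where
  "L2 f \<longleftrightarrow> f \<in> borel_measurable borel \<and> integrable lborel (\<lambda>x. (cmod (f x))\<^sup>2)"

definition truncated_fourier :: "real \<Rightarrow> (real \<Rightarrow> complex) \<Rightarrow> real \<Rightarrow> complex" where
  "truncated_fourier R f \<xi> = (LINT x:{-R..R}|lborel. f x * exp (- \<i> * of_real (x * \<xi>)))"

text \<open>
  The Fourier transform of an $L^2$ function, as the $L^2$ limit of its truncated Fourier
  integrals. It is determined up to null sets; \<open>fourier f\<close> is some representative. The distance
  is measured with the nonnegative integral, which is infinite (and not 0) when the integral
  diverges.
\<close>
definition has_fourier :: "(real \<Rightarrow> complex) \<Rightarrow> (real \<Rightarrow> complex) \<Rightarrow> bool" where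
  "has_fourier f g \<longleftrightarrow> L2 f \<and> L2 g \<and>
     (\<lambda>n::nat. \<integral>\<^sup>+ \<xi>. ennreal ((cmod (truncated_fourier (real n) f \<xi> - g \<xi>))\<^sup>2) \<partial>lborel)
       \<longlonglongrightarrow> 0"

definition fourier :: "(real \<Rightarrow> complex) \<Rightarrow> real \<Rightarrow> complex" where
  "fourier f = (SOME g. has_fourier f g)"


section \<open>Sobolev spaces and the Hilbert transform\<close>

definition sobolev :: "real \<Rightarrow> (real \<Rightarrow> real) set" where
  "sobolev s = {f. L2 (\<lambda>x. of_real (f x)) \<and>
     integrable lborel (\<lambda>\<xi>. (1 + \<xi>\<^sup>2) powr s * (cmod (fourier (\<lambda>x. of_real (f x)) \<xi>))\<^sup>2)}"

definition sobolev_norm :: "real \<Rightarrow> (real \<Rightarrow> real) \<Rightarrow> real" where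
  "sobolev_norm s f =
     sqrt (LINT \<xi>|lborel. (1 + \<xi>\<^sup>2) powr s * (cmod (fourier (\<lambda>x. of_real (f x)) \<xi>))\<^sup>2)"

definition L1_norm :: "(real \<Rightarrow> real) \<Rightarrow> real" where
  "L1_norm f = (LINT x|lborel. \<bar>f x\<bar>)"

definition is_hilbert :: "(real \<Rightarrow> real) \<Rightarrow> (real \<Rightarrow> real) \<Rightarrow> bool" where
  "is_hilbert f h \<longleftrightarrow>
     has_fourier (\<lambda>x. of_real (h x))
       (\<lambda>\<xi>. - \<i> * of_real (sgn \<xi>) * fourier (\<lambda>x. of_real (f x)) \<xi>)"

text \<open>
  The Fourier multiplier determines the Hilbert transform up to null sets. The continuous
  representative is chosen whenever there is one, in particular for every \<open>f\<close> in \<open>sobolev s\<close>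
  with $s > 1/2$, so that pointwise values of \<open>hilbert f\<close> are meaningful.
\<close>
definition hilbert :: "(real \<Rightarrow> real) \<Rightarrow> real \<Rightarrow> real" where
  "hilbert f = (SOME h. is_hilbert f h \<and>
     ((\<exists>k. is_hilbert f k \<and> continuous_on UNIV k) \<longrightarrow> continuous_on UNIV h))"


section \<open>Continuous curves in $H^s$ and in $L^1$\<close>

definition curve_sobolev :: "real \<Rightarrow> real \<Rightarrow> (real \<Rightarrow> real \<Rightarrow> real) \<Rightarrow> bool" where
  "curve_sobolev s T u \<longleftrightarrow>
     (\<forall>t\<in>{0..T}. u t \<in> sobolev s) \<and>
     (\<forall>t\<in>{0..T}. ((\<lambda>\<tau>. sobolev_norm s (\<lambda>x. u \<tau> x - u t x)) \<longlongrightarrow> 0) (at t within {0..T}))"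

definition curve_L1 :: "real \<Rightarrow> (real \<Rightarrow> real \<Rightarrow> real) \<Rightarrow> bool" where
  "curve_L1 T u \<longleftrightarrow>
     (\<forall>t\<in>{0..T}. integrable lborel (u t)) \<and>
     (\<forall>t\<in>{0..T}. ((\<lambda>\<tau>. L1_norm (\<lambda>x. u \<tau> x - u t x)) \<longlongrightarrow> 0) (at t within {0..T}))"


section \<open>Test functions and distributional solutions\<close>

definition partial_t :: "(real \<Rightarrow> real \<Rightarrow> real) \<Rightarrow> real \<Rightarrow> real \<Rightarrow> real" where
  "partial_t \<phi> t x = deriv (\<lambda>\<tau>. \<phi> \<tau> x) t"

definition partial_x :: "(real \<Rightarrow> real \<Rightarrow> real) \<Rightarrow> real \<Rightarrow> real \<Rightarrow> real" where
  "partial_x \<phi> t x = deriv (\<phi> t) x"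

text \<open>\<open>C_upto k \<phi>\<close>: all partial derivatives of order at most \<open>k\<close> exist and are continuous.\<close>
primrec C_upto :: "nat \<Rightarrow> (real \<Rightarrow> real \<Rightarrow> real) \<Rightarrow> bool" where
  "C_upto 0 \<phi> \<longleftrightarrow> continuous_on UNIV (\<lambda>(t, x). \<phi> t x)"
| "C_upto (Suc k) \<phi> \<longleftrightarrow>
     continuous_on UNIV (\<lambda>(t, x). \<phi> t x) \<and>
     (\<forall>t x. (\<lambda>\<tau>. \<phi> \<tau> x) differentiable (at t) \<and> \<phi> t differentiable (at x)) \<and>
     C_upto k (partial_t \<phi>) \<and> C_upto k (partial_x \<phi>)"

definition test_function :: "real \<Rightarrow> (real \<Rightarrow> real \<Rightarrow> real) \<Rightarrow> bool" where
  "test_function T \<phi> \<longleftrightarrow>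
     (\<forall>k. C_upto k \<phi>) \<and>
     compact (closure {(t, x). \<phi> t x \<noteq> 0}) \<and>
     closure {(t, x). \<phi> t x \<noteq> 0} \<subseteq> {0<..<T} \<times> UNIV"

text \<open>
  The linear derivatives are moved onto the test function. The products $u\,\partial_x u$ and
  $(\mathcal{H}u)\,\partial_x(\mathcal{H}u)$ are products of functions: for $s > 3/2$ the
  continuous representative of an element of $H^s$ is continuously differentiable.
\<close>
definition distributional_eq ::
  "real \<Rightarrow> real \<Rightarrow> real \<Rightarrow> (real \<Rightarrow> real \<Rightarrow> real) \<Rightarrow> bool" where
  "distributional_eq \<beta> \<mu> T u \<longleftrightarrow>
     (\<forall>\<phi>. test_function T \<phi> \<longrightarrow>
        (LINT p:{0<..<T} \<times> UNIV|lborel.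
           (case p of (t, x) \<Rightarrow>
              - u t x * partial_t \<phi> t x
              + (u t x * deriv (u t) x + hilbert (u t) x * deriv (hilbert (u t)) x) * \<phi> t x
              + \<beta> * hilbert (u t) x * \<phi> t x
              - \<mu> * u t x * partial_x (partial_x \<phi>) t x)) = 0)"

text \<open>
  Elements of $H^s$, $s > 1/2$, are identified with their continuous representatives; this is
  what the continuity of each \<open>u t\<close> expresses. The datum \<open>u0\<close> may be any representative.
\<close>
definition solution ::
  "real \<Rightarrow> real \<Rightarrow> real \<Rightarrow> (real \<Rightarrow> real) \<Rightarrow> real \<Rightarrow> (real \<Rightarrow> real \<Rightarrow> real) \<Rightarrow> bool" where
  "solution \<beta> \<mu> s u0 T u \<longleftrightarrow>
     (\<forall>t\<in>{0..T}. continuous_on UNIV (u t)) \<and>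
     curve_sobolev s T u \<and>
     (AE x in lborel. u 0 x = u0 x) \<and>
     distributional_eq \<beta> \<mu> T u"

text \<open>The pair \<open>T0\<close>, \<open>u\<close> furnished by the local theory for the datum \<open>u0\<close>.\<close>
definition local_solution ::
  "real \<Rightarrow> real \<Rightarrow> real \<Rightarrow> real \<Rightarrow> (real \<Rightarrow> real) \<Rightarrow> real \<Rightarrow> (real \<Rightarrow> real \<Rightarrow> real) \<Rightarrow> bool" where
  "local_solution \<beta> \<mu> s \<gamma> u0 T0 u \<longleftrightarrow>
     T0 > 0 \<and>
     solution \<beta> \<mu> s u0 T0 u \<and>
     (\<forall>v. solution \<beta> \<mu> s u0 T0 v \<longrightarrow> (\<forall>t\<in>{0..T0}. v t = u t)) \<and>
     (\<exists>C1. \<forall>t x. 0 < t \<and> t \<le> T0 \<longrightarrow>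
        \<bar>u t x\<bar> + \<bar>hilbert (u t) x\<bar> \<le> C1 * t powr (-1/2) * (1 + \<bar>x\<bar>) powr (- min 1 \<gamma>))"

end

theory Submission
  imports Defs "HOL-Probability.Probability" "HOL-Real_Asymp.Real_Asymp"
begin

text \<open>
  Put $w = u + i\mathcal{H}u$. Its Fourier transform vanishes on negative frequencies, so on positive
  ones the equation reads $\partial_t \hat w = -(\mu\xi^2 - i\beta)\hat w - i\xi\,\widehat{|w|^2}$, and
  $\beta$ only contributes a phase. Starting from the time $T_0$, where the local theory already gives
  the decay, Duhamel's formula bounds $|w(t)|$ by a Gaussian mean of $|w(T_0)|$ plus the time integral
  of $|N_{\mu(t-\tau)}| * |w(\tau)|^2$, where $|N_r(z)| \le C/(r + z^2)$. A weight $\omega$ with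
  $\omega(x) \le \omega(y) + |x-y|$ passes through the convolutions:
  the $\omega(y)$ part yields $(t-\tau)^{-1/2} \sup \omega|w(\tau)|$ since $w$ is bounded, and the $|x-y|$
  part yields $(t-\tau)^{-1/2}\|w\|_{L^2}^2$. For the bounded weights $\min(R, (1+|x|)^{\min(1,\gamma)})$ the
  suprema are finite, and a Gronwall argument in the norm $\sup e^{-\lambda t}\omega|w|$ gives a bound
  independent of $R$.

  The Duhamel formula is obtained frequency by frequency, by testing the equation with
  $\theta(t)\chi(x/n)\cos(\xi x)$ and $\theta(t)\chi(x/n)\sin(\xi x)$. All the Fourier analysis is done with the
  classical transform of integrable functions, to which the $L^2$ transform reduces because $u$ and
  $\mathcal{H}u$ are integrable.
\<close>

section \<open>The classical Fourier transform and Gaussians\<close>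

text \<open>Since u u_x + (Hu)(Hu)_x is half the x derivative of |w|^2, the nonlinearity is
  quadratic in the very function whose decay is estimated: one factor can carry the weight while the
  other is bounded or integrated. On positive frequencies H is multiplication by -i, which turns
  \<open>\<beta>\<close> Hu into the phase. The restriction to positive frequencies has a price. The
  symbol \<xi> exp(-r \<xi>^2), cut off at 0, has a corner there, so its kernel decays only like
  z^(-2), however smooth the solution is. This limits the method to weights of at most linear
  growth, and |x-y| times the kernel is bounded but not integrable, so that this part must be paired
  with the integrable function |w|^2. Starting at a positive time turns the singular factor t^(-1/2)
  of the local bound into a constant. The singularity (t-\<tau>)^(-1/2) in Duhamel's formula is
  integrable with room to spare: the spare power is traded for a negative power of \<lambda>, so the
  Gronwall term can be absorbed on the whole interval at once, however long it is.\<close>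

definition ft :: "(real \<Rightarrow> complex) \<Rightarrow> real \<Rightarrow> complex" where
  "ft f \<xi> = (LINT x|lborel. f x * cis (- (x * \<xi>)))"

text \<open>The heat kernel at time \<open>r\<close>, of mass 1 and variance \<open>2 * r\<close>.
  It is scaled to be the inverse Fourier transform of exp(-r \<xi>^2), the multiplier of the
  dissipation.\<close>

definition gauss :: "real \<Rightarrow> real \<Rightarrow> real" where
  "gauss r z = exp (- z\<^sup>2 / (4 * r)) / sqrt (4 * pi * r)"

lemma borel_measurable_cis [measurable]: "cis \<in> borel_measurable borel"
  by (intro borel_measurable_continuous_onI continuous_intros)

lemma borel_measurable_cnj [measurable]: "cnj \<in> borel_measurable borel"
  by (intro borel_measurable_continuous_onI continuous_intros)

lemma integrable_mult_bounded:
  fixes f g :: "'a \<Rightarrow> 'b::{real_normed_algebra, banach, second_countable_topology}"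
  assumes "integrable M f" "g \<in> borel_measurable M" "\<And>x. norm (g x) \<le> B"
  shows "integrable M (\<lambda>x. f x * g x)"
proof (rule Bochner_Integration.integrable_bound[where f = "\<lambda>x. B * norm (f x)"])
  show "integrable M (\<lambda>x. B * norm (f x))"
    using assms by (intro integrable_mult_right integrable_norm) auto
  have "norm (f x * g x) \<le> B * norm (f x)" for x
    using norm_mult_ineq[of "f x" "g x"] mult_left_mono[OF assms(3)[of x], of "norm (f x)"]
    by (simp add: mult.commute)
  then show "AE x in M. norm (f x * g x) \<le> norm (B * norm (f x))"
    by (intro AE_I2) (simp add: order.trans[OF _ abs_ge_self])
qed (use assms in measurable)

lemma integrable_mult_cis [simp]:
  assumes "integrable lborel f" "g \<in> borel_measurable borel"
  shows "integrable lborel (\<lambda>x. f x * cis (g x))"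
  by (rule integrable_mult_bounded[where B = 1]) (use assms in \<open>auto\<close>)

lemma norm_ft_le: "norm (ft f \<xi>) \<le> (LINT x|lborel. norm (f x))"
proof -
  have "norm (ft f \<xi>) \<le> (LINT x|lborel. norm (f x * cis (- (x * \<xi>))))"
    unfolding ft_def by (rule integral_norm_bound)
  then show ?thesis by (simp add: norm_mult)
qed

lemma isCont_ft:
  assumes "integrable lborel f"
  shows "isCont (ft f) \<xi>"
  unfolding continuous_at_sequentially
proof (intro allI impI)
  fix X assume X: "X \<longlonglongrightarrow> \<xi>"
  have [measurable]: "f \<in> borel_measurable borel" using assms by auto
  show "(ft f \<circ> X) \<longlonglongrightarrow> ft f \<xi>"
    unfolding ft_def comp_def
    by (rule integral_dominated_convergence[where w = "\<lambda>x. norm (f x)"])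
       (use assms X in \<open>auto intro!: tendsto_intros simp: norm_mult\<close>)
qed

lemma borel_measurable_ft:
  "integrable lborel f \<Longrightarrow> ft f \<in> borel_measurable borel"
  by (intro borel_measurable_continuous_onI) (simp add: continuous_at_imp_continuous_on isCont_ft)

text \<open>Tonelli for the tensor product of two integrable functions, then multiplication by a
  bounded kernel. It licenses the exchange of integrals in the multiplication formula and in the
  Duhamel formula.\<close>

lemma integrable_pair_mult:
  fixes f :: "'a \<Rightarrow> complex" and g :: "'b \<Rightarrow> complex"
  assumes M: "sigma_finite_measure M" "sigma_finite_measure N"
    and f: "integrable M f" and g: "integrable N g"
    and k: "k \<in> borel_measurable (M \<Otimes>\<^sub>M N)" and B: "\<And>p. norm (k p) \<le> B"
  shows "integrable (M \<Otimes>\<^sub>M N) (\<lambda>(x, y). f x * g y * k (x, y))"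
proof -
  interpret pair_sigma_finite M N by (intro pair_sigma_finite.intro M)
  note [measurable] = k borel_measurable_integrable[OF f] borel_measurable_integrable[OF g]
  have "integrable (M \<Otimes>\<^sub>M N) (\<lambda>p. (f (fst p) * g (snd p)))"
  proof (rule Fubini_integrable)
    show "integrable M (\<lambda>x. \<integral>y. norm (f (fst (x, y)) * g (snd (x, y))) \<partial>N)"
      using f by (simp add: norm_mult)
    show "AE x in M. integrable N (\<lambda>y. f (fst (x, y)) * g (snd (x, y)))"
      using g by simp
  qed measurable
  from integrable_mult_bounded[OF this k B] show ?thesis
    by (simp add: case_prod_unfold)
qed

lemma sigma_finite_lborel: "sigma_finite_measure lborel"
  by (rule lborel.sigma_finite_measure_axioms)

text \<open>Fubini for \<open>f x * g \<xi> * cis (- (x * \<xi>))\<close>. It takes the place of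
  Parseval's identity: a transform is moved from a general function onto an explicit kernel whose
  transform is known.\<close>

lemma ft_mult_formula:
  assumes f: "integrable lborel f" and g: "integrable lborel g"
  shows "(LINT \<xi>|lborel. ft f \<xi> * g \<xi>) = (LINT x|lborel. f x * ft g x)"
proof -
  have "integrable (lborel \<Otimes>\<^sub>M lborel) (\<lambda>(x, \<xi>). f x * g \<xi> * (\<lambda>p. cis (- (fst p * snd p))) (x, \<xi>))"
    by (rule integrable_pair_mult[where B = 1]) (use f g in \<open>auto intro: sigma_finite_lborel\<close>)
  then have "(LINT \<xi>|lborel. LINT x|lborel. f x * g \<xi> * cis (- (x * \<xi>))) =
     (LINT x|lborel. LINT \<xi>|lborel. f x * g \<xi> * cis (- (x * \<xi>)))"
    by (intro lborel_pair.Fubini_integral) (simp add: case_prod_unfold)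
  moreover have "(LINT x|lborel. f x * g \<xi> * cis (- (x * \<xi>))) = ft f \<xi> * g \<xi>" for \<xi>
  proof -
    have "(LINT x|lborel. f x * g \<xi> * cis (- (x * \<xi>))) = (LINT x|lborel. (f x * cis (- (x * \<xi>))) * g \<xi>)"
      by (simp add: mult_ac)
    also have "\<dots> = ft f \<xi> * g \<xi>"
      unfolding ft_def by (rule integral_mult_left_zero)
    finally show ?thesis .
  qed
  moreover have "(LINT \<xi>|lborel. f x * g \<xi> * cis (- (x * \<xi>))) = f x * ft g x" for x
  proof -
    have "(LINT \<xi>|lborel. f x * g \<xi> * cis (- (x * \<xi>))) = (LINT \<xi>|lborel. f x * (g \<xi> * cis (- (\<xi> * x))))"
      by (simp add: mult_ac)
    also have "\<dots> = f x * ft g x"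
      unfolding ft_def by (rule integral_mult_right_zero)
    finally show ?thesis .
  qed
  ultimately show ?thesis by simp
qed

section \<open>Gaussians and their Fourier integrals\<close>

lemma gauss_pos: "r > 0 \<Longrightarrow> gauss r z > 0"
  by (simp add: gauss_def)

lemma borel_measurable_gauss [measurable]: "gauss r \<in> borel_measurable borel"
  unfolding gauss_def by measurable

lemma gauss_minus: "gauss r (- z) = gauss r z" by (simp add: gauss_def)

text \<open>The heat kernel at time \<open>r\<close> is the normal density of variance
  \<open>2 * r\<close>, so the dilation by \<open>sqrt (2 * r)\<close> reduces it to the standard
  normal density.\<close>

lemma gauss_scale:
  assumes "r > 0"
  shows "gauss r (sqrt (2 * r) * z) * sqrt (2 * r) = std_normal_density z"
proof -
  have "(sqrt (2 * r) * z)\<^sup>2 / (4 * r) = z\<^sup>2 / 2"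
    using assms by (simp add: power_mult_distrib field_simps)
  moreover have "sqrt (4 * pi * r) = sqrt (2 * pi) * sqrt (2 * r)"
    by (simp flip: real_sqrt_mult)
  ultimately show ?thesis
    using assms by (simp add: gauss_def std_normal_density_def)
qed

lemma has_bochner_integral_gauss:
  assumes "r > 0"
  shows "has_bochner_integral lborel (gauss r) 1"
proof -
  have "(\<lambda>z. gauss r (0 + sqrt (2 * r) * z)) = (\<lambda>z. std_normal_density z / sqrt (2 * r))"
    using gauss_scale[OF assms] assms by (auto simp: field_simps)
  moreover have "has_bochner_integral lborel (\<lambda>z. std_normal_density z / sqrt (2 * r)) (1 / sqrt (2 * r))"
    using integrable_normal_density[of 1 0] integral_normal_density[of 1 0]
    by (intro has_bochner_integral_divide_zero) (simp add: has_bochner_integral_iff)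
  ultimately show ?thesis
    using assms
    by (subst lborel_has_bochner_integral_real_affine_iff[where c = "sqrt (2 * r)" and t = 0])
       (simp_all add: inverse_eq_divide)
qed

lemma integrable_gauss: "r > 0 \<Longrightarrow> integrable lborel (gauss r)"
  and integral_gauss: "r > 0 \<Longrightarrow> (LINT z|lborel. gauss r z) = 1"
  using has_bochner_integral_gauss by (auto simp: has_bochner_integral_iff)

lemma integrable_gauss_shift: "r > 0 \<Longrightarrow> integrable lborel (\<lambda>y. gauss r (x - y))"
  using lborel_integrable_real_affine[OF integrable_gauss, of r "-1" x] by simp

lemma integral_gauss_shift: "r > 0 \<Longrightarrow> (LINT y|lborel. gauss r (x - y)) = 1"
  using lborel_integral_real_affine[of "-1" "gauss r" x] by (simp add: integral_gauss)

lemma exp_eq_gauss: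
  assumes "r > 0"
  shows "exp (- (r * \<xi>\<^sup>2)) = sqrt (pi / r) * gauss (1 / (4 * r)) \<xi>"
  using assms by (simp add: gauss_def real_sqrt_divide field_simps)

lemma integrable_exp_sq:
  fixes r :: real
  assumes "r > 0"
  shows "integrable lborel (\<lambda>\<xi>. exp (- (r * \<xi>\<^sup>2)))"
proof -
  have "(\<lambda>\<xi>. exp (- (r * \<xi>\<^sup>2))) = (\<lambda>\<xi>. sqrt (pi / r) * gauss (1 / (4 * r)) \<xi>)"
    using exp_eq_gauss[OF assms] by blast
  then show ?thesis
    using assms by (auto intro!: integrable_mult_right integrable_gauss)
qed

lemma ft_std_normal: "(CLINT x|lborel. of_real (std_normal_density x) * cis (t * x)) = of_real (exp (- (t\<^sup>2) / 2))"
proof -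
  have "char std_normal_distribution t = (CLINT x|lborel. std_normal_density x * cis (t * x))"
    unfolding char_def
    by (subst integral_density) (auto simp: cis_conv_exp scaleR_conv_of_real)
  then show ?thesis by (simp add: char_std_normal_distribution)
qed

lemma integral_exp_cis:
  assumes r: "r > 0"
  shows "(CLINT \<xi>|lborel. of_real (exp (- (r * \<xi>\<^sup>2))) * cis (z * \<xi>)) = 2 * pi * gauss r z"
proof -
  \<comment> \<open>The dilation by \<open>?c\<close> turns r \<xi>^2 into \<xi>^2 / 2, so that the
    characteristic function of the standard normal distribution applies.\<close>
  let ?c = "1 / sqrt (2 * r)"
  have c: "?c \<noteq> 0" "?c > 0" "?c\<^sup>2 = 1 / (2 * r)" using r by (auto simp: power_divide)
  have "(CLINT \<xi>|lborel. of_real (exp (- (r * \<xi>\<^sup>2))) * cis (z * \<xi>)) =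
     \<bar>?c\<bar> *\<^sub>R (CLINT \<xi>|lborel. of_real (exp (- (r * (0 + ?c * \<xi>)\<^sup>2))) * cis (z * (0 + ?c * \<xi>)))"
    by (rule lborel_integral_real_affine[OF c(1)])
  also have "(\<lambda>\<xi>. of_real (exp (- (r * (0 + ?c * \<xi>)\<^sup>2))) * cis (z * (0 + ?c * \<xi>))) =
     (\<lambda>\<xi>. sqrt (2 * pi) * (std_normal_density \<xi> * cis ((z * ?c) * \<xi>)))"
  proof
    fix \<xi>
    have "r * (0 + ?c * \<xi>)\<^sup>2 = \<xi>\<^sup>2 / 2"
      using r c(3) by (simp add: power_mult_distrib power_divide)
    then have "exp (- (r * (0 + ?c * \<xi>)\<^sup>2)) = sqrt (2 * pi) * std_normal_density \<xi>"
      by (simp add: std_normal_density_def)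
    then show "of_real (exp (- (r * (0 + ?c * \<xi>)\<^sup>2))) * cis (z * (0 + ?c * \<xi>)) =
        sqrt (2 * pi) * (std_normal_density \<xi> * cis ((z * ?c) * \<xi>))"
      by (simp only: of_real_mult) (simp add: mult_ac)
  qed
  also have "(CLINT \<xi>|lborel. sqrt (2 * pi) * (std_normal_density \<xi> * cis ((z * ?c) * \<xi>))) =
     of_real (sqrt (2 * pi)) * of_real (exp (- ((z * ?c)\<^sup>2) / 2))"
    unfolding integral_mult_right_zero ft_std_normal by simp
  also have "\<bar>?c\<bar> *\<^sub>R (complex_of_real (sqrt (2 * pi)) * complex_of_real (exp (- ((z * ?c)\<^sup>2) / 2))) = 2 * pi * gauss r z"
  proof -
    have e: "- ((z * ?c)\<^sup>2) / 2 = - z\<^sup>2 / (4 * r)"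
      unfolding power_mult_distrib c(3) using r by simp
    have "sqrt (2 * pi) / sqrt (2 * r) = 2 * pi / sqrt (4 * pi * r)"
    proof -
      have "sqrt (2 * pi) * sqrt (4 * pi * r) = 2 * pi * sqrt (2 * r)"
        using pi_gt_zero by (simp add: real_sqrt_mult)
      then show ?thesis using r by (simp add: field_simps)
    qed
    moreover have "?c * (sqrt (2 * pi) * E) = sqrt (2 * pi) / sqrt (2 * r) * E" for E
      by simp
    ultimately have "?c * (sqrt (2 * pi) * exp (- ((z * ?c)\<^sup>2) / 2)) = 2 * pi * gauss r z"
      unfolding e gauss_def by simp
    moreover have "\<bar>?c\<bar> *\<^sub>R (complex_of_real A * complex_of_real B) = complex_of_real (?c * (A * B))" for A B
      using c(2) by (simp only: abs_of_pos scaleR_conv_of_real of_real_mult)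
    ultimately show ?thesis by (simp only:)
  qed
  finally show ?thesis .
qed

lemma integrable_gauss_cis:
  "r > 0 \<Longrightarrow> integrable lborel (\<lambda>\<xi>. complex_of_real (exp (- (r * \<xi>\<^sup>2))) * cis (x * \<xi>))"
  by (intro integrable_mult_cis integrable_of_real integrable_exp_sq) auto

lemma ft_gauss_cis:
  assumes "r > 0"
  shows "ft (\<lambda>\<xi>. of_real (exp (- (r * \<xi>\<^sup>2))) * cis (x * \<xi>)) y = 2 * pi * gauss r (x - y)"
  unfolding ft_def integral_exp_cis[OF assms, symmetric]
  by (intro Bochner_Integration.integral_cong refl) (simp add: cis_mult algebra_simps)

text \<open>The inversion integral, damped by a Gaussian, is a heat mean of \<open>f\<close>. The
  damping makes it converge for every integrable \<open>f\<close>; letting \<open>r\<close> tend to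
  0 later gives inversion, the Plancherel inequality and the recovery of the solution from its
  transform.\<close>

lemma integral_ft_gauss:
  fixes f :: "real \<Rightarrow> complex"
  assumes f: "integrable lborel f" and r: "r > 0"
  shows "(LINT \<xi>|lborel. ft f \<xi> * (of_real (exp (- (r * \<xi>\<^sup>2))) * cis (x * \<xi>))) =
         2 * pi * (LINT y|lborel. f y * gauss r (x - y))"
proof -
  have "(LINT \<xi>|lborel. ft f \<xi> * (of_real (exp (- (r * \<xi>\<^sup>2))) * cis (x * \<xi>))) =
        (LINT y|lborel. f y * (2 * pi * gauss r (x - y)))"
    by (subst ft_mult_formula[OF f integrable_gauss_cis[OF r]]) (simp add: ft_gauss_cis r)
  also have "\<dots> = (LINT y|lborel. (2 * pi) * (f y * gauss r (x - y)))"
    by (simp add: mult_ac)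
  also have "\<dots> = 2 * pi * (LINT y|lborel. f y * gauss r (x - y))"
    by (rule integral_mult_right_zero)
  finally show ?thesis .
qed

section \<open>Heat means for small times and the Plancherel inequality\<close>

lemma nn_integral_limit_le:
  fixes F :: "nat \<Rightarrow> 'a \<Rightarrow> ennreal"
  assumes [measurable]: "\<And>n. F n \<in> borel_measurable M"
    and lim: "AE x in M. (\<lambda>n. F n x) \<longlonglongrightarrow> G x"
    and le: "\<And>n. (\<integral>\<^sup>+x. F n x \<partial>M) \<le> C n" and C: "C \<longlonglongrightarrow> c"
  shows "(\<integral>\<^sup>+x. G x \<partial>M) \<le> c"
proof -
  have "(\<integral>\<^sup>+x. G x \<partial>M) = (\<integral>\<^sup>+x. liminf (\<lambda>n. F n x) \<partial>M)"
    by (intro nn_integral_cong_AE) (use lim in \<open>auto elim!: eventually_mono simp: lim_imp_Liminf\<close>)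
  also have "\<dots> \<le> liminf (\<lambda>n. \<integral>\<^sup>+x. F n x \<partial>M)"
    by (rule nn_integral_liminf) measurable
  also have "\<dots> \<le> liminf C"
    by (intro Liminf_mono always_eventually allI le)
  also have "\<dots> = c" using C by (simp add: lim_imp_Liminf)
  finally show ?thesis .
qed

text \<open>Holds for non-integrable \<open>f\<close> too, whose Bochner integral is 0 by
  convention.\<close>

lemma norm_integral_le_nn_integral:
  fixes f :: "'a \<Rightarrow> 'b::{banach, second_countable_topology}"
  shows "ennreal (norm (integral\<^sup>L M f)) \<le> (\<integral>\<^sup>+x. ennreal (norm (f x)) \<partial>M)"
  by (cases "integrable M f") (auto simp: integral_norm_bound_ennreal not_integrable_integral_eq)

lemma gauss_tendsto_0:
  fixes \<delta> :: real
  assumes "\<delta> > 0"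
  shows "((\<lambda>r. gauss r \<delta>) \<longlongrightarrow> 0) (at_right 0)"
  unfolding gauss_def using assms by real_asymp

lemma gauss_mono:
  assumes "r > 0" "\<bar>\<delta>\<bar> \<le> \<bar>z\<bar>"
  shows "gauss r z \<le> gauss r \<delta>"
  using assms by (auto simp: gauss_def divide_right_mono abs_le_square_iff)

text \<open>\<open>f\<close> is integrable but perhaps unbounded away from \<open>x\<close>. Near
  \<open>x\<close> it is bounded by continuity, and after rescaling dominated convergence against a
  fixed normal density applies. Far from \<open>x\<close> the kernel is at most
  \<open>gauss (r n) \<delta>\<close>, which tends to 0 and multiplies the \<open>L1\<close>
  norm.\<close>

lemma gauss_approx_identity:
  fixes f :: "real \<Rightarrow> complex"
  assumes f: "integrable lborel f" and cont: "isCont f x"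
    and r: "\<And>n::nat. r n > 0" and r0: "r \<longlonglongrightarrow> 0"
  shows "(\<lambda>n. LINT y|lborel. f y * gauss (r n) (x - y)) \<longlonglongrightarrow> f x"
proof -
  have [measurable]: "f \<in> borel_measurable borel" using f by auto
  obtain \<delta> where \<delta>: "\<delta> > 0" "\<And>y. \<bar>y - x\<bar> < \<delta> \<Longrightarrow> norm (f y - f x) < 1"
    using cont unfolding continuous_at_eps_delta dist_norm by (metis real_norm_def zero_less_one)
  define B where "B = norm (f x) + 1"
  define f1 where "f1 y = (if \<bar>y - x\<bar> < \<delta> then f y else 0)" for y
  define f2 where "f2 y = (if \<bar>y - x\<bar> < \<delta> then 0 else f y)" for y
  have [measurable]: "f1 \<in> borel_measurable borel" "f2 \<in> borel_measurable borel"
    unfolding f1_def f2_def by measurable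
  have B: "norm (f1 y) \<le> B" for y
  proof (cases "\<bar>y - x\<bar> < \<delta>")
    case True
    then show ?thesis
      using \<delta>(2)[OF True] norm_triangle_ineq2[of "f y" "f x"] unfolding f1_def B_def by simp
  qed (simp add: f1_def B_def)
  have f12: "integrable lborel f1" "integrable lborel f2"
    unfolding f1_def f2_def
    by (rule Bochner_Integration.integrable_bound[OF f]; simp)+
  have int: "integrable lborel (\<lambda>y. g y * of_real (gauss (r n) (x - y)))"
    if "integrable lborel g" for g :: "real \<Rightarrow> complex" and n
    by (rule integrable_mult_bounded[OF that, where B = "gauss (r n) 0"])
       (use r in \<open>auto intro!: gauss_mono simp: less_imp_le[OF gauss_pos]\<close>)
  have rr: "filterlim r (at_right 0) sequentially"
    using r r0 by (simp add: filterlim_at less_imp_neq[symmetric])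
  have "(\<lambda>n. LINT y|lborel. f1 y * gauss (r n) (x - y)) \<longlonglongrightarrow> f1 x"
  proof -
    have eq: "(LINT y|lborel. f1 y * gauss (r n) (x - y)) =
       (LINT z|lborel. f1 (x + sqrt (2 * r n) * z) * std_normal_density z)" for n
    proof -
      let ?c = "sqrt (2 * r n)"
      have c: "?c > 0" using r[of n] by simp
      have "(LINT y|lborel. f1 y * gauss (r n) (x - y)) =
         \<bar>?c\<bar> *\<^sub>R (LINT z|lborel. f1 (x + ?c * z) * gauss (r n) (x - (x + ?c * z)))"
        by (rule lborel_integral_real_affine) (use c in auto)
      also have "\<dots> = (LINT z|lborel. \<bar>?c\<bar> *\<^sub>R (f1 (x + ?c * z) * gauss (r n) (x - (x + ?c * z))))"
        by (rule integral_scaleR_right[symmetric]) 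
      also have "\<dots> = (LINT z|lborel. f1 (x + ?c * z) * std_normal_density z)"
      proof (intro Bochner_Integration.integral_cong refl)
        fix z
        have "gauss (r n) (x - (x + ?c * z)) = gauss (r n) (?c * z)"
          using gauss_minus[of "r n" "?c * z"] by simp
        then show "\<bar>?c\<bar> *\<^sub>R (f1 (x + ?c * z) * gauss (r n) (x - (x + ?c * z))) =
            f1 (x + ?c * z) * std_normal_density z"
          unfolding gauss_scale[OF r[of n], symmetric] using c
          by (simp add: scaleR_conv_of_real mult_ac)
      qed
      finally show ?thesis .
    qed
    have c1: "isCont f1 x"
    proof -
      have "\<forall>\<^sub>F y in nhds x. f1 y = f y"
        unfolding eventually_nhds_metric using \<delta>(1) by (auto simp: f1_def dist_real_def)
      from isCont_cong[OF this] cont show ?thesis by simp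
    qed
    have "(\<lambda>n. LINT z|lborel. f1 (x + sqrt (2 * r n) * z) * std_normal_density z) \<longlonglongrightarrow>
          (LINT z|lborel. f1 x * std_normal_density z)"
    proof (rule integral_dominated_convergence[where w = "\<lambda>z. B * std_normal_density z"])
      show "AE z in lborel. (\<lambda>n. f1 (x + sqrt (2 * r n) * z) * std_normal_density z) \<longlonglongrightarrow> f1 x * std_normal_density z"
      proof (intro AE_I2 tendsto_intros isCont_tendsto_compose[OF c1])
        fix z
        have "(\<lambda>n. x + sqrt (2 * r n) * z) \<longlonglongrightarrow> x + sqrt (2 * 0) * z"
          by (intro tendsto_intros r0)
        then show "(\<lambda>n. x + sqrt (2 * r n) * z) \<longlonglongrightarrow> x" by simp
      qed
    qed (use B in \<open>auto simp: norm_mult intro!: mult_right_mono\<close>)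
    also have "(LINT z|lborel. f1 x * std_normal_density z) = f1 x"
      using integral_normal_density[of 1 0] by simp
    finally show ?thesis unfolding eq .
  qed
  moreover have "(\<lambda>n. LINT y|lborel. f2 y * gauss (r n) (x - y)) \<longlonglongrightarrow> 0"
  proof (rule Lim_null_comparison)
    show "(\<lambda>n. (LINT y|lborel. norm (f2 y)) * gauss (r n) \<delta>) \<longlonglongrightarrow> 0"
      using tendsto_mult_left[OF filterlim_compose[OF gauss_tendsto_0[OF \<delta>(1)] rr], of "LINT y|lborel. norm (f2 y)"]
      by simp
    have "norm (LINT y|lborel. f2 y * gauss (r n) (x - y)) \<le> (LINT y|lborel. norm (f2 y)) * gauss (r n) \<delta>" for n
    proof -
      have "norm (LINT y|lborel. f2 y * gauss (r n) (x - y)) \<le> (LINT y|lborel. norm (f2 y * gauss (r n) (x - y)))"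
        by (rule integral_norm_bound)
      also have "\<dots> \<le> (LINT y|lborel. norm (f2 y) * gauss (r n) \<delta>)"
      proof (intro integral_mono integrable_norm int f12 integrable_mult_left)
        fix y show "norm (f2 y * gauss (r n) (x - y)) \<le> norm (f2 y) * gauss (r n) \<delta>"
          using gauss_mono[OF r[of n], of \<delta> "x - y"] gauss_pos[OF r[of n], of "x - y"] \<delta>(1)
          by (auto simp: f2_def norm_mult intro!: mult_left_mono)
      qed
      finally show ?thesis by simp
    qed
    then show "\<forall>\<^sub>F n in sequentially. norm (LINT y|lborel. f2 y * gauss (r n) (x - y)) \<le> (LINT y|lborel. norm (f2 y)) * gauss (r n) \<delta>"
      by simp
  qed
  ultimately have "(\<lambda>n. (LINT y|lborel. f1 y * gauss (r n) (x - y)) + (LINT y|lborel. f2 y * gauss (r n) (x - y))) \<longlonglongrightarrow> f1 x + 0"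
    by (rule tendsto_add)
  moreover have "(LINT y|lborel. f1 y * gauss (r n) (x - y)) + (LINT y|lborel. f2 y * gauss (r n) (x - y)) =
     (LINT y|lborel. f y * gauss (r n) (x - y))" for n
    unfolding Bochner_Integration.integral_add[OF int[OF f12(1)] int[OF f12(2)], symmetric]
    by (intro Bochner_Integration.integral_cong refl) (simp add: f1_def f2_def)
  moreover have "f1 x = f x" using \<delta> by (simp add: f1_def)
  ultimately show ?thesis by simp
qed

lemma nn_integral_gauss_shift:
  assumes "r > 0" 
  shows "(\<integral>\<^sup>+y. gauss r (x - y) \<partial>lborel) = 1" "(\<integral>\<^sup>+x. gauss r (x - y) \<partial>lborel) = 1"
proof -
  have *: "(\<integral>\<^sup>+y. gauss r (x - y) \<partial>lborel) = 1" for x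
    using integrable_gauss_shift[OF assms, of x] integral_gauss_shift[OF assms, of x]
    by (subst nn_integral_eq_integral) (auto simp: less_imp_le[OF gauss_pos[OF assms]])
  then show "(\<integral>\<^sup>+y. gauss r (x - y) \<partial>lborel) = 1" .
  have "gauss r (x - y) = gauss r (y - x)" for x by (simp add: gauss_def power2_commute)
  then show "(\<integral>\<^sup>+x. gauss r (x - y) \<partial>lborel) = 1" using * by simp
qed

text \<open>The left side is the integral of \<open>ft f\<close> against \<open>g\<close>, the
  conjugate transform times the Gaussian. The multiplication formula turns it into a double integral
  of f(x) conj f(y) against the heat kernel, which is at most 2 pi times the square norm because the
  kernel has mass 1 in each variable.\<close>

lemma ft_square_gauss_le:
  assumes f: "integrable lborel f" and f2: "integrable lborel (\<lambda>x. (cmod (f x))\<^sup>2)" and r: "r > 0"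
  shows "(\<integral>\<^sup>+\<xi>. ennreal ((cmod (ft f \<xi>))\<^sup>2 * exp (- (r * \<xi>\<^sup>2))) \<partial>lborel) \<le>
         ennreal (2 * pi * (LINT x|lborel. (cmod (f x))\<^sup>2))"
proof -
  have [measurable]: "f \<in> borel_measurable borel" using f by auto
  note [measurable] = borel_measurable_ft[OF f]
  define g where "g \<xi> = cnj (ft f \<xi>) * of_real (exp (- (r * \<xi>\<^sup>2)))" for \<xi>
  define C where "C = (LINT x|lborel. norm (f x))"
  have C: "norm (ft f \<xi>) \<le> C" for \<xi> unfolding C_def by (rule norm_ft_le)
  have g: "integrable lborel g"
  proof -
    have "integrable lborel (\<lambda>\<xi>. complex_of_real (exp (- (r * \<xi>\<^sup>2))) * cnj (ft f \<xi>))"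
      by (rule integrable_mult_bounded[where B = C]) (use C integrable_exp_sq[OF r] in auto)
    then show ?thesis unfolding g_def by (simp add: mult.commute)
  qed
  define k where "k x = (LINT y|lborel. f y * gauss r (x - y))" for x
  have ftg: "ft g x = cnj (2 * pi * k x)" for x
  proof -
    have "ft g x = (LINT \<xi>|lborel. cnj (ft f \<xi> * (of_real (exp (- (r * \<xi>\<^sup>2))) * cis (x * \<xi>))))"
      unfolding ft_def[of g] g_def
      by (intro Bochner_Integration.integral_cong refl) (simp add: cis_cnj mult_ac)
    also have "\<dots> = cnj (2 * pi * k x)"
      unfolding k_def integral_ft_gauss[OF f r, symmetric] by (rule Bochner_Integration.integral_cnj)
    finally show ?thesis .
  qed
  have int: "integrable lborel (\<lambda>\<xi>. (cmod (ft f \<xi>))\<^sup>2 * exp (- (r * \<xi>\<^sup>2)))"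
  proof -
    have "integrable lborel (\<lambda>\<xi>. norm (g \<xi> * ft f \<xi>))"
      by (intro integrable_norm integrable_mult_bounded[OF g, where B = C] C) measurable
    then show ?thesis by (simp add: g_def norm_mult power2_eq_square mult_ac)
  qed
  have "complex_of_real (LINT \<xi>|lborel. (cmod (ft f \<xi>))\<^sup>2 * exp (- (r * \<xi>\<^sup>2))) =
      (LINT \<xi>|lborel. complex_of_real ((cmod (ft f \<xi>))\<^sup>2 * exp (- (r * \<xi>\<^sup>2))))"
    by (rule integral_complex_of_real[symmetric])
  also have "\<dots> = (LINT \<xi>|lborel. ft f \<xi> * g \<xi>)"
    by (intro Bochner_Integration.integral_cong refl)
       (simp add: g_def complex_norm_square mult_ac flip: of_real_power)
  also have "\<dots> = (LINT x|lborel. f x * cnj (2 * pi * k x))"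
    by (subst ft_mult_formula[OF f g]) (simp add: ftg)
  finally have eq: "complex_of_real (LINT \<xi>|lborel. (cmod (ft f \<xi>))\<^sup>2 * exp (- (r * \<xi>\<^sup>2))) = \<dots>" .
  have nn: "(LINT \<xi>|lborel. (cmod (ft f \<xi>))\<^sup>2 * exp (- (r * \<xi>\<^sup>2))) \<ge> 0"
    by (intro integral_nonneg_AE) auto
  have S: "(\<integral>\<^sup>+x. ennreal ((cmod (f x))\<^sup>2) \<partial>lborel) = ennreal (LINT x|lborel. (cmod (f x))\<^sup>2)" (is "?S = _")
    by (rule nn_integral_eq_integral[OF f2]) auto
  have "(\<integral>\<^sup>+\<xi>. ennreal ((cmod (ft f \<xi>))\<^sup>2 * exp (- (r * \<xi>\<^sup>2))) \<partial>lborel) =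
      ennreal (LINT \<xi>|lborel. (cmod (ft f \<xi>))\<^sup>2 * exp (- (r * \<xi>\<^sup>2)))"
    by (rule nn_integral_eq_integral[OF int]) auto
  also have "\<dots> = ennreal (norm (LINT x|lborel. f x * cnj (2 * pi * k x)))"
    unfolding eq[symmetric] using nn by simp
  also have "\<dots> \<le> (\<integral>\<^sup>+x. ennreal (norm (f x * cnj (2 * pi * k x))) \<partial>lborel)"
    by (rule norm_integral_le_nn_integral)
  also have "\<dots> \<le> (\<integral>\<^sup>+x. \<integral>\<^sup>+y. ennreal (pi * ((cmod (f x))\<^sup>2 + (cmod (f y))\<^sup>2) * gauss r (x - y)) \<partial>lborel \<partial>lborel)"
  proof (rule nn_integral_mono)
    fix x
    have "ennreal (norm (f x * cnj (2 * pi * k x))) = ennreal (2 * pi * norm (f x)) * ennreal (norm (k x))"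
      by (simp add: norm_mult mult_ac flip: ennreal_mult)
    also have "\<dots> \<le> ennreal (2 * pi * norm (f x)) * (\<integral>\<^sup>+y. ennreal (norm (f y * gauss r (x - y))) \<partial>lborel)"
      unfolding k_def by (intro mult_left_mono norm_integral_le_nn_integral) auto
    also have "\<dots> = (\<integral>\<^sup>+y. ennreal (2 * pi * norm (f x)) * ennreal (norm (f y * gauss r (x - y))) \<partial>lborel)"
      by (rule nn_integral_cmult[symmetric]) measurable
    also have "\<dots> \<le> (\<integral>\<^sup>+y. ennreal (pi * ((cmod (f x))\<^sup>2 + (cmod (f y))\<^sup>2) * gauss r (x - y)) \<partial>lborel)"
    proof (intro nn_integral_mono)
      fix y
      \<comment> \<open>Symmetrising the product by the arithmetic-geometric inequality replaces a
        Cauchy-Schwarz argument: each of the two squares sees the kernel only through its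
        mass.\<close>
      have "2 * norm (f x) * norm (f y) \<le> (cmod (f x))\<^sup>2 + (cmod (f y))\<^sup>2"
        using sum_squares_bound[of "cmod (f x)" "cmod (f y)"] by simp
      then have "(2 * norm (f x) * norm (f y)) * (pi * gauss r (x - y)) \<le> ((cmod (f x))\<^sup>2 + (cmod (f y))\<^sup>2) * (pi * gauss r (x - y))"
        by (intro mult_right_mono) (auto intro!: mult_nonneg_nonneg less_imp_le[OF gauss_pos[OF r]])
      then show "ennreal (2 * pi * norm (f x)) * ennreal (norm (f y * gauss r (x - y))) \<le>
          ennreal (pi * ((cmod (f x))\<^sup>2 + (cmod (f y))\<^sup>2) * gauss r (x - y))"
        using less_imp_le[OF gauss_pos[OF r, of "x - y"]]
        by (simp add: norm_mult mult_ac flip: ennreal_mult)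
    qed
    finally show "ennreal (norm (f x * cnj (2 * pi * k x))) \<le> \<dots>" .
  qed
  also have "\<dots> = (\<integral>\<^sup>+x. \<integral>\<^sup>+y. (ennreal (pi * (cmod (f x))\<^sup>2) * gauss r (x - y) + ennreal (pi * (cmod (f y))\<^sup>2) * gauss r (x - y)) \<partial>lborel \<partial>lborel)"
    by (intro nn_integral_cong) (simp add: less_imp_le[OF gauss_pos[OF r]] algebra_simps flip: ennreal_mult ennreal_plus)
  also have "\<dots> = (\<integral>\<^sup>+x. ((\<integral>\<^sup>+y. ennreal (pi * (cmod (f x))\<^sup>2) * gauss r (x - y) \<partial>lborel) + (\<integral>\<^sup>+y. ennreal (pi * (cmod (f y))\<^sup>2) * gauss r (x - y) \<partial>lborel)) \<partial>lborel)"
    by (intro nn_integral_cong nn_integral_add) measurable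
  also have "\<dots> = (\<integral>\<^sup>+x. (\<integral>\<^sup>+y. ennreal (pi * (cmod (f x))\<^sup>2) * gauss r (x - y) \<partial>lborel) \<partial>lborel) +
     (\<integral>\<^sup>+x. (\<integral>\<^sup>+y. ennreal (pi * (cmod (f y))\<^sup>2) * gauss r (x - y) \<partial>lborel) \<partial>lborel)"
    by (intro nn_integral_add) measurable
  also have "(\<integral>\<^sup>+x. (\<integral>\<^sup>+y. ennreal (pi * (cmod (f y))\<^sup>2) * gauss r (x - y) \<partial>lborel) \<partial>lborel) =
     (\<integral>\<^sup>+y. (\<integral>\<^sup>+x. ennreal (pi * (cmod (f y))\<^sup>2) * gauss r (x - y) \<partial>lborel) \<partial>lborel)"
    by (rule lborel_pair.Fubini') measurable
  also have "(\<integral>\<^sup>+x. (\<integral>\<^sup>+y. ennreal (pi * (cmod (f x))\<^sup>2) * gauss r (x - y) \<partial>lborel) \<partial>lborel) = pi * ?S"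
    by (simp add: nn_integral_cmult nn_integral_gauss_shift r ennreal_mult)
  also have "(\<integral>\<^sup>+y. (\<integral>\<^sup>+x. ennreal (pi * (cmod (f y))\<^sup>2) * gauss r (x - y) \<partial>lborel) \<partial>lborel) = pi * ?S"
    by (simp add: nn_integral_cmult nn_integral_gauss_shift r ennreal_mult)
  also have "pi * ?S + pi * ?S = ennreal (2 * pi * (LINT x|lborel. (cmod (f x))\<^sup>2))"
    unfolding S by (simp flip: ennreal_mult ennreal_plus)
  finally show ?thesis .
qed

text \<open>Fatou's lemma removes the Gaussian weight as its parameter decreases to 0; the bound
  does not depend on the parameter.\<close>

lemma plancherel_le:
  assumes f: "integrable lborel f" and f2: "integrable lborel (\<lambda>x. (cmod (f x))\<^sup>2)"
  shows "(\<integral>\<^sup>+\<xi>. ennreal ((cmod (ft f \<xi>))\<^sup>2) \<partial>lborel) \<le> ennreal (2 * pi * (LINT x|lborel. (cmod (f x))\<^sup>2))"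
proof (rule nn_integral_limit_le)
  note [measurable] = borel_measurable_ft[OF f]
  let ?r = "\<lambda>n::nat. inverse (real (Suc n))"
  show "(\<lambda>\<xi>. ennreal ((cmod (ft f \<xi>))\<^sup>2 * exp (- (?r n * \<xi>\<^sup>2)))) \<in> borel_measurable lborel" for n
    by measurable
  show "(\<integral>\<^sup>+\<xi>. ennreal ((cmod (ft f \<xi>))\<^sup>2 * exp (- (?r n * \<xi>\<^sup>2))) \<partial>lborel) \<le>
         ennreal (2 * pi * (LINT x|lborel. (cmod (f x))\<^sup>2))" for n
    by (rule ft_square_gauss_le[OF f f2]) simp
  show "AE \<xi> in lborel. (\<lambda>n. ennreal ((cmod (ft f \<xi>))\<^sup>2 * exp (- (?r n * \<xi>\<^sup>2)))) \<longlonglongrightarrow> ennreal ((cmod (ft f \<xi>))\<^sup>2)"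
  proof (intro AE_I2 tendsto_ennrealI)
    fix \<xi>
    have "(\<lambda>n. (cmod (ft f \<xi>))\<^sup>2 * exp (- (?r n * \<xi>\<^sup>2))) \<longlonglongrightarrow> (cmod (ft f \<xi>))\<^sup>2 * exp (- (0 * \<xi>\<^sup>2))"
      by (intro tendsto_intros LIMSEQ_inverse_real_of_nat)
    then show "(\<lambda>n. (cmod (ft f \<xi>))\<^sup>2 * exp (- (?r n * \<xi>\<^sup>2))) \<longlonglongrightarrow> (cmod (ft f \<xi>))\<^sup>2" by simp
  qed
qed simp

section \<open>The $L^2$ Fourier transform\<close>

lemma ft_diff:
  assumes "integrable lborel f" "integrable lborel g"
  shows "ft f \<xi> - ft g \<xi> = ft (\<lambda>x. f x - g x) \<xi>"
  unfolding ft_def left_diff_distrib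
  by (rule Bochner_Integration.integral_diff[symmetric]) (use assms in auto)

lemma cmod_diff_square_le: "(cmod (a - b))\<^sup>2 \<le> 2 * (cmod a)\<^sup>2 + 2 * (cmod b)\<^sup>2"
proof -
  have "(cmod (a - b))\<^sup>2 \<le> (cmod a + cmod b)\<^sup>2"
    by (intro power_mono norm_triangle_ineq4) auto
  also have "\<dots> \<le> 2 * (cmod a)\<^sup>2 + 2 * (cmod b)\<^sup>2"
    using sum_squares_bound[of "cmod a" "cmod b"] by (simp add: power2_sum)
  finally show ?thesis .
qed

lemma square_integrable_diff:
  fixes f g :: "real \<Rightarrow> complex"
  assumes f: "f \<in> borel_measurable borel" "integrable lborel (\<lambda>x. (cmod (f x))\<^sup>2)"
    and g: "g \<in> borel_measurable borel" "integrable lborel (\<lambda>x. (cmod (g x))\<^sup>2)"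
  shows "integrable lborel (\<lambda>x. (cmod (f x - g x))\<^sup>2)"
proof (rule Bochner_Integration.integrable_bound)
  show "integrable lborel (\<lambda>x. 2 * (cmod (f x))\<^sup>2 + 2 * (cmod (g x))\<^sup>2)"
    using f g by simp
  show "AE x in lborel. norm ((cmod (f x - g x))\<^sup>2) \<le> norm (2 * (cmod (f x))\<^sup>2 + 2 * (cmod (g x))\<^sup>2)"
    using cmod_diff_square_le by (intro AE_I2) (simp add: abs_of_nonneg)
qed (use f g in measurable)

lemma ft_diff_le:
  assumes f: "integrable lborel f" "integrable lborel (\<lambda>x. (cmod (f x))\<^sup>2)"
    and g: "integrable lborel g" "integrable lborel (\<lambda>x. (cmod (g x))\<^sup>2)"
  shows "(\<integral>\<^sup>+\<xi>. ennreal ((cmod (ft f \<xi> - ft g \<xi>))\<^sup>2) \<partial>lborel) \<le>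
         ennreal (2 * pi * (LINT x|lborel. (cmod (f x - g x))\<^sup>2))"
  unfolding ft_diff[OF f(1) g(1)]
  by (rule plancherel_le) (use f g in \<open>auto intro!: square_integrable_diff\<close>)

lemma truncated_fourier_eq_ft:
  "truncated_fourier R f = ft (\<lambda>x. indicator {-R..R} x *\<^sub>R f x)"
  by (simp add: truncated_fourier_def ft_def set_lebesgue_integral_def cis_conv_exp fun_eq_iff)

text \<open>On a bounded interval square integrability gives integrability, through
  \<open>a \<le> 1 + a^2\<close>. So the truncated transforms of an \<open>L2\<close> function are
  classical transforms.\<close>

lemma truncation_integrable:
  assumes "L2 f"
  shows "integrable lborel (\<lambda>x. indicator {-R..R} x *\<^sub>R f x)"
    and "integrable lborel (\<lambda>x. (cmod (indicator {-R..R} x *\<^sub>R f x))\<^sup>2)"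
proof -
  have [measurable]: "f \<in> borel_measurable borel" and f2: "integrable lborel (\<lambda>x. (cmod (f x))\<^sup>2)"
    using assms by (auto simp: L2_def)
  show "integrable lborel (\<lambda>x. (cmod (indicator {-R..R} x *\<^sub>R f x))\<^sup>2)"
    by (rule Bochner_Integration.integrable_bound[OF f2]) (auto simp: indicator_def)
  show "integrable lborel (\<lambda>x. indicator {-R..R} x *\<^sub>R f x)"
  proof (rule Bochner_Integration.integrable_bound)
    show "integrable lborel (\<lambda>x. indicator {-R..R} x *\<^sub>R (1 :: real) + (cmod (f x))\<^sup>2)"
      unfolding real_scaleR_def mult_1_right
      by (intro Bochner_Integration.integrable_add f2 integrable_real_indicator) (auto simp: emeasure_lborel_Icc_eq)
    have "a \<le> 1 + a\<^sup>2" for a :: real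
      using sum_squares_bound[of a 1] zero_le_power2[of a] unfolding power_one mult_1_right by linarith
    then show "AE x in lborel. norm (indicator {-R..R} x *\<^sub>R f x) \<le> norm (indicator {-R..R} x *\<^sub>R (1 :: real) + (cmod (f x))\<^sup>2)"
      by (intro AE_I2) (auto simp: indicator_def abs_of_nonneg)
  qed measurable
qed

lemma truncation_tendsto_0:
  assumes "L2 f"
  shows "(\<lambda>n::nat. LINT x|lborel. (cmod (indicator {-real n..real n} x *\<^sub>R f x - f x))\<^sup>2) \<longlonglongrightarrow> 0"
proof -
  have [measurable]: "f \<in> borel_measurable borel" and f2: "integrable lborel (\<lambda>x. (cmod (f x))\<^sup>2)"
    using assms by (auto simp: L2_def)
  have "(\<lambda>n::nat. LINT x|lborel. (cmod (indicator {-real n..real n} x *\<^sub>R f x - f x))\<^sup>2) \<longlonglongrightarrow> (LINT x|(lborel :: real measure). 0)"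
  proof (rule integral_dominated_convergence[where w = "\<lambda>x. (cmod (f x))\<^sup>2"])
    show "AE x in lborel. (\<lambda>n. (cmod (indicator {-real n..real n} x *\<^sub>R f x - f x))\<^sup>2) \<longlonglongrightarrow> 0"
    proof (intro AE_I2 tendsto_eventually)
      fix x :: real
      show "\<forall>\<^sub>F n in sequentially. (cmod (indicator {-real n..real n} x *\<^sub>R f x - f x))\<^sup>2 = 0"
        using eventually_ge_at_top[of "nat \<lceil>\<bar>x\<bar>\<rceil>"]
        by eventually_elim (auto simp: indicator_def abs_le_iff)
    qed
    show "AE x in lborel. norm ((cmod (indicator {-real n..real n} x *\<^sub>R f x - f x))\<^sup>2) \<le> (cmod (f x))\<^sup>2" for n
      by (auto simp: indicator_def)
  qed (use f2 in auto)
  then show ?thesis by simp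
qed

text \<open>The tails of an \<open>L2\<close> function tend to 0 in \<open>L2\<close>, so a
  Plancherel-type bound of the error by the tail is all that has to be checked for a candidate
  transform.\<close>

lemma has_fourierI:
  assumes "L2 f" "L2 g"
    and "\<And>n::nat. (\<integral>\<^sup>+ \<xi>. ennreal ((cmod (truncated_fourier (real n) f \<xi> - g \<xi>))\<^sup>2) \<partial>lborel) \<le>
      ennreal (2 * pi * (LINT x|lborel. (cmod (indicator {-real n..real n} x *\<^sub>R f x - f x))\<^sup>2))"
  shows "has_fourier f g"
proof -
  have "(\<lambda>n. ennreal (2 * pi * (LINT x|lborel. (cmod (indicator {-real n..real n} x *\<^sub>R f x - f x))\<^sup>2))) \<longlonglongrightarrow> ennreal (2 * pi * 0)"
    by (intro tendsto_intros tendsto_ennrealI truncation_tendsto_0 assms)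
  then have *: "(\<lambda>n. ennreal (2 * pi * (LINT x|lborel. (cmod (indicator {-real n..real n} x *\<^sub>R f x - f x))\<^sup>2))) \<longlonglongrightarrow> 0"
    by simp
  have "(\<lambda>n::nat. \<integral>\<^sup>+ \<xi>. ennreal ((cmod (truncated_fourier (real n) f \<xi> - g \<xi>))\<^sup>2) \<partial>lborel) \<longlonglongrightarrow> 0"
    by (rule tendsto_sandwich[OF always_eventually always_eventually tendsto_const *]) (use assms(3) in auto)
  then show ?thesis using assms by (simp add: has_fourier_def)
qed

lemma L2_ft:
  assumes f: "integrable lborel f" "integrable lborel (\<lambda>x. (cmod (f x))\<^sup>2)"
  shows "L2 (ft f)"
proof -
  note [measurable] = borel_measurable_ft[OF f(1)]
  have "integrable lborel (\<lambda>\<xi>. (cmod (ft f \<xi>))\<^sup>2)"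
    using plancherel_le[OF f] by (intro integrableI_bounded) (auto intro: le_less_trans)
  then show ?thesis by (simp add: L2_def borel_measurable_ft f)
qed

lemma has_fourier_ft:
  assumes f: "integrable lborel f" "integrable lborel (\<lambda>x. (cmod (f x))\<^sup>2)"
  shows "has_fourier f (ft f)"
proof (rule has_fourierI)
  show L: "L2 f" using f by (auto simp: L2_def)
  show "L2 (ft f)" using f by (rule L2_ft)
  show "(\<integral>\<^sup>+ \<xi>. ennreal ((cmod (truncated_fourier (real n) f \<xi> - ft f \<xi>))\<^sup>2) \<partial>lborel) \<le>
      ennreal (2 * pi * (LINT x|lborel. (cmod (indicator {-real n..real n} x *\<^sub>R f x - f x))\<^sup>2))" for n
    unfolding truncated_fourier_eq_ft by (rule ft_diff_le[OF truncation_integrable[OF L] f])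
qed

text \<open>Two limits in \<open>L2\<close> of the same sequence. The distances are nonnegative
  integrals, so the quadratic triangle inequality passes through them without any integrability to
  verify.\<close>

lemma has_fourier_unique:
  assumes "has_fourier f g1" "has_fourier f g2"
  shows "AE \<xi> in lborel. g1 \<xi> = g2 \<xi>"
proof -
  have [measurable]: "g1 \<in> borel_measurable borel" "g2 \<in> borel_measurable borel" and f: "L2 f"
    using assms by (auto simp: has_fourier_def L2_def)
  let ?T = "\<lambda>n::nat. truncated_fourier (real n) f"
  have [measurable]: "?T n \<in> borel_measurable borel" for n
    unfolding truncated_fourier_eq_ft by (rule borel_measurable_ft[OF truncation_integrable(1)[OF f]])
  let ?I = "\<lambda>g n. \<integral>\<^sup>+ \<xi>. ennreal ((cmod (?T n \<xi> - g \<xi>))\<^sup>2) \<partial>lborel"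
  have "(\<integral>\<^sup>+ \<xi>. ennreal ((cmod (g1 \<xi> - g2 \<xi>))\<^sup>2) \<partial>lborel) \<le> 0"
  proof (rule LIMSEQ_le_const[of "\<lambda>n. 2 * ?I g1 n + 2 * ?I g2 n"])
    have "(\<lambda>n. 2 * ?I g1 n + 2 * ?I g2 n) \<longlonglongrightarrow> 2 * 0 + 2 * 0"
      by (intro tendsto_add ennreal_tendsto_cmult) (use assms in \<open>auto simp: has_fourier_def\<close>)
    then show "(\<lambda>n. 2 * ?I g1 n + 2 * ?I g2 n) \<longlonglongrightarrow> 0" by simp
    have "(\<integral>\<^sup>+ \<xi>. ennreal ((cmod (g1 \<xi> - g2 \<xi>))\<^sup>2) \<partial>lborel) \<le> 2 * ?I g1 n + 2 * ?I g2 n" for n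
    proof -
      have *: "(cmod (a - b))\<^sup>2 \<le> 2 * (cmod (c - a))\<^sup>2 + 2 * (cmod (c - b))\<^sup>2" for a b c :: complex
        using cmod_diff_square_le[of "c - b" "c - a"] by (simp add: add.commute)
      have "(\<integral>\<^sup>+ \<xi>. ennreal ((cmod (g1 \<xi> - g2 \<xi>))\<^sup>2) \<partial>lborel) \<le>
         (\<integral>\<^sup>+ \<xi>. (2 * ennreal ((cmod (?T n \<xi> - g1 \<xi>))\<^sup>2) + 2 * ennreal ((cmod (?T n \<xi> - g2 \<xi>))\<^sup>2)) \<partial>lborel)"
      proof (intro nn_integral_mono)
        fix \<xi>
        have "ennreal ((cmod (g1 \<xi> - g2 \<xi>))\<^sup>2) \<le> ennreal (2 * (cmod (?T n \<xi> - g1 \<xi>))\<^sup>2 + 2 * (cmod (?T n \<xi> - g2 \<xi>))\<^sup>2)"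
          by (intro ennreal_leI *)
        also have "\<dots> = 2 * ennreal ((cmod (?T n \<xi> - g1 \<xi>))\<^sup>2) + 2 * ennreal ((cmod (?T n \<xi> - g2 \<xi>))\<^sup>2)"
          by (subst ennreal_plus) (auto simp: ennreal_mult)
        finally show "ennreal ((cmod (g1 \<xi> - g2 \<xi>))\<^sup>2) \<le> \<dots>" .
      qed
      also have "\<dots> = 2 * ?I g1 n + 2 * ?I g2 n"
        by (simp add: nn_integral_add nn_integral_cmult)
      finally show ?thesis .
    qed
    then show "\<exists>N. \<forall>n\<ge>N. (\<integral>\<^sup>+ \<xi>. ennreal ((cmod (g1 \<xi> - g2 \<xi>))\<^sup>2) \<partial>lborel) \<le> 2 * ?I g1 n + 2 * ?I g2 n"
      by blast
  qed
  then have "AE \<xi> in lborel. ennreal ((cmod (g1 \<xi> - g2 \<xi>))\<^sup>2) = 0"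
    by (subst nn_integral_0_iff_AE[symmetric]) auto
  then show ?thesis by eventually_elim auto
qed

lemma has_fourier_fourier: "has_fourier f g \<Longrightarrow> has_fourier f (fourier f)"
  using someI[of "has_fourier f" g] by (simp add: fourier_def)

text \<open>\<open>fourier\<close> picks an arbitrary representative; this ties it to the continuous
  function \<open>ft f\<close> up to a null set.\<close>

lemma fourier_eq_ft:
  assumes "integrable lborel f" "integrable lborel (\<lambda>x. (cmod (f x))\<^sup>2)"
  shows "AE \<xi> in lborel. fourier f \<xi> = ft f \<xi>"
  using has_fourier_ft[OF assms] by (intro has_fourier_unique[of f] has_fourier_fourier)

lemma has_fourier_cong_AE:
  assumes "has_fourier f g" "AE \<xi> in lborel. g \<xi> = g' \<xi>" "g' \<in> borel_measurable borel"
  shows "has_fourier f g'"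
proof -
  have "(\<integral>\<^sup>+ \<xi>. ennreal ((cmod (truncated_fourier R f \<xi> - g' \<xi>))\<^sup>2) \<partial>lborel) =
        (\<integral>\<^sup>+ \<xi>. ennreal ((cmod (truncated_fourier R f \<xi> - g \<xi>))\<^sup>2) \<partial>lborel)" for R
    by (rule nn_integral_cong_AE) (use assms(2) in auto)
  moreover have "L2 g'"
    unfolding L2_def
  proof
    have "integrable lborel (\<lambda>x. (cmod (g x))\<^sup>2)" "g \<in> borel_measurable borel"
      using assms by (auto simp: has_fourier_def L2_def)
    then show "integrable lborel (\<lambda>x. (cmod (g' x))\<^sup>2)"
      by (elim integrable_cong_AE_imp) (use assms in auto)
  qed fact
  ultimately show ?thesis using assms(1) by (simp add: has_fourier_def)
qed

text \<open>The same Gaussian-damped integral has two limits: the undamped integral by dominated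
  convergence, and \<open>2 * pi * f x\<close> because heat means converge at a point of
  continuity.\<close>

lemma fourier_inversion:
  assumes f: "integrable lborel f" and c: "isCont f x" and ff: "integrable lborel (ft f)"
  shows "f x = (LINT \<xi>|lborel. ft f \<xi> * cis (x * \<xi>)) / (2 * pi)"
proof -
  let ?r = "\<lambda>n::nat. inverse (real (Suc n))"
  note [measurable] = borel_measurable_ft[OF f]
  have "(\<lambda>n. LINT \<xi>|lborel. ft f \<xi> * (of_real (exp (- (?r n * \<xi>\<^sup>2))) * cis (x * \<xi>))) \<longlonglongrightarrow>
      (LINT \<xi>|lborel. ft f \<xi> * cis (x * \<xi>))"
  proof (rule integral_dominated_convergence[where w = "\<lambda>\<xi>. norm (ft f \<xi>)"])
    show "AE \<xi> in lborel. (\<lambda>n. ft f \<xi> * (of_real (exp (- (?r n * \<xi>\<^sup>2))) * cis (x * \<xi>))) \<longlonglongrightarrow> ft f \<xi> * cis (x * \<xi>)"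
    proof (rule AE_I2)
      fix \<xi>
      have "(\<lambda>n. ft f \<xi> * (of_real (exp (- (?r n * \<xi>\<^sup>2))) * cis (x * \<xi>))) \<longlonglongrightarrow> ft f \<xi> * (of_real (exp (- (0 * \<xi>\<^sup>2))) * cis (x * \<xi>))"
        by (intro tendsto_intros LIMSEQ_inverse_real_of_nat)
      then show "(\<lambda>n. ft f \<xi> * (of_real (exp (- (?r n * \<xi>\<^sup>2))) * cis (x * \<xi>))) \<longlonglongrightarrow> ft f \<xi> * cis (x * \<xi>)" by simp
    qed
  qed (use ff in \<open>auto simp: norm_mult intro!: mult_left_le\<close>)
  moreover have "(\<lambda>n. 2 * pi * (LINT y|lborel. f y * gauss (?r n) (x - y))) \<longlonglongrightarrow> 2 * pi * f x"
    by (intro tendsto_intros gauss_approx_identity[OF f c] LIMSEQ_inverse_real_of_nat) simp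
  ultimately have "(LINT \<xi>|lborel. ft f \<xi> * cis (x * \<xi>)) = 2 * pi * f x"
    by (subst (asm) integral_ft_gauss[OF f]) (auto intro: LIMSEQ_unique)
  then show ?thesis by simp
qed

text \<open>
  The Gaussian cutoffs of \<open>h\<close> are integrable and their transforms are Gaussian means of \<open>p\<close>, which
  converge pointwise; Fatou's lemma then upgrades the Plancherel inequality, so that neither the
  Plancherel identity nor completeness of $L^2$ is needed.
\<close>
lemma has_fourier_inverse:
  assumes p: "integrable lborel p" "integrable lborel (\<lambda>x. (cmod (p x))\<^sup>2)"
    and cont: "AE \<xi> in lborel. isCont p \<xi>"
  defines "h \<equiv> \<lambda>x. ft p (- x) / (2 * pi)"
  shows "has_fourier h p"
proof (rule has_fourierI)
  have [measurable]: "p \<in> borel_measurable borel" using p by auto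
  note [measurable] = borel_measurable_ft[OF p(1)]
  have hm [measurable]: "h \<in> borel_measurable borel" unfolding h_def by measurable
  have h2: "integrable lborel (\<lambda>x. (cmod (h x))\<^sup>2)"
  proof -
    have "integrable lborel (\<lambda>\<xi>. (cmod (ft p \<xi>))\<^sup>2)" using L2_ft[OF p] by (simp add: L2_def)
    from lborel_integrable_real_affine[OF this, of "-1" 0]
    show ?thesis unfolding h_def by (simp add: norm_divide power_divide)
  qed
  show L2h: "L2 h" and "L2 p" using h2 p by (auto simp: L2_def)
  define C where "C = (LINT x|lborel. norm (p x))"
  have C: "norm (h x) \<le> C" for x
  proof -
    have "norm (h x) \<le> norm (ft p (-x)) / 1"
      unfolding h_def norm_divide using pi_gt3 by (intro divide_left_mono) auto
    then show ?thesis using norm_ft_le[of p "-x"] by (simp add: C_def)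
  qed
  let ?r = "\<lambda>n::nat. inverse (real (Suc n))"
  have r: "?r n > 0" for n by simp
  define hk where "hk n x = of_real (exp (- (?r n * x\<^sup>2))) * h x" for n x
  have [measurable]: "hk n \<in> borel_measurable borel" for n unfolding hk_def by measurable
  have hk1: "integrable lborel (hk n)" for n
    unfolding hk_def by (rule integrable_mult_bounded[where B = C]) (use C integrable_exp_sq[OF r] in auto)
  have hkle: "cmod (hk n x) \<le> cmod (h x)" for n x
    unfolding hk_def norm_mult by (auto intro!: mult_left_le_one_le)
  have hk2: "integrable lborel (\<lambda>x. (cmod (hk n x))\<^sup>2)" for n
    by (rule Bochner_Integration.integrable_bound[OF h2]) (auto intro!: power_mono hkle)
  have hkh: "(\<lambda>n. hk n x) \<longlonglongrightarrow> h x" for x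
  proof -
    have "(\<lambda>n. hk n x) \<longlonglongrightarrow> of_real (exp (- (0 * x\<^sup>2))) * h x"
      unfolding hk_def by (intro tendsto_intros LIMSEQ_inverse_real_of_nat)
    then show ?thesis by simp
  qed
  have fthk: "ft (hk n) \<xi> = (LINT y|lborel. p y * gauss (?r n) (\<xi> - y))" for n \<xi>
  proof -
    have "ft (hk n) \<xi> = \<bar>-1\<bar> *\<^sub>R (LINT x|lborel. hk n (0 + -1 * x) * cis (- ((0 + -1 * x) * \<xi>)))"
      unfolding ft_def by (rule lborel_integral_real_affine) simp
    also have "\<dots> = (LINT x|lborel. (ft p x * (of_real (exp (- (?r n * x\<^sup>2))) * cis (\<xi> * x))) / (2 * pi))"
      by (simp add: hk_def h_def mult_ac)
    also have "\<dots> = (LINT y|lborel. p y * gauss (?r n) (\<xi> - y))"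
      unfolding integral_divide_zero integral_ft_gauss[OF p(1) r] by simp
    finally show ?thesis .
  qed
  fix n :: nat
  let ?t = "\<lambda>x. indicator {-real n..real n} x *\<^sub>R h x"
  note t = truncation_integrable[OF L2h, of "real n"]
  have [measurable]: "ft ?t \<in> borel_measurable borel" "ft (hk k) \<in> borel_measurable borel" for k
    by (intro borel_measurable_ft t hk1)+
  show "(\<integral>\<^sup>+ \<xi>. ennreal ((cmod (truncated_fourier (real n) h \<xi> - p \<xi>))\<^sup>2) \<partial>lborel) \<le>
      ennreal (2 * pi * (LINT x|lborel. (cmod (?t x - h x))\<^sup>2))"
    unfolding truncated_fourier_eq_ft
  proof (rule nn_integral_limit_le)
    show "(\<integral>\<^sup>+ \<xi>. ennreal ((cmod (ft ?t \<xi> - ft (hk k) \<xi>))\<^sup>2) \<partial>lborel) \<le>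
      ennreal (2 * pi * (LINT x|lborel. (cmod (?t x - hk k x))\<^sup>2))" for k
      by (rule ft_diff_le[OF t hk1 hk2])
    show "AE \<xi> in lborel. (\<lambda>k. ennreal ((cmod (ft ?t \<xi> - ft (hk k) \<xi>))\<^sup>2)) \<longlonglongrightarrow> ennreal ((cmod (ft ?t \<xi> - p \<xi>))\<^sup>2)"
      using cont
    proof eventually_elim
      fix \<xi> assume "isCont p \<xi>"
      then show "(\<lambda>k. ennreal ((cmod (ft ?t \<xi> - ft (hk k) \<xi>))\<^sup>2)) \<longlonglongrightarrow> ennreal ((cmod (ft ?t \<xi> - p \<xi>))\<^sup>2)"
        unfolding fthk by (intro tendsto_intros tendsto_ennrealI gauss_approx_identity p r LIMSEQ_inverse_real_of_nat)
    qed
    show "(\<lambda>k. ennreal (2 * pi * (LINT x|lborel. (cmod (?t x - hk k x))\<^sup>2))) \<longlonglongrightarrow>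
       ennreal (2 * pi * (LINT x|lborel. (cmod (?t x - h x))\<^sup>2))"
    proof (intro tendsto_intros tendsto_ennrealI integral_dominated_convergence[where w = "\<lambda>x. 4 * (cmod (h x))\<^sup>2"])
      show "AE x in lborel. (\<lambda>k. (cmod (?t x - hk k x))\<^sup>2) \<longlonglongrightarrow> (cmod (?t x - h x))\<^sup>2"
        by (intro AE_I2 tendsto_intros hkh)
      have "(cmod (?t x - hk k x))\<^sup>2 \<le> 4 * (cmod (h x))\<^sup>2" for x k
      proof -
        have "cmod (?t x - hk k x) \<le> 2 * cmod (h x)"
          using norm_triangle_ineq4[of "?t x" "hk k x"] hkle[of k x] norm_ge_zero[of "h x"]
          by (cases "x \<in> {-real n..real n}") (simp_all del: norm_ge_zero)
        then have "(cmod (?t x - hk k x))\<^sup>2 \<le> (2 * cmod (h x))\<^sup>2" by (intro power_mono) auto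
        then show ?thesis by (simp add: power_mult_distrib)
      qed
      then show "AE x in lborel. norm ((cmod (?t x - hk k x))\<^sup>2) \<le> 4 * (cmod (h x))\<^sup>2" for k by simp
    qed (use h2 in auto)
  qed measurable
qed

section \<open>Sobolev embedding\<close>

abbreviation cx :: "(real \<Rightarrow> real) \<Rightarrow> real \<Rightarrow> complex" where
  "cx f \<equiv> \<lambda>x. complex_of_real (f x)"

lemma sobolev_L2:
  assumes "f \<in> sobolev s"
  shows "integrable lborel (\<lambda>x. (cmod (cx f x))\<^sup>2)"
  using assms by (simp add: sobolev_def L2_def)

lemma sobolev_fourier_eq_ft:
  assumes "f \<in> sobolev s" "integrable lborel f"
  shows "AE \<xi> in lborel. fourier (cx f) \<xi> = ft (cx f) \<xi>"
  by (rule fourier_eq_ft[OF integrable_of_real[OF assms(2)] sobolev_L2[OF assms(1)]])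

lemma fourier_measurable:
  assumes "f \<in> sobolev s" "integrable lborel f"
  shows "fourier (cx f) \<in> borel_measurable borel"
proof -
  have "has_fourier (cx f) (fourier (cx f))"
    by (rule has_fourier_fourier[OF has_fourier_ft[OF integrable_of_real[OF assms(2)] sobolev_L2[OF assms(1)]]])
  then show ?thesis by (simp add: has_fourier_def L2_def)
qed

text \<open>The weighted estimates are carried out on \<open>ft\<close>, which is continuous and
  linear on integrable functions, whereas \<open>fourier\<close> is an arbitrary representative; the
  two agree almost everywhere.\<close>

lemma sobolev_ft:
  assumes f: "f \<in> sobolev s" "integrable lborel f"
  shows "integrable lborel (\<lambda>\<xi>. (1 + \<xi>\<^sup>2) powr s * (cmod (ft (cx f) \<xi>))\<^sup>2)"
    and "(LINT \<xi>|lborel. (1 + \<xi>\<^sup>2) powr s * (cmod (ft (cx f) \<xi>))\<^sup>2) = (sobolev_norm s f)\<^sup>2"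
proof -
  note [measurable] = fourier_measurable[OF f] borel_measurable_ft[OF integrable_of_real[OF f(2)]]
  have ae: "AE \<xi> in lborel. (1 + \<xi>\<^sup>2) powr s * (cmod (fourier (cx f) \<xi>))\<^sup>2 =
     (1 + \<xi>\<^sup>2) powr s * (cmod (ft (cx f) \<xi>))\<^sup>2"
    using sobolev_fourier_eq_ft[OF f] by eventually_elim simp
  have "integrable lborel (\<lambda>\<xi>. (1 + \<xi>\<^sup>2) powr s * (cmod (fourier (cx f) \<xi>))\<^sup>2)"
    using f by (simp add: sobolev_def)
  then show "integrable lborel (\<lambda>\<xi>. (1 + \<xi>\<^sup>2) powr s * (cmod (ft (cx f) \<xi>))\<^sup>2)"
    by (rule integrable_cong_AE_imp[OF _ _ ae]) measurable
  have "(LINT \<xi>|lborel. (1 + \<xi>\<^sup>2) powr s * (cmod (fourier (cx f) \<xi>))\<^sup>2) =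
     (LINT \<xi>|lborel. (1 + \<xi>\<^sup>2) powr s * (cmod (ft (cx f) \<xi>))\<^sup>2)"
    by (rule integral_cong_AE) (use ae in auto)
  moreover have "(LINT \<xi>|lborel. (1 + \<xi>\<^sup>2) powr s * (cmod (fourier (cx f) \<xi>))\<^sup>2) \<ge> 0"
    by (intro integral_nonneg_AE) auto
  ultimately show "(LINT \<xi>|lborel. (1 + \<xi>\<^sup>2) powr s * (cmod (ft (cx f) \<xi>))\<^sup>2) = (sobolev_norm s f)\<^sup>2"
    by (simp add: sobolev_norm_def)
qed

lemma integrable_one_plus_abs_powr:
  fixes q :: real
  assumes q: "q > 1"
  shows "integrable lborel (\<lambda>\<xi>::real. (1 + \<bar>\<xi>\<bar>) powr (- q))"
proof -
  define g where "g \<xi> = indicator {0..} \<xi> * (1 + \<bar>\<xi>\<bar>) powr (- q)" for \<xi> :: real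
  have [measurable]: "g \<in> borel_measurable borel" unfolding g_def by measurable
  have "(\<integral>\<^sup>+x. ennreal ((1 + \<bar>x\<bar>) powr (- q)) * indicator {0 ..} x \<partial>lborel) =
     ennreal (0 - (- ((1 + 0) powr (1 - q)) / (q - 1)))"
  proof (rule nn_integral_FTC_atLeast)
    show "((\<lambda>x. - ((1 + x) powr (1 - q)) / (q - 1)) \<longlongrightarrow> 0) at_top"
      using q by real_asymp
    show "((\<lambda>x. - ((1 + x) powr (1 - q)) / (q - 1)) has_real_derivative (1 + \<bar>x\<bar>) powr (- q)) (at x)" if "0 \<le> x" for x
      using that q by (auto intro!: derivative_eq_intros simp: divide_simps) (simp add: algebra_simps)
  qed auto
  also have "(\<integral>\<^sup>+x. ennreal ((1 + \<bar>x\<bar>) powr (- q)) * indicator {0 ..} x \<partial>lborel) = (\<integral>\<^sup>+x. ennreal (norm (g x)) \<partial>lborel)"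
    by (intro nn_integral_cong) (auto simp: g_def indicator_def)
  finally have g: "integrable lborel g"
    by (intro integrableI_bounded) auto
  from lborel_integrable_real_affine[OF g, of "-1" 0] have "integrable lborel (\<lambda>x. g (- x))" by simp
  with g have "integrable lborel (\<lambda>x. g x + g (- x))" by simp
  then show ?thesis
    by (rule Bochner_Integration.integrable_bound) (auto simp: g_def indicator_def)
qed

text \<open>Cauchy-Schwarz in disguise: a bound by \<open>K * l + N^2 / l\<close> for all positive
  \<open>l\<close> is used at \<open>l = N\<close>, and for \<open>N = 0\<close> with
  \<open>l\<close> tending to 0.\<close>

lemma scale_bound:
  fixes x K N :: real
  assumes le: "\<And>l. l > 0 \<Longrightarrow> x \<le> K * l + N\<^sup>2 / l" and K: "K \<ge> 0" and N: "N \<ge> 0"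
  shows "x \<le> (K + 1) * N"
proof (cases "N = 0")
  case True
  have "x \<le> e" if "e > 0" for e
  proof -
    have "x \<le> K * (e / (K + 1))" using le[of "e / (K + 1)"] that K True by simp
    also have "\<dots> \<le> (K + 1) * (e / (K + 1))" using that K by (intro mult_right_mono) auto
    also have "\<dots> = e" using K by simp
    finally show ?thesis .
  qed
  then show ?thesis using True field_le_epsilon[of x 0] by auto
next
  case False
  then show ?thesis using le[of N] N by (simp add: field_simps power2_eq_square)
qed

text \<open>The function (1 + |\<xi>|) (1 + \<xi>^2)^(-s/2) is square integrable exactly when 2 s -
  2 > 1, that is s > 3/2. Its product with the square root of the Sobolev density is then
  integrable.\<close>

lemma sobolev_ft_weighted_bound:
  assumes s: "s > 3/2"
  obtains C where "C > 0"
    and "\<And>f. \<lbrakk>f \<in> sobolev s; integrable lborel f\<rbrakk> \<Longrightarrow>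
      integrable lborel (\<lambda>\<xi>. (1 + \<bar>\<xi>\<bar>) * cmod (ft (cx f) \<xi>)) \<and>
      (LINT \<xi>|lborel. (1 + \<bar>\<xi>\<bar>) * cmod (ft (cx f) \<xi>)) \<le> C * sobolev_norm s f"
proof -
  \<comment> \<open>A majorant of (1 + |\<xi>|)^2 / (1 + \<xi>^2)^s; the factor
    \<open>2 powr s\<close> comes from (1 + |\<xi>|)^2 \<le> 2 (1 + \<xi>^2).\<close>
  define A where "A \<xi> = 2 powr s * (1 + \<bar>\<xi>\<bar>) powr (- (2 * s - 2))" for \<xi> :: real
  define K where "K = (LINT \<xi>|lborel. A \<xi>)"
  have A: "integrable lborel A"
    unfolding A_def by (intro integrable_mult_right integrable_one_plus_abs_powr) (use s in auto)
  have A0: "A \<xi> \<ge> 0" for \<xi> unfolding A_def by simp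
  have K: "K \<ge> 0" unfolding K_def by (intro integral_nonneg_AE) (simp add: A0)
  have key: "(1 + \<bar>\<xi>\<bar>) * a \<le> A \<xi> * l + (1 + \<xi>\<^sup>2) powr s * a\<^sup>2 / l" if "a \<ge> 0" "l > 0" for \<xi> a l :: real
  proof -
    define w where "w = (1 + \<xi>\<^sup>2) powr s"
    have "1 + \<xi>\<^sup>2 > 0" by (simp add: add_pos_nonneg)
    then have w: "w > 0" unfolding w_def by simp
    have "(1 + \<bar>\<xi>\<bar>)\<^sup>2 / w \<le> A \<xi>"
    proof -
      have "(1 + \<bar>\<xi>\<bar>)\<^sup>2 \<le> 2 * (1 + \<xi>\<^sup>2)"
        using sum_squares_bound[of 1 "\<bar>\<xi>\<bar>"] by (simp add: power2_sum)
      then have "((1 + \<bar>\<xi>\<bar>)\<^sup>2) powr s \<le> (2 * (1 + \<xi>\<^sup>2)) powr s"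
        using s by (intro powr_mono2) auto
      then have "(1 + \<bar>\<xi>\<bar>) powr (2 * s) \<le> 2 powr s * w"
        unfolding w_def
        by (simp add: powr_mult powr_powr del: distrib_left_numeral flip: powr_numeral)
      then have "(1 + \<bar>\<xi>\<bar>) powr (- (2 * s - 2)) * (1 + \<bar>\<xi>\<bar>) powr (2 * s) \<le>
          (1 + \<bar>\<xi>\<bar>) powr (- (2 * s - 2)) * (2 powr s * w)"
        by (intro mult_left_mono) auto
      moreover have "(1 + \<bar>\<xi>\<bar>) powr (- (2 * s - 2)) * (1 + \<bar>\<xi>\<bar>) powr (2 * s) = (1 + \<bar>\<xi>\<bar>)\<^sup>2"
        by (simp flip: powr_add powr_numeral)
      ultimately have "(1 + \<bar>\<xi>\<bar>)\<^sup>2 \<le> A \<xi> * w"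
        unfolding A_def by (simp only: mult_ac)
      then show ?thesis
        using w by (simp only: pos_divide_le_eq)
    qed
    moreover have "(1 + \<bar>\<xi>\<bar>) * a \<le> (1 + \<bar>\<xi>\<bar>)\<^sup>2 / w * l + w * a\<^sup>2 / l"
    proof -
      define p q where "p = (1 + \<bar>\<xi>\<bar>) * sqrt (l / w)" and "q = a * sqrt (w / l)"
      have pq: "p * q = (1 + \<bar>\<xi>\<bar>) * a"
        using w that by (simp add: p_def q_def real_sqrt_divide)
      have "p\<^sup>2 = (1 + \<bar>\<xi>\<bar>)\<^sup>2 / w * l" "q\<^sup>2 = w * a\<^sup>2 / l"
        using w that by (auto simp: p_def q_def power_mult_distrib)
      moreover have "p * q \<le> p\<^sup>2 + q\<^sup>2"
      proof -
        have "0 \<le> p * q" using pq that by simp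
        then show ?thesis using sum_squares_bound[of p q] by linarith
      qed
      ultimately show ?thesis using pq by simp
    qed
    ultimately show ?thesis
      unfolding w_def using that(2) by (meson add_right_mono less_imp_le mult_right_mono order_trans)
  qed
  show ?thesis
  proof
    show "K + 1 > 0" using K by simp
    fix f assume f: "f \<in> sobolev s" "integrable lborel f"
    let ?F = "\<lambda>\<xi>. cmod (ft (cx f) \<xi>)"
    note [measurable] = borel_measurable_ft[OF integrable_of_real[OF f(2)]]
    note W = sobolev_ft[OF f]
    have int: "integrable lborel (\<lambda>\<xi>. A \<xi> * l + (1 + \<xi>\<^sup>2) powr s * (?F \<xi>)\<^sup>2 / l)" for l
      using A W(1) by simp
    have int1: "integrable lborel (\<lambda>\<xi>. (1 + \<bar>\<xi>\<bar>) * ?F \<xi>)"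
      by (rule Bochner_Integration.integrable_bound[OF int[of 1]])
         (use key[of _ 1] A0 in \<open>auto simp: abs_mult\<close>)
    have "(LINT \<xi>|lborel. (1 + \<bar>\<xi>\<bar>) * ?F \<xi>) \<le> K * l + (sobolev_norm s f)\<^sup>2 / l" if "l > 0" for l
    proof -
      have "(LINT \<xi>|lborel. (1 + \<bar>\<xi>\<bar>) * ?F \<xi>) \<le> (LINT \<xi>|lborel. A \<xi> * l + (1 + \<xi>\<^sup>2) powr s * (?F \<xi>)\<^sup>2 / l)"
        by (intro integral_mono int1 int key that) auto
      also have "\<dots> = K * l + (sobolev_norm s f)\<^sup>2 / l"
        using A W by (simp add: K_def)
      finally show ?thesis .
    qed
    then have "(LINT \<xi>|lborel. (1 + \<bar>\<xi>\<bar>) * ?F \<xi>) \<le> (K + 1) * sobolev_norm s f"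
      by (rule scale_bound) (use K in \<open>auto simp: sobolev_norm_def intro!: integral_nonneg_AE\<close>)
    with int1 show "integrable lborel (\<lambda>\<xi>. (1 + \<bar>\<xi>\<bar>) * ?F \<xi>) \<and>
      (LINT \<xi>|lborel. (1 + \<bar>\<xi>\<bar>) * ?F \<xi>) \<le> (K + 1) * sobolev_norm s f" by simp
  qed
qed

text \<open>The mean value theorem bounds every difference quotient by \<open>w\<close>, so
  dominated convergence along an arbitrary null sequence gives the derivative.\<close>

lemma DERIV_under_integral:
  fixes g g' :: "real \<Rightarrow> 'a \<Rightarrow> real"
  assumes g: "\<And>x. integrable M (g x)"
    and d: "\<And>x \<xi>. ((\<lambda>x. g x \<xi>) has_real_derivative g' x \<xi>) (at x)"
    and b: "\<And>x \<xi>. \<bar>g' x \<xi>\<bar> \<le> w \<xi>" and w: "integrable M w"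
    and [measurable]: "\<And>x. g' x \<in> borel_measurable M"
  shows "((\<lambda>x. LINT \<xi>|M. g x \<xi>) has_real_derivative (LINT \<xi>|M. g' x \<xi>)) (at x)"
  unfolding DERIV_def LIMSEQ_SEQ_conv[symmetric]
proof safe
  fix S :: "nat \<Rightarrow> real" assume S: "\<forall>n. S n \<noteq> 0" "S \<longlonglongrightarrow> 0"
  have [measurable]: "g x \<in> borel_measurable M" for x using g by auto
  have "(\<lambda>n. LINT \<xi>|M. (g (x + S n) \<xi> - g x \<xi>) / S n) \<longlonglongrightarrow> (LINT \<xi>|M. g' x \<xi>)"
  proof (rule integral_dominated_convergence[where w = w])
    show "AE \<xi> in M. (\<lambda>n. (g (x + S n) \<xi> - g x \<xi>) / S n) \<longlonglongrightarrow> g' x \<xi>"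
      using d[of _ x] S unfolding DERIV_def LIMSEQ_SEQ_conv[symmetric] by auto
    fix n
    have "\<bar>(g (x + S n) \<xi> - g x \<xi>) / S n\<bar> \<le> w \<xi>" for \<xi>
    proof -
      have "\<bar>g (x + S n) \<xi> - g x \<xi>\<bar> \<le> w \<xi> * \<bar>x + S n - x\<bar>"
        using field_differentiable_bound[of UNIV "\<lambda>x. g x \<xi>" "\<lambda>x. g' x \<xi>" "w \<xi>" "x + S n" x] d b by simp
      then show ?thesis using S(1) by (simp add: field_simps)
    qed
    then show "AE \<xi> in M. norm ((g (x + S n) \<xi> - g x \<xi>) / S n) \<le> w \<xi>" by simp
  qed (use w in auto)
  moreover have "(LINT \<xi>|M. (g (x + S n) \<xi> - g x \<xi>) / S n) = ((LINT \<xi>|M. g (x + S n) \<xi>) - (LINT \<xi>|M. g x \<xi>)) / S n" for n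
    unfolding integral_divide_zero Bochner_Integration.integral_diff[OF g g] ..
  ultimately show "(\<lambda>n. ((LINT \<xi>|M. g (x + S n) \<xi>) - (LINT \<xi>|M. g x \<xi>)) / S n) \<longlonglongrightarrow> (LINT \<xi>|M. g' x \<xi>)" by (simp only:)
qed

text \<open>By inversion \<open>f\<close> and its derivative are Fourier integrals of
  \<open>ft f\<close> and of i \<xi> times \<open>ft f\<close>, both dominated by the same weighted
  integral. One constant serves all \<open>f\<close>, so the bounds can be applied to the difference
  of a curve at two times.\<close>

lemma sobolev_embedding:
  assumes s: "s > 3/2"
  obtains C where "C > 0"
    and "\<And>f x. \<lbrakk>f \<in> sobolev s; integrable lborel f; continuous_on UNIV f\<rbrakk> \<Longrightarrow>
      \<bar>f x\<bar> \<le> C * sobolev_norm s f \<and> f differentiable (at x) \<and> \<bar>deriv f x\<bar> \<le> C * sobolev_norm s f"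
proof -
  obtain C where C: "C > 0" and CC: "\<And>f. \<lbrakk>f \<in> sobolev s; integrable lborel f\<rbrakk> \<Longrightarrow>
      integrable lborel (\<lambda>\<xi>. (1 + \<bar>\<xi>\<bar>) * cmod (ft (cx f) \<xi>)) \<and>
      (LINT \<xi>|lborel. (1 + \<bar>\<xi>\<bar>) * cmod (ft (cx f) \<xi>)) \<le> C * sobolev_norm s f"
    using sobolev_ft_weighted_bound[OF s] by blast
  show ?thesis
  proof
    show "C > 0" by fact
    fix f x assume f: "f \<in> sobolev s" "integrable lborel f" and cont: "continuous_on UNIV f"
    let ?F = "ft (cx f)"
    define N where "N = (LINT \<xi>|lborel. (1 + \<bar>\<xi>\<bar>) * cmod (?F \<xi>))"
    note [measurable] = borel_measurable_ft[OF integrable_of_real[OF f(2)]]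
    have w: "integrable lborel (\<lambda>\<xi>. (1 + \<bar>\<xi>\<bar>) * cmod (?F \<xi>))" and NC: "N \<le> C * sobolev_norm s f"
      using CC[OF f] by (auto simp: N_def)
    have N0: "N \<ge> 0" unfolding N_def by (intro integral_nonneg_AE) auto
    have F: "integrable lborel ?F"
      by (rule Bochner_Integration.integrable_bound[OF w]) (auto simp: abs_mult mult_le_cancel_right1)
    define g g' where "g x \<xi> = Re (?F \<xi> * cis (x * \<xi>)) / (2 * pi)"
      and "g' x \<xi> = - \<xi> * Im (?F \<xi> * cis (x * \<xi>)) / (2 * pi)" for x \<xi>
    have fg: "f x = (LINT \<xi>|lborel. g x \<xi>)" for x
    proof -
      have "isCont (cx f) x"
        using cont by (intro continuous_intros) (simp add: continuous_on_eq_continuous_at)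
      from arg_cong[OF fourier_inversion[OF integrable_of_real[OF f(2)] this F], of Re]
      have "f x = Re (LINT \<xi>|lborel. ?F \<xi> * cis (x * \<xi>)) / (2 * pi)"
        by (simp add: Re_divide_of_real[of _ "2 * pi", simplified])
      also have "Re (LINT \<xi>|lborel. ?F \<xi> * cis (x * \<xi>)) = (LINT \<xi>|lborel. Re (?F \<xi> * cis (x * \<xi>)))"
        by (rule integral_Re[symmetric]) (simp add: F)
      finally show ?thesis unfolding g_def by simp
    qed
    have 1: "\<bar>Re (?F \<xi> * cis (x * \<xi>))\<bar> \<le> cmod (?F \<xi>)" "\<bar>Im (?F \<xi> * cis (x * \<xi>))\<bar> \<le> cmod (?F \<xi>)" for x \<xi>
      using abs_Re_le_cmod[of "?F \<xi> * cis (x * \<xi>)"] abs_Im_le_cmod[of "?F \<xi> * cis (x * \<xi>)"] by (auto simp: norm_mult)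
    have pi: "a / (2 * pi) \<le> a" if "a \<ge> 0" for a
      using that pi_gt3 by (simp add: divide_le_eq mult_le_cancel_left1)
    have bg: "\<bar>g x \<xi>\<bar> \<le> (1 + \<bar>\<xi>\<bar>) * cmod (?F \<xi>)" for x \<xi>
    proof -
      have "\<bar>g x \<xi>\<bar> \<le> \<bar>Re (?F \<xi> * cis (x * \<xi>))\<bar>"
        using pi[of "\<bar>Re (?F \<xi> * cis (x * \<xi>))\<bar>"] by (simp add: g_def del: Re_complex_of_real times_complex.simps)
      also have "\<dots> \<le> 1 * cmod (?F \<xi>)" using 1 by simp
      also have "\<dots> \<le> (1 + \<bar>\<xi>\<bar>) * cmod (?F \<xi>)" by (intro mult_right_mono) auto
      finally show ?thesis .
    qed
    have bg': "\<bar>g' x \<xi>\<bar> \<le> (1 + \<bar>\<xi>\<bar>) * cmod (?F \<xi>)" for x \<xi>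
    proof -
      have "\<bar>g' x \<xi>\<bar> \<le> \<bar>\<xi>\<bar> * \<bar>Im (?F \<xi> * cis (x * \<xi>))\<bar>"
        using pi[of "\<bar>\<xi>\<bar> * \<bar>Im (?F \<xi> * cis (x * \<xi>))\<bar>"] by (simp add: g'_def abs_mult del: times_complex.simps)
      also have "\<dots> \<le> (1 + \<bar>\<xi>\<bar>) * cmod (?F \<xi>)" using 1 by (intro mult_mono) auto
      finally show ?thesis .
    qed
    have gm: "g x \<in> borel_measurable borel" "g' x \<in> borel_measurable borel" for x
      unfolding g_def g'_def by measurable
    have g: "integrable lborel (g x)" for x
      by (rule Bochner_Integration.integrable_bound[OF w]) (use gm bg in \<open>auto simp: abs_mult\<close>)
    have g': "integrable lborel (g' x)" for x
      by (rule Bochner_Integration.integrable_bound[OF w]) (use gm bg' in \<open>auto simp: abs_mult\<close>)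
    have D: "(f has_real_derivative (LINT \<xi>|lborel. g' x \<xi>)) (at x)"
      unfolding fg
    proof (rule DERIV_under_integral[OF g _ bg' w])
      show "((\<lambda>x. g x \<xi>) has_real_derivative g' x \<xi>) (at x)" for x \<xi>
        unfolding g_def g'_def by (auto intro!: derivative_eq_intros simp: field_simps)
    qed (use gm in auto)
    have le: "\<bar>LINT \<xi>|lborel. k \<xi>\<bar> \<le> N" if "integrable lborel k" "\<And>\<xi>. \<bar>k \<xi>\<bar> \<le> (1 + \<bar>\<xi>\<bar>) * cmod (?F \<xi>)" for k :: "real \<Rightarrow> real"
    proof -
      have "\<bar>LINT \<xi>|lborel. k \<xi>\<bar> \<le> (LINT \<xi>|lborel. \<bar>k \<xi>\<bar>)"
        using integral_norm_bound[of lborel k] by simp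
      also have "\<dots> \<le> N" unfolding N_def
        by (intro integral_mono w that integrable_abs)
      finally show ?thesis .
    qed
    have "\<bar>f x\<bar> \<le> N" unfolding fg by (intro le g bg)
    moreover have "\<bar>deriv f x\<bar> \<le> N" unfolding DERIV_imp_deriv[OF D] by (intro le g' bg')
    moreover have "f differentiable (at x)" using D real_differentiable_def by blast
    ultimately show "\<bar>f x\<bar> \<le> C * sobolev_norm s f \<and> f differentiable (at x) \<and> \<bar>deriv f x\<bar> \<le> C * sobolev_norm s f"
      using NC by auto
  qed
qed

section \<open>Existence of the Hilbert transform\<close>

text \<open>The set where two continuous functions differ is open, and a null open set is empty. The
  open set \<open>S\<close> makes room for the jump of the sign function at frequency 0.\<close>

lemma AE_eq_imp_eq_on_open:
  fixes f g :: "real \<Rightarrow> complex"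
  assumes ae: "AE x in lborel. f x = g x" and S: "open S"
    and f: "continuous_on S f" and g: "continuous_on S g" and x: "x \<in> S"
  shows "f x = g x"
proof (rule ccontr)
  assume ne: "f x \<noteq> g x"
  let ?U = "{y \<in> S. f y \<noteq> g y}"
  have "?U = S \<inter> (\<lambda>y. f y - g y) -` (- {0})" by auto
  moreover have "open (S \<inter> (\<lambda>y. f y - g y) -` (- {0}))"
    by (intro continuous_open_preimage S continuous_intros f g open_Compl)
  ultimately have "open ?U" by (simp add: Int_commute)
  moreover have "negligible ?U"
  proof -
    have "{y. f y \<noteq> g y} \<in> null_sets (completion lborel)"
      using ae by (auto simp: eventually_ae_filter null_sets_completion_iff2)
    then have "{y. f y \<noteq> g y} \<in> null_sets lebesgue" by simp
    then have "negligible {y. f y \<noteq> g y}" by (simp add: negligible_iff_null_sets)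
    then show ?thesis by (rule negligible_subset) auto
  qed
  ultimately show False using open_not_negligible x ne by blast
qed

lemma ft_uminus_cnj:
  assumes "integrable lborel f"
  shows "ft (cx f) (- \<xi>) = cnj (ft (cx f) \<xi>)"
proof -
  have "ft (cx f) (- \<xi>) = (LINT x|lborel. cnj (cx f x * cis (- (x * \<xi>))))"
    unfolding ft_def by (intro Bochner_Integration.integral_cong refl) (simp add: cis_cnj)
  then show ?thesis unfolding ft_def by (simp only: Bochner_Integration.integral_cnj)
qed

lemma isCont_hilbert_symbol:
  assumes "integrable lborel f" "\<xi> \<noteq> 0"
  shows "isCont (\<lambda>\<xi>. - \<i> * of_real (sgn \<xi>) * ft (cx f) \<xi>) \<xi>"
  by (intro continuous_intros isCont_ft integrable_of_real assms) 

text \<open>The symbol -i sgn(\<xi>) times the transform of \<open>f\<close> is integrable, so its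
  inverse transform is an honest continuous function. \<open>has_fourier_inverse\<close> asks for
  continuity of the symbol almost everywhere, and that can fail only at 0.\<close>

lemma hilbert_exists:
  assumes s: "s > 3/2" and f: "f \<in> sobolev s" "integrable lborel f"
  shows "\<exists>k. is_hilbert f k \<and> continuous_on UNIV k"
proof -
  let ?F = "ft (cx f)"
  define p where "p \<xi> = - \<i> * of_real (sgn \<xi>) * ?F \<xi>" for \<xi> :: real
  note [measurable] = borel_measurable_ft[OF integrable_of_real[OF f(2)]] fourier_measurable[OF f]
  obtain C where "integrable lborel (\<lambda>\<xi>. (1 + \<bar>\<xi>\<bar>) * cmod (?F \<xi>))"
    using sobolev_ft_weighted_bound[OF s] f by blast
  then have "integrable lborel ?F"
    by (rule Bochner_Integration.integrable_bound) (auto simp: abs_mult mult_le_cancel_right1)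
  then have p1: "integrable lborel p"
    unfolding p_def by (rule Bochner_Integration.integrable_bound) (auto simp: norm_mult sgn_if)
  have "integrable lborel (\<lambda>\<xi>. (cmod (?F \<xi>))\<^sup>2)"
    using L2_ft[OF integrable_of_real[OF f(2)] sobolev_L2[OF f(1)]] by (simp add: L2_def)
  then have p2: "integrable lborel (\<lambda>\<xi>. (cmod (p \<xi>))\<^sup>2)"
    unfolding p_def by (rule Bochner_Integration.integrable_bound) (auto simp: norm_mult sgn_if)
  have contp: "isCont p \<xi>" if "\<xi> \<noteq> 0" for \<xi>
    unfolding p_def using isCont_hilbert_symbol[OF f(2) that] .
  have ae: "AE \<xi> in lborel. isCont p \<xi>"
    using AE_lborel_singleton[of "0 :: real"] by (rule eventually_mono) (erule contp)
  define h where "h x = ft p (- x) / (2 * pi)" for x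
  have "has_fourier h p" unfolding h_def by (rule has_fourier_inverse[OF p1 p2 ae])
  moreover have "AE \<xi> in lborel. p \<xi> = - \<i> * of_real (sgn \<xi>) * fourier (cx f) \<xi>"
    using sobolev_fourier_eq_ft[OF f] by eventually_elim (simp add: p_def)
  ultimately have "has_fourier h (\<lambda>\<xi>. - \<i> * of_real (sgn \<xi>) * fourier (cx f) \<xi>)"
    by (rule has_fourier_cong_AE) measurable
  moreover have hr: "h x = of_real (Re (h x))" for x
  proof -
    \<comment> \<open>Hermitian symmetry of the symbol, inherited from the real \<open>f\<close> and
      the odd sign function, is what makes \<open>h\<close> real.\<close>
    have p_cnj: "p (- \<xi>) = cnj (p \<xi>)" for \<xi>
      by (simp add: p_def ft_uminus_cnj[OF f(2)] sgn_minus)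
    have "ft p (- x) = \<bar>-1\<bar> *\<^sub>R (LINT \<xi>|lborel. p (0 + -1 * \<xi>) * cis (- ((0 + -1 * \<xi>) * (- x))))"
      unfolding ft_def by (rule lborel_integral_real_affine) simp
    also have "\<dots> = (LINT \<xi>|lborel. cnj (p \<xi> * cis (- (\<xi> * (- x)))))"
      by (simp add: p_cnj cis_cnj)
    also have "\<dots> = cnj (ft p (- x))" unfolding ft_def by (rule Bochner_Integration.integral_cnj)
    finally have "cnj (ft p (- x)) = ft p (- x)" by simp
    then have "cnj (h x) = h x" by (simp add: h_def)
    then show ?thesis by (simp add: complex_eq_iff)
  qed
  ultimately have "is_hilbert f (\<lambda>x. Re (h x))"
    unfolding is_hilbert_def by (simp flip: hr)
  moreover have "continuous_on UNIV (\<lambda>x. Re (h x))"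
  proof -
    have "continuous_on UNIV (ft p)"
      by (simp add: continuous_at_imp_continuous_on isCont_ft p1)
    then have "continuous_on UNIV (\<lambda>x. ft p (- x))"
      by (rule continuous_on_compose2) (auto intro!: continuous_intros)
    then show ?thesis unfolding h_def by (intro continuous_intros) auto
  qed
  ultimately show ?thesis by blast
qed

text \<open>The existence of a continuous transform triggers the implication in the definition of
  \<open>hilbert\<close>, so the selected representative is continuous.\<close>

lemma hilbert_props:
  assumes "s > 3/2" "f \<in> sobolev s" "integrable lborel f"
  shows "is_hilbert f (hilbert f)" "continuous_on UNIV (hilbert f)"
proof -
  obtain k where k: "is_hilbert f k \<and> continuous_on UNIV k" using hilbert_exists[OF assms] by blast
  have "is_hilbert f (hilbert f) \<and> ((\<exists>k. is_hilbert f k \<and> continuous_on UNIV k) \<longrightarrow> continuous_on UNIV (hilbert f))"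
    unfolding hilbert_def by (rule someI[of _ k]) (use k in auto)
  with k show "is_hilbert f (hilbert f)" "continuous_on UNIV (hilbert f)" by auto
qed

text \<open>The defining identity holds almost everywhere. Since \<open>f\<close> and
  \<open>hilbert f\<close> are integrable, both sides are continuous away from 0, and the identity
  becomes pointwise there; at 0 the sign function jumps.\<close>

lemma ft_hilbert:
  assumes s: "s > 3/2" and f: "f \<in> sobolev s" "integrable lborel f" and h: "integrable lborel (hilbert f)"
    and \<xi>: "\<xi> \<noteq> 0"
  shows "ft (cx (hilbert f)) \<xi> = - \<i> * of_real (sgn \<xi>) * ft (cx f) \<xi>"
proof (rule AE_eq_imp_eq_on_open)
  have ish: "has_fourier (cx (hilbert f)) (\<lambda>\<xi>. - \<i> * of_real (sgn \<xi>) * fourier (cx f) \<xi>)"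
    using hilbert_props(1)[OF s f] by (simp add: is_hilbert_def)
  then have "integrable lborel (\<lambda>x. (cmod (cx (hilbert f) x))\<^sup>2)"
    by (auto simp: has_fourier_def L2_def)
  from has_fourier_ft[OF integrable_of_real[OF h] this]
  have "AE \<xi> in lborel. ft (cx (hilbert f)) \<xi> = - \<i> * of_real (sgn \<xi>) * fourier (cx f) \<xi>"
    using has_fourier_unique ish by blast
  with sobolev_fourier_eq_ft[OF f]
  show "AE \<xi> in lborel. ft (cx (hilbert f)) \<xi> = - \<i> * of_real (sgn \<xi>) * ft (cx f) \<xi>"
    by eventually_elim simp
  show "open (- {0::real})" by (simp add: open_Compl)
  show "continuous_on (- {0}) (ft (cx (hilbert f)))"
    by (intro continuous_at_imp_continuous_on ballI isCont_ft integrable_of_real h)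
  show "continuous_on (- {0}) (\<lambda>\<xi>. - \<i> * of_real (sgn \<xi>) * ft (cx f) \<xi>)"
    by (intro continuous_at_imp_continuous_on ballI isCont_hilbert_symbol f) auto
qed (use \<xi> in auto)

text \<open>A compactness argument by bisection. Monotonicity in \<open>B\<close> lets the larger of
  two bounds serve both halves of an interval.\<close>

lemma locally_bounded_imp_bounded:
  fixes P :: "real \<Rightarrow> real \<Rightarrow> bool"
  assumes mono: "\<And>t B B'. P t B \<Longrightarrow> B \<le> B' \<Longrightarrow> P t B'" and ab: "a \<le> b"
    and loc: "\<And>t. t \<in> {a..b} \<Longrightarrow> \<exists>B d. d > 0 \<and> (\<forall>\<tau>\<in>{a..b}. \<bar>\<tau> - t\<bar> < d \<longrightarrow> P \<tau> B)"
  shows "\<exists>B. \<forall>t\<in>{a..b}. P t B"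
proof -
  \<comment> \<open>Named so that the bisection, which varies \<open>a\<close> and \<open>b\<close>,
    leaves the set of admissible times fixed.\<close>
  define S where "S = {a..b}"
  from ab have "\<exists>B. \<forall>t\<in>{a..b} \<inter> S. P t B"
  proof (induction rule: Bolzano)
    case (trans a' b' c')
    then obtain B1 B2 where "\<forall>t\<in>{a'..b'} \<inter> S. P t B1" "\<forall>t\<in>{b'..c'} \<inter> S. P t B2" by blast
    then have "P t (max B1 B2)" if "t \<in> {a'..c'} \<inter> S" for t
      using that mono[of t B1 "max B1 B2"] mono[of t B2 "max B1 B2"] by (cases "t \<le> b'") auto
    then show ?case by blast
  next
    case (local t)
    then obtain B d where d: "d > 0" and B: "\<forall>\<tau>\<in>S. \<bar>\<tau> - t\<bar> < d \<longrightarrow> P \<tau> B"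
      using loc[of t] by (auto simp: S_def)
    have "P \<tau> B" if "c \<le> t" "t \<le> e" "e - c < d" "\<tau> \<in> {c..e} \<inter> S" for c e \<tau>
      using B that by (auto simp: abs_less_iff)
    then show ?case using d by blast
  qed
  then show ?thesis by (simp add: S_def)
qed

section \<open>Continuous curves in $H^s$ and $L^1$\<close>

text \<open>Linearity holds everywhere for \<open>ft\<close> but only up to null sets for
  \<open>fourier\<close>, so the difference is estimated on the classical side and then
  transferred.\<close>

lemma sobolev_diff:
  assumes f: "f \<in> sobolev s" "integrable lborel f" and g: "g \<in> sobolev s" "integrable lborel g"
  shows "(\<lambda>x. f x - g x) \<in> sobolev s"
proof -
  let ?d = "\<lambda>x. f x - g x"
  note [measurable] = borel_measurable_integrable[OF f(2)] borel_measurable_integrable[OF g(2)]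
  note F = borel_measurable_ft[OF integrable_of_real[OF f(2)]] and G = borel_measurable_ft[OF integrable_of_real[OF g(2)]]
  note [measurable] = F G
  have d1: "integrable lborel (cx ?d)" using f g by (intro integrable_of_real) simp
  have d2: "integrable lborel (\<lambda>x. (cmod (cx ?d x))\<^sup>2)"
    using square_integrable_diff[of "cx f" "cx g", OF _ sobolev_L2[OF f(1)] _ sobolev_L2[OF g(1)]]
    by simp
  have Ld: "has_fourier (cx ?d) (fourier (cx ?d))"
    by (rule has_fourier_fourier[OF has_fourier_ft[OF d1 d2]])
  then have [measurable]: "fourier (cx ?d) \<in> borel_measurable borel" by (simp add: has_fourier_def L2_def)
  have eq: "ft (cx ?d) \<xi> = ft (cx f) \<xi> - ft (cx g) \<xi>" for \<xi>
    using ft_diff[OF integrable_of_real[OF f(2)] integrable_of_real[OF g(2)]] by simp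
  have le: "(1 + \<xi>\<^sup>2) powr s * (cmod (ft (cx f) \<xi> - ft (cx g) \<xi>))\<^sup>2 \<le>
      2 * ((1 + \<xi>\<^sup>2) powr s * (cmod (ft (cx f) \<xi>))\<^sup>2) + 2 * ((1 + \<xi>\<^sup>2) powr s * (cmod (ft (cx g) \<xi>))\<^sup>2)" for \<xi>
  proof -
    from cmod_diff_square_le
    have "(1 + \<xi>\<^sup>2) powr s * (cmod (ft (cx f) \<xi> - ft (cx g) \<xi>))\<^sup>2 \<le>
        (1 + \<xi>\<^sup>2) powr s * (2 * (cmod (ft (cx f) \<xi>))\<^sup>2 + 2 * (cmod (ft (cx g) \<xi>))\<^sup>2)"
      by (rule mult_left_mono) auto
    then show ?thesis by (simp add: algebra_simps)
  qed
  have i: "integrable lborel (\<lambda>\<xi>. (1 + \<xi>\<^sup>2) powr s * (cmod (ft (cx f) \<xi> - ft (cx g) \<xi>))\<^sup>2)"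
    by (rule Bochner_Integration.integrable_bound[where f = "\<lambda>\<xi>. 2 * ((1 + \<xi>\<^sup>2) powr s * (cmod (ft (cx f) \<xi>))\<^sup>2) + 2 * ((1 + \<xi>\<^sup>2) powr s * (cmod (ft (cx g) \<xi>))\<^sup>2)"])
       (use sobolev_ft(1)[OF f] sobolev_ft(1)[OF g] le in \<open>auto simp: abs_mult\<close>)
  have ae: "AE \<xi> in lborel. (1 + \<xi>\<^sup>2) powr s * (cmod (ft (cx f) \<xi> - ft (cx g) \<xi>))\<^sup>2 =
     (1 + \<xi>\<^sup>2) powr s * (cmod (fourier (cx ?d) \<xi>))\<^sup>2"
    using fourier_eq_ft[OF d1 d2] by eventually_elim (simp only: eq)
  have "integrable lborel (\<lambda>\<xi>. (1 + \<xi>\<^sup>2) powr s * (cmod (fourier (cx ?d) \<xi>))\<^sup>2)"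
    by (rule integrable_cong_AE_imp[OF i _ ae]) measurable
  moreover have "cx ?d \<in> borel_measurable borel" by measurable
  ultimately show ?thesis using d2 unfolding sobolev_def L2_def by blast
qed

text \<open>Interpreted twice, for the solution and for its Hilbert transform, which have the same
  regularity.\<close>

locale nice_curve =
  fixes s T :: real and v :: "real \<Rightarrow> real \<Rightarrow> real"
  assumes s: "s > 3/2" and T: "T > 0"
    and cont: "\<And>t. t \<in> {0..T} \<Longrightarrow> continuous_on UNIV (v t)"
    and sob: "curve_sobolev s T v" and L1: "curve_L1 T v"
begin

lemma sobolev: "t \<in> {0..T} \<Longrightarrow> v t \<in> sobolev s"
  using sob by (simp add: curve_sobolev_def)

lemma integrable: "t \<in> {0..T} \<Longrightarrow> integrable lborel (v t)"
  using L1 by (simp add: curve_L1_def)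

lemma v_differentiable: "t \<in> {0..T} \<Longrightarrow> v t differentiable (at x)"
  using sobolev_embedding[OF s] sobolev integrable cont by metis

lemma deriv: "t \<in> {0..T} \<Longrightarrow> (v t has_real_derivative deriv (v t) x) (at x)"
  using v_differentiable by (simp add: DERIV_deriv_iff_real_differentiable)

lemma measurable: "t \<in> {0..T} \<Longrightarrow> v t \<in> borel_measurable borel"
  using cont by (rule borel_measurable_continuous_onI)

text \<open>The embedding is applied to the difference of \<open>v \<tau>\<close> and
  \<open>v t\<close>, which turns continuity in the Sobolev norm into uniform closeness of values
  and of first derivatives.\<close>

lemma uniformly_continuous_in_time:
  assumes t: "t \<in> {0..T}" and e: "e > 0"
  shows "\<exists>d>0. \<forall>\<tau>\<in>{0..T}. \<bar>\<tau> - t\<bar> < d \<longrightarrow>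
    (\<forall>x. \<bar>v \<tau> x - v t x\<bar> \<le> e \<and> \<bar>deriv (v \<tau>) x - deriv (v t) x\<bar> \<le> e)"
proof -
  obtain C where C: "C > 0" and emb: "\<And>f x. \<lbrakk>f \<in> sobolev s; integrable lborel f; continuous_on UNIV f\<rbrakk> \<Longrightarrow>
      \<bar>f x\<bar> \<le> C * sobolev_norm s f \<and> f differentiable (at x) \<and> \<bar>deriv f x\<bar> \<le> C * sobolev_norm s f"
    using sobolev_embedding[OF s] by blast
  have "((\<lambda>\<tau>. sobolev_norm s (\<lambda>x. v \<tau> x - v t x)) \<longlongrightarrow> 0) (at t within {0..T})"
    using sob t by (simp add: curve_sobolev_def)
  then have "\<forall>\<^sub>F \<tau> in at t within {0..T}. sobolev_norm s (\<lambda>x. v \<tau> x - v t x) < e / C"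
    using C e by (intro order_tendstoD(2)[where y = 0]) auto
  then obtain d where d: "d > 0" and dd: "\<And>\<tau>. \<tau> \<in> {0..T} \<Longrightarrow> \<tau> \<noteq> t \<Longrightarrow> \<bar>\<tau> - t\<bar> < d \<Longrightarrow> sobolev_norm s (\<lambda>x. v \<tau> x - v t x) < e / C"
    unfolding eventually_at dist_real_def by blast
  have "\<bar>v \<tau> x - v t x\<bar> \<le> e \<and> \<bar>deriv (v \<tau>) x - deriv (v t) x\<bar> \<le> e" if \<tau>: "\<tau> \<in> {0..T}" "\<bar>\<tau> - t\<bar> < d" for \<tau> x
  proof (cases "\<tau> = t")
    case False
    let ?f = "\<lambda>x. v \<tau> x - v t x"
    have "?f \<in> sobolev s" by (intro sobolev_diff sobolev integrable t \<tau>)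
    moreover have "integrable lborel ?f" by (intro Bochner_Integration.integrable_diff integrable t \<tau>)
    moreover have "continuous_on UNIV ?f" by (intro continuous_intros cont t \<tau>)
    ultimately have *: "\<bar>?f x\<bar> \<le> C * sobolev_norm s ?f" "\<bar>deriv ?f x\<bar> \<le> C * sobolev_norm s ?f"
      using emb by blast+
    have "deriv ?f x = deriv (v \<tau>) x - deriv (v t) x"
      by (intro DERIV_imp_deriv DERIV_diff deriv t \<tau>)
    moreover have "C * sobolev_norm s ?f \<le> e"
      using dd[OF \<tau>(1) False \<tau>(2)] C by (simp add: field_simps)
    ultimately show ?thesis using * by simp
  qed (use e in simp)
  then show ?thesis using d by blast
qed

lemma L1_continuous_in_time:
  assumes t: "t \<in> {0..T}" and e: "e > 0"
  shows "\<exists>d>0. \<forall>\<tau>\<in>{0..T}. \<bar>\<tau> - t\<bar> < d \<longrightarrow> (LINT x|lborel. \<bar>v \<tau> x - v t x\<bar>) \<le> e"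
proof -
  have "((\<lambda>\<tau>. L1_norm (\<lambda>x. v \<tau> x - v t x)) \<longlongrightarrow> 0) (at t within {0..T})"
    using L1 t by (simp add: curve_L1_def)
  then have "\<forall>\<^sub>F \<tau> in at t within {0..T}. L1_norm (\<lambda>x. v \<tau> x - v t x) < e"
    using e by (intro order_tendstoD(2)[where y = 0]) auto
  then obtain d where d: "d > 0" and dd: "\<And>\<tau>. \<tau> \<in> {0..T} \<Longrightarrow> \<tau> \<noteq> t \<Longrightarrow> \<bar>\<tau> - t\<bar> < d \<Longrightarrow> L1_norm (\<lambda>x. v \<tau> x - v t x) < e"
    unfolding eventually_at dist_real_def by blast
  have "(LINT x|lborel. \<bar>v \<tau> x - v t x\<bar>) \<le> e" if "\<tau> \<in> {0..T}" "\<bar>\<tau> - t\<bar> < d" for \<tau>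
    using dd[of \<tau>] that e by (cases "\<tau> = t") (auto simp: L1_norm_def)
  then show ?thesis using d by blast
qed

text \<open>Each bound holds near a given time by continuity there, and compactness of
  \<open>{0..T}\<close> makes it uniform.\<close>

lemma bounded:
  obtains S where "S > 0" "\<And>t x. t \<in> {0..T} \<Longrightarrow> \<bar>v t x\<bar> \<le> S" "\<And>t x. t \<in> {0..T} \<Longrightarrow> \<bar>deriv (v t) x\<bar> \<le> S"
    "\<And>t. t \<in> {0..T} \<Longrightarrow> (LINT x|lborel. \<bar>v t x\<bar>) \<le> S"
proof -
  obtain C where C: "C > 0" and emb: "\<And>f x. \<lbrakk>f \<in> sobolev s; integrable lborel f; continuous_on UNIV f\<rbrakk> \<Longrightarrow>
      \<bar>f x\<bar> \<le> C * sobolev_norm s f \<and> f differentiable (at x) \<and> \<bar>deriv f x\<bar> \<le> C * sobolev_norm s f"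
    using sobolev_embedding[OF s] by blast
  let ?P = "\<lambda>t B. (\<forall>x. \<bar>v t x\<bar> \<le> B) \<and> (\<forall>x. \<bar>deriv (v t) x\<bar> \<le> B) \<and> (LINT x|lborel. \<bar>v t x\<bar>) \<le> B"
  have "\<exists>B. \<forall>t\<in>{0..T}. ?P t B"
  proof (rule locally_bounded_imp_bounded)
    fix t assume t: "t \<in> {0..T}"
    obtain d1 where d1: "d1 > 0" "\<And>\<tau> x. \<tau>\<in>{0..T} \<Longrightarrow> \<bar>\<tau> - t\<bar> < d1 \<Longrightarrow>
       \<bar>v \<tau> x - v t x\<bar> \<le> 1 \<and> \<bar>deriv (v \<tau>) x - deriv (v t) x\<bar> \<le> 1"
      using uniformly_continuous_in_time[OF t, of 1] by auto
    obtain d2 where d2: "d2 > 0" "\<And>\<tau>. \<tau>\<in>{0..T} \<Longrightarrow> \<bar>\<tau> - t\<bar> < d2 \<Longrightarrow> (LINT x|lborel. \<bar>v \<tau> x - v t x\<bar>) \<le> 1"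
      using L1_continuous_in_time[OF t, of 1] by auto
    define B1 where "B1 = C * sobolev_norm s (v t)"
    define B2 where "B2 = (LINT x|lborel. \<bar>v t x\<bar>)"
    have B1: "\<bar>v t x\<bar> \<le> B1" "\<bar>deriv (v t) x\<bar> \<le> B1" for x
      using emb[OF sobolev[OF t] integrable[OF t] cont[OF t]] by (auto simp: B1_def)
    have "?P \<tau> (1 + max B1 B2)" if \<tau>: "\<tau> \<in> {0..T}" "\<bar>\<tau> - t\<bar> < min d1 d2" for \<tau>
    proof (intro conjI allI)
      fix x
      have "\<bar>v \<tau> x - v t x\<bar> \<le> 1" "\<bar>deriv (v \<tau>) x - deriv (v t) x\<bar> \<le> 1" using d1(2)[of \<tau> x] \<tau> by auto
      then show "\<bar>v \<tau> x\<bar> \<le> 1 + max B1 B2" "\<bar>deriv (v \<tau>) x\<bar> \<le> 1 + max B1 B2"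
        using B1[of x] by linarith+
      have "(LINT x|lborel. \<bar>v \<tau> x\<bar>) \<le> (LINT x|lborel. \<bar>v \<tau> x - v t x\<bar> + \<bar>v t x\<bar>)"
        by (intro integral_mono Bochner_Integration.integrable_add integrable_abs Bochner_Integration.integrable_diff integrable \<tau> t) auto
      also have "\<dots> = (LINT x|lborel. \<bar>v \<tau> x - v t x\<bar>) + B2"
        unfolding B2_def
        by (intro Bochner_Integration.integral_add integrable_abs Bochner_Integration.integrable_diff integrable \<tau> t)
      also have "\<dots> \<le> 1 + max B1 B2" using d2(2)[of \<tau>] \<tau> by simp
      finally show "(LINT x|lborel. \<bar>v \<tau> x\<bar>) \<le> 1 + max B1 B2" .
    qed
    then show "\<exists>B d. d > 0 \<and> (\<forall>\<tau>\<in>{0..T}. \<bar>\<tau> - t\<bar> < d \<longrightarrow> ?P \<tau> B)"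
      using d1(1) d2(1) by (intro exI[of _ "1 + max B1 B2"] exI[of _ "min d1 d2"]) auto
  qed (use T in \<open>auto intro: order_trans\<close>)
  then obtain B where B: "\<forall>t\<in>{0..T}. ?P t B" by blast
  show ?thesis
  proof (rule that[of "\<bar>B\<bar> + 1"])
    fix t x assume "t \<in> {0..T}"
    with B have "\<bar>v t x\<bar> \<le> B" "\<bar>deriv (v t) x\<bar> \<le> B" "(LINT x|lborel. \<bar>v t x\<bar>) \<le> B" by auto
    then show "\<bar>v t x\<bar> \<le> \<bar>B\<bar> + 1" "\<bar>deriv (v t) x\<bar> \<le> \<bar>B\<bar> + 1" "(LINT x|lborel. \<bar>v t x\<bar>) \<le> \<bar>B\<bar> + 1" by linarith+
  qed auto
qed

lemma jointly_continuous: "continuous_on ({0..T} \<times> UNIV) (\<lambda>(t, x). v t x)"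
  unfolding continuous_on_iff
proof clarify
  fix t x e :: real assume t: "t \<in> {0..T}" and e: "e > 0"
  obtain d1 where d1: "d1 > 0" "\<And>\<tau> x. \<tau>\<in>{0..T} \<Longrightarrow> \<bar>\<tau> - t\<bar> < d1 \<Longrightarrow> \<bar>v \<tau> x - v t x\<bar> \<le> e / 2"
    using uniformly_continuous_in_time[OF t, of "e/2"] e by auto
  obtain d2 where d2: "d2 > 0" "\<And>y. dist y x < d2 \<Longrightarrow> dist (v t y) (v t x) < e / 2"
    using cont[OF t] e unfolding continuous_on_iff by (metis UNIV_I half_gt_zero)
  show "\<exists>d>0. \<forall>p\<in>{0..T} \<times> UNIV. dist p (t, x) < d \<longrightarrow> dist (case p of (t, x) \<Rightarrow> v t x) (v t x) < e"
  proof (intro exI[of _ "min d1 d2"] conjI ballI impI)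
    fix p assume p: "p \<in> {0..T} \<times> (UNIV :: real set)" "dist p (t, x) < min d1 d2"
    obtain \<tau> y where [simp]: "p = (\<tau>, y)" by (cases p)
    have "\<bar>\<tau> - t\<bar> < d1" "dist y x < d2"
      using p(2) dist_fst_le[of p "(t, x)"] dist_snd_le[of p "(t, x)"] by (auto simp: dist_real_def)
    then have "\<bar>v \<tau> y - v t y\<bar> \<le> e / 2" "\<bar>v t y - v t x\<bar> < e / 2"
      using d1(2)[of \<tau> y] d2(2)[of y] p(1) by (auto simp: dist_real_def)
    then have "\<bar>v \<tau> y - v t x\<bar> < e" by linarith
    then show "dist (case p of (t, x) \<Rightarrow> v t x) (v t x) < e"
      by (simp add: dist_real_def)
  qed (use d1 d2 in auto)
qed

end

section \<open>Test functions\<close>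

text \<open>The functions q(1/z) exp(-1/z) for z > 0, extended by 0. The polynomial is a parameter
  so that the family is closed under differentiation and smoothness at 0 is settled for all orders
  by one computation.\<close>

definition flat :: "real poly \<Rightarrow> real \<Rightarrow> real" where
  "flat q z = (if z > 0 then poly q (inverse z) * exp (- inverse z) else 0)"

lemma poly_exp_tendsto_0: "((\<lambda>w::real. poly q w * exp (- w)) \<longlongrightarrow> 0) at_top"
proof -
  have "((\<lambda>w::real. \<Sum>i\<le>degree q. coeff q i * (w ^ i / exp w)) \<longlongrightarrow> (\<Sum>i\<le>degree q. coeff q i * 0)) at_top"
    by (intro tendsto_intros tendsto_power_div_exp_0)
  then show ?thesis
    by (simp add: poly_altdef sum_distrib_right exp_minus divide_inverse mult.assoc)
qed

text \<open>The chain rule gives z^(-2) (q - q')(1/z) exp(-1/z), and \<open>[:0, 0, 1:]\<close> is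
  the square of the variable 1/z. At 0 the difference quotient is again a polynomial times an
  exponential in 1/z, hence tends to 0.\<close>

lemma DERIV_flat:
  "(flat q has_real_derivative flat ([:0, 0, 1:] * (q - pderiv q)) z) (at z)"
proof -
  consider "z > 0" | "z < 0" | "z = 0" by linarith
  then show ?thesis
  proof cases
    case 1
    have "((\<lambda>z. poly q (inverse z) * exp (- inverse z)) has_real_derivative flat ([:0, 0, 1:] * (q - pderiv q)) z) (at z)"
      using 1
      by (auto intro!: derivative_eq_intros poly_DERIV[THEN DERIV_chain2] simp: flat_def power2_eq_square algebra_simps)
    moreover have "\<forall>\<^sub>F z in nhds z. flat q z = poly q (inverse z) * exp (- inverse z)"
      using eventually_nhds_in_open[of "{0<..}" z] 1 by (auto simp: flat_def elim!: eventually_mono)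
    ultimately show ?thesis by (subst DERIV_cong_ev[OF refl _ refl]) auto
  next
    case 2
    have "\<forall>\<^sub>F z in nhds z. flat q z = 0"
      using eventually_nhds_in_open[of "{..<0}" z] 2 by (auto simp: flat_def elim!: eventually_mono)
    then show ?thesis using 2 by (subst DERIV_cong_ev[OF refl _ refl]) (auto simp: flat_def)
  next
    case 3
    have "((\<lambda>h. flat q h / h) \<longlongrightarrow> 0) (at_right 0)"
    proof (rule Lim_transform_eventually)
      show "((\<lambda>h. poly ([:0, 1:] * q) (inverse h) * exp (- inverse h)) \<longlongrightarrow> 0) (at_right 0)"
        by (rule filterlim_compose[OF poly_exp_tendsto_0 filterlim_inverse_at_top_right])
      show "\<forall>\<^sub>F h in at_right 0. poly ([:0, 1:] * q) (inverse h) * exp (- inverse h) = flat q h / h"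
        by (auto simp: flat_def eventually_at_filter divide_inverse)
    qed
    moreover have "((\<lambda>h. flat q h / h) \<longlongrightarrow> 0) (at_left 0)"
      by (rule tendsto_eventually) (auto simp: flat_def eventually_at_filter)
    ultimately have "((\<lambda>h. flat q h / h) \<longlongrightarrow> 0) (at 0)"
      by (rule filterlim_split_at[rotated])
    then show ?thesis using 3 by (simp add: DERIV_def flat_def)
  qed
qed

lemma flat_1_nonneg: "flat 1 y \<ge> 0" and flat_1_pos: "y > 0 \<Longrightarrow> flat 1 y > 0" and flat_1_eq_0: "y \<le> 0 \<Longrightarrow> flat 1 y = 0"
  by (auto simp: flat_def)

lemma isCont_flat: "isCont (flat q) x"
  using DERIV_flat DERIV_isCont by blast

lemma continuous_on_flat [continuous_intros]:
  "continuous_on A f \<Longrightarrow> continuous_on A (\<lambda>x. flat q (f x))"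
  by (rule continuous_on_compose2[of UNIV "flat q"])
     (auto intro: continuous_at_imp_continuous_on isCont_flat)

text \<open>The step is the antiderivative of the bump \<open>flat 1 y * flat 1 (1 - y)\<close>,
  supported in [0, 1], divided by its total mass, which the mean value theorem shows to be
  positive.\<close>

lemma smooth_step_exists:
  "\<exists>P \<rho>. (\<forall>y. (P has_real_derivative \<rho> y) (at y)) \<and> (\<exists>c>0. \<forall>y. \<rho> y = c * (flat 1 y * flat 1 (1 - y))) \<and>
     (\<forall>y\<le>0. P y = 0) \<and> (\<forall>y\<ge>1. P y = 1)"
proof -
  define r where "r y = flat 1 y * flat 1 (1 - y)" for y
  have rc: "continuous_on UNIV r" unfolding r_def by (intro continuous_intros)
  have r0: "r y \<ge> 0" for y by (simp add: r_def flat_1_nonneg)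
  obtain F where F: "\<And>y. (F has_real_derivative r y) (at y)"
    using einterval_antiderivative[of "-\<infinity>" "\<infinity>" r] rc
    by (auto simp: continuous_on_eq_continuous_at has_real_derivative_iff_has_vector_derivative)
  define I where "I = F 1 - F 0"
  have mono: "F x \<le> F y" if "x \<le> y" for x y
    by (rule DERIV_nonneg_imp_nondecreasing[OF that]) (use F r0 in blast)
  have I: "I > 0"
  proof -
    obtain z where z: "0 < z" "z < 1" "F 1 - F 0 = (1 - 0) * r z"
      using MVT2[of 0 1 F r] F by auto
    then have "r z > 0" by (simp add: r_def flat_1_pos)
    then show ?thesis using z by (simp add: I_def)
  qed
  have left: "F y = F 0" if "y \<le> 0" for y
  proof (cases "y < 0")
    case True
    then obtain z where "y < z" "z < 0" "F 0 - F y = (0 - y) * r z"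
      using MVT2[of y 0 F r] F by auto
    then show ?thesis by (simp add: r_def flat_1_eq_0)
  qed (use that in simp)
  have right: "F y = F 1" if "y \<ge> 1" for y
  proof (cases "y > 1")
    case True
    then obtain z where "1 < z" "z < y" "F y - F 1 = (y - 1) * r z"
      using MVT2[of 1 y F r] F by auto
    then show ?thesis by (simp add: r_def flat_1_eq_0)
  qed (use that in simp)
  show ?thesis
  proof (rule exI[of _ "\<lambda>y. (F y - F 0) / I"], rule exI[of _ "\<lambda>y. (1 / I) * (flat 1 y * flat 1 (1 - y))"],
      intro conjI allI impI)
    fix y :: real
    show "((\<lambda>y. (F y - F 0) / I) has_real_derivative (1 / I) * (flat 1 y * flat 1 (1 - y))) (at y)"
      using DERIV_cdivide[OF DERIV_diff[OF F DERIV_const], of "F 0" I y] by (simp add: r_def)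
    show "y \<le> 0 \<Longrightarrow> (F y - F 0) / I = 0" using left[of y] by simp
    show "y \<ge> 1 \<Longrightarrow> (F y - F 0) / I = 1" using right[of y] I by (simp add: I_def)
    show "\<exists>c>0. \<forall>y. 1 / I * (flat 1 y * flat 1 (1 - y)) = c * (flat 1 y * flat 1 (1 - y))"
      using I by (intro exI[of _ "1/I"]) auto
  qed
qed

text \<open>Function and derivative are chosen together, so that the derivative keeps its explicit
  form as a product of \<open>flat\<close> functions.\<close>

definition step_pair :: "(real \<Rightarrow> real) \<times> (real \<Rightarrow> real)" where
  "step_pair = (SOME (P, \<rho>). (\<forall>y. (P has_real_derivative \<rho> y) (at y)) \<and> (\<exists>c>0. \<forall>y. \<rho> y = c * (flat 1 y * flat 1 (1 - y))) \<and>
     (\<forall>y\<le>0. P y = 0) \<and> (\<forall>y\<ge>1. P y = 1))"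

definition step :: "real \<Rightarrow> real" where "step = fst step_pair"
definition step' :: "real \<Rightarrow> real" where "step' = snd step_pair"

lemma step_props:
  "(step has_real_derivative step' y) (at y)" "\<exists>c>0. step' = (\<lambda>y. c * (flat 1 y * flat 1 (1 - y)))"
  "y \<le> 0 \<Longrightarrow> step y = 0" "y \<ge> 1 \<Longrightarrow> step y = 1"
proof -
  have "case step_pair of (P, \<rho>) \<Rightarrow> (\<forall>y. (P has_real_derivative \<rho> y) (at y)) \<and> (\<exists>c>0. \<forall>y. \<rho> y = c * (flat 1 y * flat 1 (1 - y))) \<and>
     (\<forall>y\<le>0. P y = 0) \<and> (\<forall>y\<ge>1. P y = 1)"
    unfolding step_pair_def by (rule someI_ex) (use smooth_step_exists in auto)
  then show "(step has_real_derivative step' y) (at y)" "\<exists>c>0. step' = (\<lambda>y. c * (flat 1 y * flat 1 (1 - y)))"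
    "y \<le> 0 \<Longrightarrow> step y = 0" "y \<ge> 1 \<Longrightarrow> step y = 1"
    unfolding step_def step'_def by (auto simp: case_prod_unfold fun_eq_iff)
qed

lemma step'_nonneg: "step' y \<ge> 0"
  and step'_eq_0: "y \<notin> {0..1} \<Longrightarrow> step' y = 0"
  and continuous_step': "continuous_on UNIV step'"
proof -
  obtain c where c: "c > 0" "step' = (\<lambda>y. c * (flat 1 y * flat 1 (1 - y)))" using step_props(2) by blast
  show "step' y \<ge> 0" "y \<notin> {0..1} \<Longrightarrow> step' y = 0" "continuous_on UNIV step'"
    using c(1) unfolding c(2) by (auto simp: flat_1_nonneg flat_1_eq_0 intro!: continuous_intros)
qed

lemma step_bounds: "0 \<le> step y" "step y \<le> 1"
proof -
  have mono: "step x \<le> step y" if "x \<le> y" for x y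
    by (rule DERIV_nonneg_imp_nondecreasing[OF that]) (use step_props(1) step'_nonneg in blast)
  show "0 \<le> step y" using mono[of "min y 0" y] step_props(3)[of "min y 0"] by simp
  show "step y \<le> 1" using mono[of y "max y 1"] step_props(4)[of "max y 1"] by simp
qed

text \<open>Closed under differentiation, so every member is infinitely differentiable.\<close>
inductive_set smooth_alg :: "(real \<Rightarrow> real) set" where
  const: "(\<lambda>_. c) \<in> smooth_alg"
| flat: "(\<lambda>x. flat q (a * x + b)) \<in> smooth_alg"
| step: "(\<lambda>x. step (a * x + b)) \<in> smooth_alg"
| cos: "(\<lambda>x. cos (a * x)) \<in> smooth_alg"
| sin: "(\<lambda>x. sin (a * x)) \<in> smooth_alg"
| add: "f \<in> smooth_alg \<Longrightarrow> g \<in> smooth_alg \<Longrightarrow> (\<lambda>x. f x + g x) \<in> smooth_alg"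
| mult: "f \<in> smooth_alg \<Longrightarrow> g \<in> smooth_alg \<Longrightarrow> (\<lambda>x. f x * g x) \<in> smooth_alg"

lemma smooth_alg_deriv:
  "f \<in> smooth_alg \<Longrightarrow> \<exists>g\<in>smooth_alg. \<forall>x. (f has_real_derivative g x) (at x)"
proof (induction rule: smooth_alg.induct)
  case (const c)
  show ?case by (intro bexI[of _ "\<lambda>_. 0"] smooth_alg.const) auto
next
  case (flat q a b)
  show ?case
  proof (intro bexI allI)
    show "(\<lambda>x. flat ([:0, 0, 1:] * (q - pderiv q)) (a * x + b) * a) \<in> smooth_alg"
      by (intro smooth_alg.intros)
    show "((\<lambda>x. flat q (a * x + b)) has_real_derivative flat ([:0, 0, 1:] * (q - pderiv q)) (a * x + b) * a) (at x)" for x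
      by (rule DERIV_chain2[OF DERIV_flat]) (auto intro!: derivative_eq_intros)
  qed
next
  case (step a b)
  obtain c where c: "step' = (\<lambda>y. c * (flat 1 y * flat 1 (1 - y)))" using step_props(2) by blast
  show ?case
  proof (intro bexI allI)
    have "(\<lambda>x. (c * (flat 1 (a * x + b) * flat 1 ((- a) * x + (1 - b)))) * a) \<in> smooth_alg"
      by (intro smooth_alg.intros)
    moreover have "(- a) * x + (1 - b) = 1 - (a * x + b)" for x by simp
    ultimately show "(\<lambda>x. step' (a * x + b) * a) \<in> smooth_alg"
      by (simp only: c)
    show "((\<lambda>x. step (a * x + b)) has_real_derivative step' (a * x + b) * a) (at x)" for x
      by (rule DERIV_chain2[OF step_props(1)]) (auto intro!: derivative_eq_intros)
  qed
next
  case (cos a)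
  show ?case
  proof (intro bexI allI)
    show "(\<lambda>x. (-a) * sin (a * x)) \<in> smooth_alg" by (intro smooth_alg.intros)
    show "((\<lambda>x. cos (a * x)) has_real_derivative (-a) * sin (a * x)) (at x)" for x
      by (auto intro!: derivative_eq_intros)
  qed
next
  case (sin a)
  show ?case
  proof (intro bexI allI)
    show "(\<lambda>x. a * cos (a * x)) \<in> smooth_alg" by (intro smooth_alg.intros)
    show "((\<lambda>x. sin (a * x)) has_real_derivative a * cos (a * x)) (at x)" for x
      by (auto intro!: derivative_eq_intros)
  qed
next
  case (add f g)
  then obtain f' g' where "f' \<in> smooth_alg" "g' \<in> smooth_alg" "\<forall>x. (f has_real_derivative f' x) (at x)"
    "\<forall>x. (g has_real_derivative g' x) (at x)" by blast
  then show ?case by (intro bexI[of _ "\<lambda>x. f' x + g' x"] smooth_alg.intros) (auto intro: DERIV_add)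
next
  case (mult f g)
  then obtain f' g' where "f' \<in> smooth_alg" "g' \<in> smooth_alg" "\<forall>x. (f has_real_derivative f' x) (at x)"
    "\<forall>x. (g has_real_derivative g' x) (at x)" by blast
  then show ?case
    using mult.hyps
    by (intro bexI[of _ "\<lambda>x. f' x * g x + g' x * f x"] smooth_alg.intros) (auto intro: DERIV_mult)
qed

lemma smooth_alg_derivE:
  assumes "f \<in> smooth_alg" "\<And>x. (f has_real_derivative f' x) (at x)"
  shows "f' \<in> smooth_alg"
proof -
  obtain g where g: "g \<in> smooth_alg" "\<forall>x. (f has_real_derivative g x) (at x)"
    using smooth_alg_deriv[OF assms(1)] by blast
  then have "f' = g" using assms(2) DERIV_unique by blast
  with g show ?thesis by simp
qed

lemma smooth_alg_continuous:
  assumes "f \<in> smooth_alg" shows "continuous_on A f"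
proof -
  obtain g where "\<forall>x. (f has_real_derivative g x) (at x)" using smooth_alg_deriv[OF assms] by blast
  then show ?thesis by (meson DERIV_isCont continuous_at_imp_continuous_on)
qed

section \<open>Test functions that are products in time and space\<close>

lemma partial_product:
  assumes "\<And>t. (a has_real_derivative a' t) (at t)"
  shows "partial_t (\<lambda>t x. a t * b x) = (\<lambda>t x. a' t * b x)"
    and "partial_x (\<lambda>t x. b t * a x) = (\<lambda>t x. b t * a' x)"
proof -
  have "deriv (\<lambda>\<tau>. a \<tau> * b x) t = a' t * b x" for t x
    by (intro DERIV_imp_deriv) (auto intro!: derivative_eq_intros assms)
  then show "partial_t (\<lambda>t x. a t * b x) = (\<lambda>t x. a' t * b x)" by (simp add: partial_t_def fun_eq_iff)
  have "deriv (\<lambda>x. b t * a x) x = b t * a' x" for t x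
    by (intro DERIV_imp_deriv) (auto intro!: derivative_eq_intros assms)
  then show "partial_x (\<lambda>t x. b t * a x) = (\<lambda>t x. b t * a' x)" by (simp add: partial_x_def fun_eq_iff)
qed

lemma continuous_on_product:
  assumes "a \<in> smooth_alg" "b \<in> smooth_alg"
  shows "continuous_on UNIV (\<lambda>(t, x). a t * b x)"
proof -
  have "continuous_on UNIV (\<lambda>p :: real \<times> real. a (fst p))" "continuous_on UNIV (\<lambda>p :: real \<times> real. b (snd p))"
    by (rule continuous_on_compose2[OF smooth_alg_continuous[of _ UNIV]], rule assms, auto intro: continuous_intros)+
  then show ?thesis by (simp add: case_prod_unfold continuous_on_mult)
qed

text \<open>Both partial derivatives of a product are products of the same kind, so the induction
  lets the two factors vary.\<close>

lemma C_upto_product: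
  "a \<in> smooth_alg \<Longrightarrow> b \<in> smooth_alg \<Longrightarrow> C_upto k (\<lambda>t x. a t * b x)"
proof (induction k arbitrary: a b)
  case 0
  then show ?case
    by (simp add: continuous_on_product)
next
  case (Suc k)
  obtain a' where a': "a' \<in> smooth_alg" "\<And>x. (a has_real_derivative a' x) (at x)"
    using smooth_alg_deriv[OF Suc.prems(1)] by blast
  obtain b' where b': "b' \<in> smooth_alg" "\<And>x. (b has_real_derivative b' x) (at x)"
    using smooth_alg_deriv[OF Suc.prems(2)] by blast
  have "continuous_on UNIV (\<lambda>(t, x). a t * b x)"
    using Suc.prems by (rule continuous_on_product)
  moreover have "(\<lambda>\<tau>. a \<tau> * b x) differentiable at t" "(\<lambda>x. a t * b x) differentiable at x" for t x
    by (rule differentiable_mult differentiable_const real_differentiable_def[THEN iffD2] exI a' b')+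
  ultimately show ?case
    by (simp add: partial_product[OF a'(2)] partial_product[OF b'(2)] Suc.IH Suc.prems a' b')
qed

lemma test_function_product:
  assumes "a \<in> smooth_alg" "b \<in> smooth_alg" "\<And>t. t \<notin> {c..d} \<Longrightarrow> a t = 0" "\<And>x. x \<notin> {e..f} \<Longrightarrow> b x = 0"
    and "0 < c" "d < T"
  shows "test_function T (\<lambda>t x. a t * b x)"
proof -
  have "{(t, x). a t * b x \<noteq> 0} \<subseteq> {c..d} \<times> {e..f}"
    using assms(3,4) by fastforce
  then have sub: "closure {(t, x). a t * b x \<noteq> 0} \<subseteq> {c..d} \<times> {e..f}"
    by (intro closure_minimal closed_Times) auto
  have "compact ({c..d} \<times> {e..f})" by (intro compact_Times) auto
  then have "compact (closure {(t, x). a t * b x \<noteq> 0})"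
    using compact_Int_closed[of "{c..d} \<times> {e..f}" "closure {(t, x). a t * b x \<noteq> 0}"] sub
    by (simp add: Int_absorb1)
  moreover have "{c..d} \<times> {e..f} \<subseteq> {0<..<T} \<times> UNIV" using assms(5,6) by auto
  ultimately show ?thesis
    unfolding test_function_def using sub C_upto_product[OF assms(1,2)] by blast
qed

section \<open>From weak to integrated equations\<close>

lemma integral_derivative_lborel:
  fixes w :: "real \<Rightarrow> real"
  assumes W: "\<And>x. (W has_real_derivative w x) (at x)" and w: "integrable lborel w"
    and 0: "\<And>x. x \<notin> {a..b} \<Longrightarrow> w x = 0" and ab: "a \<le> b"
  shows "(LINT x|lborel. w x) = W b - W a"
proof -
  have "(w has_integral (W b - W a)) {a..b}"
    by (rule fundamental_theorem_of_calculus[OF ab])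
       (auto intro!: has_field_derivative_at_within W simp flip: has_real_derivative_iff_has_vector_derivative)
  from has_integral_on_superset[OF this 0 subset_UNIV] has_integral_integral_lborel[OF w]
  show ?thesis by (rule has_integral_unique[symmetric])
qed

lemma compact_support_bounded:
  fixes g :: "real \<Rightarrow> real"
  assumes g: "continuous_on UNIV g" and 0: "\<And>x. x \<notin> {a..b} \<Longrightarrow> g x = 0"
  obtains B where "B > 0" "\<And>x. \<bar>g x\<bar> \<le> B"
proof -
  have "bounded (g ` {a..b})"
    by (intro compact_imp_bounded compact_continuous_image continuous_on_subset[OF g]) auto
  then obtain B where B: "B > 0" "\<And>x. x \<in> {a..b} \<Longrightarrow> \<bar>g x\<bar> \<le> B"
    unfolding bounded_pos by auto
  show ?thesis
  proof (rule that[OF B(1)])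
    show "\<bar>g x\<bar> \<le> B" for x using B 0[of x] by (cases "x \<in> {a..b}") auto
  qed
qed

lemma compact_support_integrable:
  fixes g :: "real \<Rightarrow> real"
  assumes g: "continuous_on UNIV g" and 0: "\<And>x. x \<notin> {a..b} \<Longrightarrow> g x = 0"
  shows "integrable lborel g"
proof -
  have "integrable lborel (\<lambda>x. indicator {a..b} x *\<^sub>R g x)"
    by (intro borel_integrable_compact continuous_on_subset[OF g]) auto
  also have "(\<lambda>x. indicator {a..b} x *\<^sub>R g x) = g"
    using 0 by (auto simp: fun_eq_iff indicator_def)
  finally show ?thesis .
qed

lemma integrable_step': "integrable lborel step'"
  by (rule compact_support_integrable[OF continuous_step' step'_eq_0])

lemma integral_step': "(LINT y|lborel. step' y) = 1"
  using integral_derivative_lborel[OF step_props(1) integrable_step' step'_eq_0]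
  by (simp add: step_props)

text \<open>\<open>step'\<close> is a probability density on [0, 1], and its rescalings concentrate
  at \<open>a\<close>. The scale \<open>k n\<close> may be negative: the mass then lies to the left
  of \<open>a\<close>, as is wanted at the right end of an interval.\<close>

lemma mollifier_tendsto:
  fixes F :: "real \<Rightarrow> real"
  assumes [measurable]: "F \<in> borel_measurable borel" and B: "\<And>x. \<bar>F x\<bar> \<le> B" and c: "isCont F a"
    and k: "\<And>n::nat. k n \<noteq> 0" "k \<longlonglongrightarrow> 0"
  shows "(\<lambda>n. LINT x|lborel. F x * (step' ((x - a) / k n) / \<bar>k n\<bar>)) \<longlonglongrightarrow> F a"
proof -
  have [measurable]: "step' \<in> borel_measurable borel"
    by (rule borel_measurable_continuous_onI[OF continuous_step'])
  have eq: "(LINT x|lborel. F x * (step' ((x - a) / k n) / \<bar>k n\<bar>)) = (LINT y|lborel. F (a + k n * y) * step' y)" for n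
  proof -
    have "(LINT x|lborel. F x * (step' ((x - a) / k n) / \<bar>k n\<bar>)) =
       \<bar>k n\<bar> *\<^sub>R (LINT y|lborel. F (a + k n * y) * (step' ((a + k n * y - a) / k n) / \<bar>k n\<bar>))"
      by (rule lborel_integral_real_affine[OF k(1)])
    also have "\<dots> = (LINT y|lborel. \<bar>k n\<bar> *\<^sub>R (F (a + k n * y) * (step' ((a + k n * y - a) / k n) / \<bar>k n\<bar>)))"
      by (rule integral_scaleR_right[symmetric])
    also have "\<dots> = (LINT y|lborel. F (a + k n * y) * step' y)"
      using k(1)[of n] by (intro Bochner_Integration.integral_cong refl) simp
    finally show ?thesis .
  qed
  have "(\<lambda>n. LINT y|lborel. F (a + k n * y) * step' y) \<longlonglongrightarrow> (LINT y|lborel. F a * step' y)"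
  proof (rule integral_dominated_convergence[where w = "\<lambda>y. B * step' y"])
    show "AE y in lborel. (\<lambda>n. F (a + k n * y) * step' y) \<longlonglongrightarrow> F a * step' y"
    proof (intro AE_I2 tendsto_intros isCont_tendsto_compose[OF c])
      fix y
      have "(\<lambda>n. a + k n * y) \<longlonglongrightarrow> a + 0 * y" by (intro tendsto_intros k)
      then show "(\<lambda>n. a + k n * y) \<longlonglongrightarrow> a" by simp
    qed
    show "AE y in lborel. norm (F (a + k n * y) * step' y) \<le> B * step' y" for n
      using B step'_nonneg by (auto simp: abs_mult intro!: mult_right_mono)
  qed (use integrable_step' in auto)
  also have "(LINT y|lborel. F a * step' y) = F a" by (simp add: integral_step')
  finally show ?thesis unfolding eq .
qed

text \<open>The weak equation is tested with smooth approximations of the indicator of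
  \<open>{a<..<b}\<close>. Their derivatives are a mollifier at \<open>a\<close> minus a mollifier
  at \<open>b\<close>, both placed inside the interval, and continuity of \<open>f\<close> produces
  the end values.\<close>

lemma weak_derivative_imp_integral:
  fixes f g :: "real \<Rightarrow> real"
  assumes f: "continuous_on {0..T} f" and g: "continuous_on {0..T} g"
    and weak: "\<And>\<theta> \<theta>' c d. \<lbrakk>\<theta> \<in> smooth_alg; \<And>t. (\<theta> has_real_derivative \<theta>' t) (at t); 0 < c; d < T; \<And>t. t \<notin> {c..d} \<Longrightarrow> \<theta> t = 0\<rbrakk>
      \<Longrightarrow> (LINT t:{0<..<T}|lborel. g t * \<theta> t - f t * \<theta>' t) = 0"
    and ab: "0 < a" "a < b" "b < T"
  shows "f b - f a = - (LINT t:{a<..<b}|lborel. g t)"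
proof -
  define F G where "F t = indicator {0<..<T} t * f t" and "G t = indicator {0<..<T} t * g t" for t
  have cl: "bounded (f ` {0..T})" "bounded (g ` {0..T})"
    by (intro compact_imp_bounded compact_continuous_image f g compact_Icc)+
  then obtain B1 B2 where B12: "B1 > 0" "B2 > 0" "\<And>t. t \<in> {0..T} \<Longrightarrow> \<bar>f t\<bar> \<le> B1" "\<And>t. t \<in> {0..T} \<Longrightarrow> \<bar>g t\<bar> \<le> B2"
    unfolding bounded_pos by auto
  have FB: "\<bar>F t\<bar> \<le> B1" and GB: "\<bar>G t\<bar> \<le> B2 * indicator {0<..<T} t" for t
    using B12 by (auto simp: F_def G_def indicator_def)
  have "(\<lambda>t. indicator {0<..<T} t *\<^sub>R f t) \<in> borel_measurable borel" "(\<lambda>t. indicator {0<..<T} t *\<^sub>R g t) \<in> borel_measurable borel"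
    by (intro borel_measurable_continuous_on_indicator continuous_on_subset[OF f] continuous_on_subset[OF g]; auto)+
  then have Fm [measurable]: "F \<in> borel_measurable borel" and [measurable]: "G \<in> borel_measurable borel"
    by (simp_all add: F_def[abs_def] G_def[abs_def])
  have contF: "isCont F t" if "0 < t" "t < T" for t
  proof -
    have "\<forall>\<^sub>F s in nhds t. F s = f s"
      using eventually_nhds_in_open[of "{0<..<T}" t] that by (auto simp: F_def elim!: eventually_mono)
    from isCont_cong[OF this] continuous_on_interior[OF f, of t] that show ?thesis by simp
  qed
  have stepm [measurable]: "step' \<in> borel_measurable borel" "step \<in> borel_measurable borel"
    using continuous_step' step_props(1)
    by (auto intro!: borel_measurable_continuous_onI continuous_at_imp_continuous_on intro: DERIV_isCont)
  \<comment> \<open>The denominator \<open>real n + 3\<close> makes \<open>2 * k n < b - a\<close>,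
    so the ascending and the descending edge do not overlap.\<close>
  define k where "k n = (b - a) / (real n + 3)" for n
  have k: "k n > 0" "2 * k n < b - a" for n
  proof -
    show "k n > 0" using ab by (simp add: k_def)
    have "(b - a) * (2 / (real n + 3)) < (b - a) * 1"
      using ab by (intro mult_strict_left_mono) auto
    then show "2 * k n < b - a" by (simp add: k_def mult.commute)
  qed
  have k0: "k \<longlonglongrightarrow> 0" unfolding k_def by real_asymp
  have k0': "(\<lambda>n. - k n) \<longlonglongrightarrow> 0" using tendsto_minus[OF k0] by simp
  define \<theta> where "\<theta> n t = step ((t - a) / k n) * step ((b - t) / k n)" for n t
  define \<theta>' where "\<theta>' n t = step' ((t - a) / k n) / k n - step' ((b - t) / k n) / k n" for n t
  have \<theta>alg: "\<theta> n \<in> smooth_alg" for n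
  proof -
    have "(\<lambda>t. step ((1 / k n) * t + (- a / k n)) * step ((- 1 / k n) * t + b / k n)) \<in> smooth_alg"
      by (intro smooth_alg.intros)
    then show ?thesis
      by (simp add: \<theta>_def[abs_def] diff_divide_distrib)
  qed
  have \<theta>d: "(\<theta> n has_real_derivative \<theta>' n t) (at t)" for n t
  proof -
    have 1: "((\<lambda>t. step ((t - a) / k n)) has_real_derivative step' ((t - a) / k n) * (1 / k n)) (at t)"
      by (rule DERIV_chain2[OF step_props(1)]) (use k(1)[of n] in \<open>auto intro!: derivative_eq_intros\<close>)
    have 2: "((\<lambda>t. step ((b - t) / k n)) has_real_derivative step' ((b - t) / k n) * (- 1 / k n)) (at t)"
      by (rule DERIV_chain2[OF step_props(1)]) (use k(1)[of n] in \<open>auto intro!: derivative_eq_intros\<close>)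
    have "step' ((t - a) / k n) * (1 / k n) * step ((b - t) / k n) + step' ((b - t) / k n) * (- 1 / k n) * step ((t - a) / k n) = \<theta>' n t"
    proof -
      \<comment> \<open>Where the derivative of one edge is nonzero the other edge equals 1, so the
        product rule leaves just the two edge terms.\<close>
      have e1: "step' ((t - a) / k n) * step ((b - t) / k n) = step' ((t - a) / k n)"
      proof (cases "(t - a) / k n \<in> {0..1}")
        case True
        then have "(b - t) / k n \<ge> 1" using k[of n] by (auto simp: field_simps)
        then show ?thesis by (simp add: step_props)
      qed (simp add: step'_eq_0)
      have e2: "step' ((b - t) / k n) * step ((t - a) / k n) = step' ((b - t) / k n)"
      proof (cases "(b - t) / k n \<in> {0..1}")
        case True
        then have "(t - a) / k n \<ge> 1" using k[of n] by (auto simp: field_simps)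
        then show ?thesis by (simp add: step_props)
      qed (simp add: step'_eq_0)
      have "p * (1 / c) * q + p' * (- 1 / c) * q' = (p * q) / c - (p' * q') / c" for p p' q q' c :: real
        by simp
      then show ?thesis unfolding \<theta>'_def by (simp only: e1 e2)
    qed
    with DERIV_mult[OF 1 2] show ?thesis unfolding \<theta>_def[abs_def] by simp
  qed
  have \<theta>s: "\<theta> n t = 0" if "t \<notin> {a..b}" for n t
    using that k(1)[of n] by (auto simp: \<theta>_def field_simps intro!: step_props(3))
  have \<theta>b: "\<bar>\<theta> n t\<bar> \<le> 1" for n t
    using step_bounds by (auto simp: \<theta>_def abs_mult mult_le_one)
  have [measurable]: "\<theta> n \<in> borel_measurable borel" "\<theta>' n \<in> borel_measurable borel" for n
    unfolding \<theta>_def \<theta>'_def by measurable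
  have ind: "integrable lborel (\<lambda>t. B2 * indicator {0<..<T} t :: real)"
    by (intro integrable_mult_right integrable_real_indicator) (use ab in auto)
  have intG: "integrable lborel (\<lambda>t. G t * \<theta> n t)" for n
    by (rule Bochner_Integration.integrable_bound[OF ind])
       (use GB \<theta>b B12 in \<open>auto simp: abs_mult intro!: order_trans[OF mult_mono[OF GB \<theta>b]]\<close>)
  have intF: "integrable lborel (\<lambda>t. F t * (step' ((t - p) / c) / \<bar>c\<bar>))" if "c \<noteq> 0" for p c
  proof -
    have "integrable lborel (\<lambda>t. step' ((t - p) / c) / \<bar>c\<bar>)"
      using lborel_integrable_real_affine[OF integrable_step', of "1 / c" "- p / c"] that
      by (simp add: diff_divide_distrib)
    from integrable_mult_bounded[OF this, of F B1] Fm FB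
    show ?thesis by (simp add: mult.commute)
  qed
  have zero: "(LINT t|lborel. G t * \<theta> n t) - (LINT t|lborel. F t * (step' ((t - a) / k n) / \<bar>k n\<bar>))
       + (LINT t|lborel. F t * (step' ((t - b) / - k n) / \<bar>- k n\<bar>)) = 0" for n
  proof -
    have "0 = (LINT t:{0<..<T}|lborel. g t * \<theta> n t - f t * \<theta>' n t)"
      using weak[OF \<theta>alg \<theta>d, of a b n] \<theta>s ab by simp
    also have "\<dots> = (LINT t|lborel. G t * \<theta> n t - F t * (step' ((t - a) / k n) / \<bar>k n\<bar>)
        + F t * (step' ((t - b) / - k n) / \<bar>- k n\<bar>))"
      unfolding set_lebesgue_integral_def
    proof (intro Bochner_Integration.integral_cong refl)
      fix t
      \<comment> \<open>The descending edge is read as a mollifier at \<open>b\<close> with the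
        negative scale \<open>- k n\<close>.\<close>
      have "(t - b) / - k n = (b - t) / k n" by (simp add: minus_divide_right[symmetric] minus_divide_left)
      then show "indicator {0<..<T} t *\<^sub>R (g t * \<theta> n t - f t * \<theta>' n t) = G t * \<theta> n t -
         F t * (step' ((t - a) / k n) / \<bar>k n\<bar>) + F t * (step' ((t - b) / - k n) / \<bar>- k n\<bar>)"
        using k(1)[of n] by (simp add: F_def G_def \<theta>'_def algebra_simps)
    qed
    also have "\<dots> = (LINT t|lborel. G t * \<theta> n t) - (LINT t|lborel. F t * (step' ((t - a) / k n) / \<bar>k n\<bar>))
       + (LINT t|lborel. F t * (step' ((t - b) / - k n) / \<bar>- k n\<bar>))"
      using intF[of "k n" a] intF[of "- k n" b] k(1)[of n] intG[of n]
      by (subst Bochner_Integration.integral_add, simp, simp, subst Bochner_Integration.integral_diff) simp_all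
    finally show ?thesis by simp
  qed
  have "(\<lambda>n. LINT t|lborel. G t * \<theta> n t) \<longlonglongrightarrow> (LINT t|lborel. G t * indicator {a<..<b} t)"
  proof (rule integral_dominated_convergence[OF _ _ ind])
    show "AE t in lborel. (\<lambda>n. G t * \<theta> n t) \<longlonglongrightarrow> G t * indicator {a<..<b} t"
    proof (intro AE_I2 tendsto_intros)
      fix t
      show "(\<lambda>n. \<theta> n t) \<longlonglongrightarrow> indicator {a<..<b} t"
      proof (cases "t \<in> {a<..<b}")
        case True
        have "\<forall>\<^sub>F n in sequentially. k n < min (t - a) (b - t)"
          using order_tendstoD(2)[OF k0, of "min (t - a) (b - t)"] True by auto
        then have "\<forall>\<^sub>F n in sequentially. \<theta> n t = 1"
        proof eventually_elim
          case (elim n)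
          then have "(t - a) / k n \<ge> 1" "(b - t) / k n \<ge> 1" using k(1)[of n] by (auto simp: field_simps)
          then show ?case by (simp add: \<theta>_def step_props)
        qed
        then show ?thesis using True by (auto intro: tendsto_eventually)
      next
        case False
        then have "\<theta> n t = 0" for n
          using k(1)[of n] by (auto simp: \<theta>_def not_less divide_nonpos_pos intro!: step_props(3))
        then show ?thesis using False by simp
      qed
    qed
    show "AE t in lborel. norm (G t * \<theta> n t) \<le> B2 * indicator {0<..<T} t" for n
    proof (rule AE_I2)
      fix t
      have "\<bar>G t\<bar> * \<bar>\<theta> n t\<bar> \<le> (B2 * indicator {0<..<T} t) * 1"
        using B12 by (intro mult_mono GB \<theta>b) auto
      then show "norm (G t * \<theta> n t) \<le> B2 * indicator {0<..<T} t" by (simp add: abs_mult)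
    qed
  qed measurable
  moreover have "(\<lambda>n. LINT t|lborel. F t * (step' ((t - a) / k n) / \<bar>k n\<bar>)) \<longlonglongrightarrow> F a"
    by (rule mollifier_tendsto[OF Fm FB contF _ k0]) (use ab k(1) in \<open>auto simp: less_imp_neq[symmetric]\<close>)
  moreover have "(\<lambda>n. LINT t|lborel. F t * (step' ((t - b) / - k n) / \<bar>- k n\<bar>)) \<longlonglongrightarrow> F b"
    by (rule mollifier_tendsto[OF Fm FB contF _ k0']) (use ab k(1) in \<open>auto simp: less_imp_neq[symmetric]\<close>)
  ultimately have "(\<lambda>n. (LINT t|lborel. G t * \<theta> n t) - (LINT t|lborel. F t * (step' ((t - a) / k n) / \<bar>k n\<bar>))
       + (LINT t|lborel. F t * (step' ((t - b) / - k n) / \<bar>- k n\<bar>))) \<longlonglongrightarrow> (LINT t|lborel. G t * indicator {a<..<b} t) - F a + F b"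
    by (intro tendsto_intros)
  then have "(LINT t|lborel. G t * indicator {a<..<b} t) - F a + F b = 0"
    unfolding zero by (simp add: LIMSEQ_const_iff)
  moreover have "F a = f a" "F b = f b" using ab by (auto simp: F_def)
  moreover have "(LINT t|lborel. G t * indicator {a<..<b} t) = (LINT t:{a<..<b}|lborel. g t)"
    unfolding set_lebesgue_integral_def using ab
    by (intro Bochner_Integration.integral_cong refl) (auto simp: G_def indicator_def)
  ultimately show ?thesis by simp
qed

lemma L1_curve_pairing_continuous:
  fixes w :: "real \<Rightarrow> real \<Rightarrow> real" and \<psi> :: "real \<Rightarrow> 'b::{banach, second_countable_topology}"
  assumes w: "\<And>t. t \<in> A \<Longrightarrow> integrable lborel (w t)"
    and c: "\<And>t e. t \<in> A \<Longrightarrow> e > 0 \<Longrightarrow> \<exists>d>0. \<forall>\<tau>\<in>A. \<bar>\<tau> - t\<bar> < d \<longrightarrow> (LINT x|lborel. \<bar>w \<tau> x - w t x\<bar>) \<le> e"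
    and \<psi>: "\<psi> \<in> borel_measurable borel" and B: "\<And>x. norm (\<psi> x) \<le> B"
  shows "continuous_on A (\<lambda>t. LINT x|lborel. w t x *\<^sub>R \<psi> x)"
  unfolding continuous_on_iff
proof (intro ballI allI impI)
  fix t e :: real assume t: "t \<in> A" and e: "e > 0"
  have int: "integrable lborel (\<lambda>x. k x *\<^sub>R \<psi> x)" if "integrable lborel k" for k :: "real \<Rightarrow> real"
  proof (rule Bochner_Integration.integrable_bound)
    show "integrable lborel (\<lambda>x. B * k x)" using that by simp
    have "norm (k x *\<^sub>R \<psi> x) \<le> norm (B * k x)" for x
      using mult_left_mono[OF order_trans[OF B[of x] abs_ge_self], of "\<bar>k x\<bar>"] by (simp add: abs_mult mult.commute)
    then show "AE x in lborel. norm (k x *\<^sub>R \<psi> x) \<le> norm (B * k x)" by simp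
  qed (use \<psi> that in measurable)
  have B0: "B \<ge> 0" using order_trans[OF norm_ge_zero B] .
  \<comment> \<open>The factor \<open>2 * (B + 1)\<close> covers the case \<open>B = 0\<close> and
    leaves a strict inequality at the end.\<close>
  obtain d where d: "d > 0" "\<And>\<tau>. \<tau> \<in> A \<Longrightarrow> \<bar>\<tau> - t\<bar> < d \<Longrightarrow> (LINT x|lborel. \<bar>w \<tau> x - w t x\<bar>) \<le> e / (2 * (B + 1))"
    using c[OF t, of "e / (2 * (B + 1))"] e B0 by auto
  show "\<exists>d>0. \<forall>\<tau>\<in>A. dist \<tau> t < d \<longrightarrow> dist (LINT x|lborel. w \<tau> x *\<^sub>R \<psi> x) (LINT x|lborel. w t x *\<^sub>R \<psi> x) < e"
  proof (intro exI[of _ d] conjI ballI impI d)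
    fix \<tau> assume \<tau>: "\<tau> \<in> A" "dist \<tau> t < d"
    have wd: "integrable lborel (\<lambda>x. w \<tau> x - w t x)" using w[OF t] w[OF \<tau>(1)] by simp
    have "(LINT x|lborel. w \<tau> x *\<^sub>R \<psi> x) - (LINT x|lborel. w t x *\<^sub>R \<psi> x) = (LINT x|lborel. (w \<tau> x - w t x) *\<^sub>R \<psi> x)"
      by (subst Bochner_Integration.integral_diff[symmetric]) (auto intro!: int w t \<tau> simp: scaleR_diff_left)
    also have "norm \<dots> \<le> (LINT x|lborel. norm ((w \<tau> x - w t x) *\<^sub>R \<psi> x))" by (rule integral_norm_bound)
    also have "\<dots> \<le> (LINT x|lborel. \<bar>w \<tau> x - w t x\<bar> * B)"
      by (intro integral_mono integrable_norm int wd integrable_mult_left integrable_abs)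
         (auto intro!: mult_left_mono B)
    also have "\<dots> = (LINT x|lborel. \<bar>w \<tau> x - w t x\<bar>) * B" by simp
    also have "\<dots> \<le> e / (2 * (B + 1)) * B"
      using d(2)[of \<tau>] \<tau> B0 by (intro mult_right_mono) (auto simp: dist_real_def)
    also have "\<dots> < e" 
    proof -
      have "e * B < e * (2 * (B + 1))" using e B0 by (intro mult_strict_left_mono) auto
      then show ?thesis using B0 by (simp add: divide_less_eq)
    qed
    finally show "dist (LINT x|lborel. w \<tau> x *\<^sub>R \<psi> x) (LINT x|lborel. w t x *\<^sub>R \<psi> x) < e"
      by (simp add: dist_norm)
  qed
qed

lemma deriv_zero_outside:
  fixes \<psi> :: "real \<Rightarrow> real"
  assumes "\<And>x. (\<psi> has_real_derivative \<psi>' x) (at x)" "\<And>x. x \<notin> {a..b} \<Longrightarrow> \<psi> x = 0" "x \<notin> {a..b}"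
  shows "\<psi>' x = 0"
proof -
  have "\<forall>\<^sub>F y in nhds x. y \<in> - {a..b}"
    by (rule eventually_nhds_in_open) (use assms(3) in \<open>auto intro: open_Compl\<close>)
  then have "\<forall>\<^sub>F y in nhds x. \<psi> y = 0"
    by eventually_elim (rule assms(2), simp)
  then have "((\<lambda>_. 0) has_real_derivative \<psi>' x) (at x)"
    using DERIV_cong_ev[of x x \<psi> "\<lambda>_. 0" "\<psi>' x" "\<psi>' x"] assms(1)[of x] by simp
  then show ?thesis using DERIV_unique DERIV_const by blast
qed

section \<open>Measurability and integrability in space-time\<close>

context nice_curve
begin

text \<open>The curve is controlled only on \<open>{0..T}\<close>. Clamping the time gives a jointly
  measurable function on the whole plane that agrees with the curve for times in that
  interval.\<close>

definition clamp :: "real \<Rightarrow> real" where "clamp t = max 0 (min T t)"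

lemma clamp: "clamp t \<in> {0..T}" "t \<in> {0..T} \<Longrightarrow> clamp t = t"
  using T by (auto simp: clamp_def)

lemma clamped_measurable [measurable]:
  "(\<lambda>p. v (clamp (fst p)) (snd p)) \<in> borel_measurable (lborel \<Otimes>\<^sub>M lborel)"
proof -
  have "continuous_on UNIV (\<lambda>p :: real \<times> real. (clamp (fst p), snd p))"
    unfolding clamp_def by (intro continuous_intros)
  then have "continuous_on UNIV (\<lambda>p. (\<lambda>(t, x). v t x) (clamp (fst p), snd p))"
    by (rule continuous_on_compose2[OF jointly_continuous]) (use clamp in auto)
  then have "(\<lambda>p. v (clamp (fst p)) (snd p)) \<in> borel_measurable borel"
    by (intro borel_measurable_continuous_onI) simp
  then show ?thesis by (simp add: lborel_prod)
qed

text \<open>The spatial derivative is the pointwise limit of difference quotients, each of them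
  jointly measurable.\<close>

lemma clamped_deriv_measurable [measurable]:
  "(\<lambda>p. deriv (v (clamp (fst p))) (snd p)) \<in> borel_measurable (lborel \<Otimes>\<^sub>M lborel)"
proof (rule borel_measurable_LIMSEQ_real)
  let ?r = "\<lambda>n::nat. inverse (real (Suc n))"
  let ?q = "\<lambda>n p. (v (clamp (fst p)) (snd p + ?r n) - v (clamp (fst p)) (snd p)) / ?r n"
  show "(\<lambda>n. ?q n p) \<longlonglongrightarrow> deriv (v (clamp (fst p))) (snd p)" for p
  proof -
    have "(\<lambda>h. (v (clamp (fst p)) (snd p + h) - v (clamp (fst p)) (snd p)) / h) \<midarrow>0\<rightarrow> deriv (v (clamp (fst p))) (snd p)"
      using deriv[OF clamp(1)] by (simp add: DERIV_def)
    then show ?thesis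
      unfolding LIMSEQ_SEQ_conv[symmetric]
      by (rule allE[of _ ?r]) (use LIMSEQ_inverse_real_of_nat in auto)
  qed
  show "?q n \<in> borel_measurable (lborel \<Otimes>\<^sub>M lborel)" for n
  proof -
    have "(\<lambda>p. (fst p, snd p + ?r n)) \<in> (lborel \<Otimes>\<^sub>M lborel) \<rightarrow>\<^sub>M (lborel \<Otimes>\<^sub>M lborel :: (real \<times> real) measure)"
      by measurable
    from measurable_compose[OF this clamped_measurable]
    have [measurable]: "(\<lambda>p. v (clamp (fst p)) (snd p + ?r n)) \<in> borel_measurable (lborel \<Otimes>\<^sub>M lborel)" by simp
    show ?thesis by measurable
  qed
qed

lemma integrable_times:
  assumes "t \<in> {0..T}" "m \<in> borel_measurable borel" "\<And>x. \<bar>m x\<bar> \<le> B"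
  shows "integrable lborel (\<lambda>x. v t x * m x)"
  by (rule integrable_mult_bounded[where B = B]) (use assms integrable in auto)

lemma deriv_measurable: "t \<in> {0..T} \<Longrightarrow> deriv (v t) \<in> borel_measurable borel"
  using measurable_Pair2[OF clamped_deriv_measurable, of t] clamp(2)[of t] by simp

lemma integrable_sq: "t \<in> {0..T} \<Longrightarrow> integrable lborel (\<lambda>x. (v t x)\<^sup>2)"
proof -
  assume t: "t \<in> {0..T}"
  obtain S where "\<And>t x. t \<in> {0..T} \<Longrightarrow> \<bar>v t x\<bar> \<le> S" using bounded by metis
  from integrable_times[OF t measurable[OF t], of S] this t
  show ?thesis by (simp add: power2_eq_square)
qed

text \<open>At each time the \<open>L1\<close> norm in space is bounded by a common constant, and
  the time interval has finite length, so the iterated integral of the modulus is finite.\<close>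

lemma pair_integrable:
  assumes [measurable]: "k \<in> borel_measurable (lborel \<Otimes>\<^sub>M lborel)" and B: "\<And>p. \<bar>k p\<bar> \<le> B"
  shows "integrable (lborel \<Otimes>\<^sub>M lborel) (\<lambda>p. indicator {0<..<T} (fst p) * (v (clamp (fst p)) (snd p) * k p))"
proof (rule lborel_pair.Fubini_integrable)
  obtain S where S: "S > 0" "\<And>t. t \<in> {0..T} \<Longrightarrow> (LINT x|lborel. \<bar>v t x\<bar>) \<le> S" using bounded by metis
  have B0: "B \<ge> 0" using order_trans[OF abs_ge_zero B] .
  have km: "(\<lambda>x. k (t, x)) \<in> borel_measurable borel" for t
    using measurable_Pair2[OF assms(1), of t] by simp
  show "integrable lborel (\<lambda>t. LINT x|lborel. norm (indicator {0<..<T} (fst (t, x)) * (v (clamp (fst (t, x))) (snd (t, x)) * k (t, x))))"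
  proof (rule Bochner_Integration.integrable_bound)
    show "integrable lborel (\<lambda>t. indicator {0<..<T} t * (S * B) :: real)"
      by (intro integrable_mult_left integrable_real_indicator) (use T in auto)
    show "AE t in lborel. norm (LINT x|lborel. norm (indicator {0<..<T} (fst (t, x)) * (v (clamp (fst (t, x))) (snd (t, x)) * k (t, x)))) \<le>
        norm (indicator {0<..<T} t * (S * B) :: real)"
    proof (rule AE_I2)
      fix t
      have "(LINT x|lborel. \<bar>v (clamp t) x * k (t, x)\<bar>) \<le> (LINT x|lborel. \<bar>v (clamp t) x\<bar> * B)"
        by (intro integral_mono integrable_abs integrable_times[OF clamp(1) km B] integrable_mult_left integrable clamp(1))
           (auto simp: abs_mult intro!: mult_left_mono B)
      also have "\<dots> \<le> S * B" using S(2)[OF clamp(1)[of t]] B0 by (simp add: mult_right_mono)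
      finally have "(LINT x|lborel. \<bar>v (clamp t) x * k (t, x)\<bar>) \<le> S * B" .
      moreover have "(LINT x|lborel. \<bar>v (clamp t) x * k (t, x)\<bar>) \<ge> 0" by (intro integral_nonneg_AE) auto
      ultimately show "norm (LINT x|lborel. norm (indicator {0<..<T} (fst (t, x)) * (v (clamp (fst (t, x))) (snd (t, x)) * k (t, x)))) \<le>
        norm (indicator {0<..<T} t * (S * B) :: real)"
        using S B0 by (simp add: indicator_def)
    qed
  qed measurable
  show "AE t in lborel. integrable lborel (\<lambda>x. indicator {0<..<T} (fst (t, x)) * (v (clamp (fst (t, x))) (snd (t, x)) * k (t, x)))"
    using integrable_times[OF clamp(1) km B] by (intro AE_I2) simp
qed measurable

text \<open>Integration by parts in the form of an exact derivative: the difference of the two sides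
  integrates the derivative of v^2 \<psi> / 2, which has compact support.\<close>

lemma integral_v_deriv:
  assumes t: "t \<in> {0..T}" and \<psi>: "\<And>x. (\<psi> has_real_derivative \<psi>' x) (at x)" and \<psi>': "continuous_on UNIV \<psi>'"
    and 0: "\<And>x. x \<notin> {a..b} \<Longrightarrow> \<psi> x = 0" and ab: "a < b"
  shows "(LINT x|lborel. v t x * (deriv (v t) x * \<psi> x)) = - (LINT x|lborel. (v t x)\<^sup>2 * \<psi>' x) / 2"
proof -
  obtain S where S: "S > 0" "\<And>t x. t \<in> {0..T} \<Longrightarrow> \<bar>v t x\<bar> \<le> S" "\<And>t x. t \<in> {0..T} \<Longrightarrow> \<bar>deriv (v t) x\<bar> \<le> S"
    using bounded by metis
  have \<psi>'0: "x \<notin> {a..b} \<Longrightarrow> \<psi>' x = 0" for x using deriv_zero_outside[OF \<psi> 0] by blast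
  have \<psi>c: "continuous_on UNIV \<psi>" using \<psi> by (meson DERIV_isCont continuous_at_imp_continuous_on)
  obtain B1 where B1: "\<And>x. \<bar>\<psi> x\<bar> \<le> B1" using compact_support_bounded[OF \<psi>c 0] by metis
  obtain B2 where B2: "\<And>x. \<bar>\<psi>' x\<bar> \<le> B2" using compact_support_bounded[OF \<psi>' \<psi>'0] by metis
  note [measurable] = borel_measurable_continuous_onI[OF \<psi>c] borel_measurable_continuous_onI[OF \<psi>'] deriv_measurable[OF t] measurable[OF t]
  have i1: "integrable lborel (\<lambda>x. v t x * (deriv (v t) x * \<psi> x))"
    by (rule integrable_times[OF t, where B = "S * B1"]) (use S t B1 in \<open>auto simp: abs_mult intro!: mult_mono\<close>)
  have i2: "integrable lborel (\<lambda>x. v t x * (v t x * \<psi>' x))"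
    by (rule integrable_times[OF t, where B = "S * B2"]) (use S t B2 in \<open>auto simp: abs_mult intro!: mult_mono\<close>)
  \<comment> \<open>The end points \<open>a - 1\<close> and \<open>b + 1\<close> lie strictly
    outside the support, so the boundary values vanish.\<close>
  have "(LINT x|lborel. v t x * (deriv (v t) x * \<psi> x) + v t x * (v t x * \<psi>' x) / 2) =
     (v t (b + 1))\<^sup>2 * \<psi> (b + 1) / 2 - (v t (a - 1))\<^sup>2 * \<psi> (a - 1) / 2"
  proof (rule integral_derivative_lborel[where W = "\<lambda>x. (v t x)\<^sup>2 * \<psi> x / 2"])
    show "((\<lambda>x. (v t x)\<^sup>2 * \<psi> x / 2) has_real_derivative v t x * (deriv (v t) x * \<psi> x) + v t x * (v t x * \<psi>' x) / 2) (at x)" for x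
      by (rule derivative_eq_intros deriv[OF t] \<psi> refl)+ (simp_all add: field_simps power2_eq_square)
    show "integrable lborel (\<lambda>x. v t x * (deriv (v t) x * \<psi> x) + v t x * (v t x * \<psi>' x) / 2)"
      using i1 i2 by simp
  qed (use 0 \<psi>'0 ab in auto)
  then show ?thesis
    using i1 i2 0[of "b + 1"] 0[of "a - 1"] by (simp add: power2_eq_square mult.assoc)
qed

text \<open>For values bounded by \<open>S\<close>, |a^2 - b^2| is at most 2 S |a - b|. Continuity
  of the squares in \<open>L1\<close> is what makes the nonlinear term continuous in time.\<close>

lemma sq_L1_continuous_in_time:
  assumes t: "t \<in> {0..T}" and e: "e > 0"
  shows "\<exists>d>0. \<forall>\<tau>\<in>{0..T}. \<bar>\<tau> - t\<bar> < d \<longrightarrow> (LINT x|lborel. \<bar>(v \<tau> x)\<^sup>2 - (v t x)\<^sup>2\<bar>) \<le> e"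
proof -
  obtain S where S: "S > 0" "\<And>t x. t \<in> {0..T} \<Longrightarrow> \<bar>v t x\<bar> \<le> S" using bounded by metis
  obtain d where d: "d > 0" "\<And>\<tau>. \<tau> \<in> {0..T} \<Longrightarrow> \<bar>\<tau> - t\<bar> < d \<Longrightarrow> (LINT x|lborel. \<bar>v \<tau> x - v t x\<bar>) \<le> e / (2 * S)"
    using L1_continuous_in_time[OF t, of "e / (2 * S)"] e S by auto
  have "(LINT x|lborel. \<bar>(v \<tau> x)\<^sup>2 - (v t x)\<^sup>2\<bar>) \<le> e" if \<tau>: "\<tau> \<in> {0..T}" "\<bar>\<tau> - t\<bar> < d" for \<tau>
  proof -
    have "(LINT x|lborel. \<bar>(v \<tau> x)\<^sup>2 - (v t x)\<^sup>2\<bar>) \<le> (LINT x|lborel. (2 * S) * \<bar>v \<tau> x - v t x\<bar>)"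
    proof (intro integral_mono integrable_abs Bochner_Integration.integrable_diff integrable_sq integrable_mult_right integrable t \<tau>)
      fix x
      have "\<bar>(v \<tau> x)\<^sup>2 - (v t x)\<^sup>2\<bar> = \<bar>v \<tau> x + v t x\<bar> * \<bar>v \<tau> x - v t x\<bar>"
        by (simp add: power2_eq_square algebra_simps flip: abs_mult)
      also have "\<dots> \<le> (2 * S) * \<bar>v \<tau> x - v t x\<bar>"
        using S(2)[OF t, of x] S(2)[OF \<tau>(1), of x] by (intro mult_right_mono) auto
      finally show "\<bar>(v \<tau> x)\<^sup>2 - (v t x)\<^sup>2\<bar> \<le> (2 * S) * \<bar>v \<tau> x - v t x\<bar>" .
    qed
    also have "\<dots> = (2 * S) * (LINT x|lborel. \<bar>v \<tau> x - v t x\<bar>)" by simp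
    also have "\<dots> \<le> (2 * S) * (e / (2 * S))" using d(2)[OF \<tau>] S by (intro mult_left_mono) auto
    finally show ?thesis using S by simp
  qed
  then show ?thesis using d by blast
qed

lemma pairing_continuous:
  fixes \<psi> :: "real \<Rightarrow> 'b::{banach, second_countable_topology}"
  assumes "\<psi> \<in> borel_measurable borel" "\<And>x. norm (\<psi> x) \<le> B"
  shows "continuous_on {0..T} (\<lambda>t. LINT x|lborel. v t x *\<^sub>R \<psi> x)"
    and "continuous_on {0..T} (\<lambda>t. LINT x|lborel. (v t x)\<^sup>2 *\<^sub>R \<psi> x)"
  by (rule L1_curve_pairing_continuous[OF _ _ assms]; use integrable integrable_sq L1_continuous_in_time sq_L1_continuous_in_time in blast)+

end

section \<open>The equation on the Fourier side\<close>

text \<open>\<open>h\<close> stands for the Hilbert transform of \<open>u\<close>, known here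
  through its regularity and its classical Fourier transform; the choice operator in
  \<open>hilbert\<close> is left behind.\<close>

locale hilbert_flow = U: nice_curve s T u + H: nice_curve s T h
  for s T :: real and u h :: "real \<Rightarrow> real \<Rightarrow> real" +
  fixes \<beta> \<mu> :: real
  assumes \<mu>: "\<mu> > 0"
    and eq: "\<And>\<phi>. test_function T \<phi> \<Longrightarrow>
        (LINT p:{0<..<T} \<times> UNIV|lborel.
           (case p of (t, x) \<Rightarrow>
              - u t x * partial_t \<phi> t x
              + (u t x * deriv (u t) x + h t x * deriv (h t) x) * \<phi> t x
              + \<beta> * h t x * \<phi> t x
              - \<mu> * u t x * partial_x (partial_x \<phi>) t x)) = 0"
    and ft_h: "\<And>t \<xi>. t \<in> {0..T} \<Longrightarrow> \<xi> \<noteq> 0 \<Longrightarrow>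
        ft (cx (h t)) \<xi> = - \<i> * of_real (sgn \<xi>) * ft (cx (u t)) \<xi>"
begin

text \<open>The space part of the equation tested with \<psi>, after integration by parts. No
  derivative of \<open>u\<close> or \<open>h\<close> remains, so the expression is continuous in
  time and stable under bounded pointwise limits of \<psi> and its derivatives.\<close>

definition pairing :: "(real \<Rightarrow> real) \<Rightarrow> (real \<Rightarrow> real) \<Rightarrow> (real \<Rightarrow> real) \<Rightarrow> real \<Rightarrow> real" where
  "pairing \<psi> \<psi>' \<psi>'' t = - ((LINT x|lborel. (u t x)\<^sup>2 * \<psi>' x) + (LINT x|lborel. (h t x)\<^sup>2 * \<psi>' x)) / 2
     + \<beta> * (LINT x|lborel. h t x * \<psi> x) - \<mu> * (LINT x|lborel. u t x * \<psi>'' x)"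

lemma pairing_continuous:
  assumes [measurable]: "\<psi> \<in> borel_measurable borel" "\<psi>' \<in> borel_measurable borel" "\<psi>'' \<in> borel_measurable borel"
    and B: "\<And>x. \<bar>\<psi> x\<bar> \<le> B" "\<And>x. \<bar>\<psi>' x\<bar> \<le> B" "\<And>x. \<bar>\<psi>'' x\<bar> \<le> B"
  shows "continuous_on {0..T} (pairing \<psi> \<psi>' \<psi>'')"
  using U.pairing_continuous[of \<psi>' B] H.pairing_continuous[of \<psi>' B] H.pairing_continuous(1)[of \<psi> B] U.pairing_continuous(1)[of \<psi>'' B] B
  unfolding pairing_def[abs_def] by (intro continuous_intros) auto

text \<open>Testing with the product of \<theta>(t) and \<psi>(x), Fubini reduces the equation in
  two variables to the weak form of an ordinary differential equation for the pairing of
  \<open>u t\<close> with \<psi>.\<close>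

lemma weak_form:
  assumes \<psi>: "\<psi> \<in> smooth_alg" "\<And>x. (\<psi> has_real_derivative \<psi>' x) (at x)" "\<And>x. (\<psi>' has_real_derivative \<psi>'' x) (at x)"
    and \<psi>0: "\<And>x. x \<notin> {e..f} \<Longrightarrow> \<psi> x = 0" and ef: "e < f"
    and \<theta>: "\<theta> \<in> smooth_alg" "\<And>t. (\<theta> has_real_derivative \<theta>' t) (at t)" "\<And>t. t \<notin> {c..d} \<Longrightarrow> \<theta> t = 0" "0 < c" "d < T"
  shows "(LINT t:{0<..<T}|lborel. pairing \<psi> \<psi>' \<psi>'' t * \<theta> t - (LINT x|lborel. u t x * \<psi> x) * \<theta>' t) = 0"
proof -
  have alg: "\<psi>' \<in> smooth_alg" "\<psi>'' \<in> smooth_alg" "\<theta>' \<in> smooth_alg"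
    using smooth_alg_derivE \<psi> \<theta> by blast+
  note cont = smooth_alg_continuous[OF \<psi>(1)] smooth_alg_continuous[OF alg(1)] smooth_alg_continuous[OF alg(2)]
    smooth_alg_continuous[OF \<theta>(1)] smooth_alg_continuous[OF alg(3)]
  note [measurable] = cont[THEN borel_measurable_continuous_onI]
  have \<psi>'0: "x \<notin> {e..f} \<Longrightarrow> \<psi>' x = 0" for x using deriv_zero_outside[OF \<psi>(2) \<psi>0] by blast
  have \<psi>''0: "x \<notin> {e..f} \<Longrightarrow> \<psi>'' x = 0" for x using deriv_zero_outside[OF \<psi>(3) \<psi>'0] by blast
  have \<theta>'0: "x \<notin> {c..d} \<Longrightarrow> \<theta>' x = 0" for x using deriv_zero_outside[OF \<theta>(2,3)] by blast
  obtain B1 where B1: "B1 > 0" "\<And>x. \<bar>\<psi> x\<bar> \<le> B1" using compact_support_bounded[OF cont(1) \<psi>0] by metis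
  obtain B3 where B3: "B3 > 0" "\<And>x. \<bar>\<psi>'' x\<bar> \<le> B3" using compact_support_bounded[OF cont(3) \<psi>''0] by metis
  obtain B4 where B4: "B4 > 0" "\<And>x. \<bar>\<theta> x\<bar> \<le> B4" using compact_support_bounded[OF cont(4) \<theta>(3)] by metis
  obtain B5 where B5: "B5 > 0" "\<And>x. \<bar>\<theta>' x\<bar> \<le> B5" using compact_support_bounded[OF cont(5) \<theta>'0] by metis
  obtain S1 where S1: "S1 > 0" "\<And>t x. t \<in> {0..T} \<Longrightarrow> \<bar>deriv (u t) x\<bar> \<le> S1" using U.bounded by metis
  obtain S2 where S2: "S2 > 0" "\<And>t x. t \<in> {0..T} \<Longrightarrow> \<bar>deriv (h t) x\<bar> \<le> S2" using H.bounded by metis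
  \<comment> \<open>\<open>k1\<close> and \<open>k2\<close> collect the bounded cofactors of
    \<open>u\<close> and \<open>h\<close>. The integrand is then a sum of integrable curves times
    bounded functions, the form required for Fubini.\<close>
  define k1 where "k1 p = - (\<theta>' (fst p) * \<psi> (snd p)) + deriv (u (U.clamp (fst p))) (snd p) * (\<theta> (fst p) * \<psi> (snd p))
     - \<mu> * (\<theta> (fst p) * \<psi>'' (snd p))" for p
  define k2 where "k2 p = deriv (h (U.clamp (fst p))) (snd p) * (\<theta> (fst p) * \<psi> (snd p)) + \<beta> * (\<theta> (fst p) * \<psi> (snd p))" for p
  have k1m: "k1 \<in> borel_measurable (lborel \<Otimes>\<^sub>M lborel)"
    unfolding k1_def[abs_def] by (intro borel_measurable_add borel_measurable_diff borel_measurable_uminus borel_measurable_times U.clamped_deriv_measurable; measurable)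
  have k2m: "k2 \<in> borel_measurable (lborel \<Otimes>\<^sub>M lborel)"
    unfolding k2_def[abs_def] by (intro borel_measurable_add borel_measurable_times H.clamped_deriv_measurable; measurable)
  have prod_le: "\<bar>a * b\<bar> \<le> A * B" if "\<bar>a\<bar> \<le> A" "\<bar>b\<bar> \<le> B" for a b A B :: real
    using mult_mono[OF that] that(1) by (simp add: abs_mult order_trans[OF abs_ge_zero])
  have k1b: "\<bar>k1 p\<bar> \<le> B5 * B1 + S1 * (B4 * B1) + \<mu> * (B4 * B3)" for p
  proof -
    have "\<bar>\<theta>' (fst p) * \<psi> (snd p)\<bar> \<le> B5 * B1" "\<bar>deriv (u (U.clamp (fst p))) (snd p) * (\<theta> (fst p) * \<psi> (snd p))\<bar> \<le> S1 * (B4 * B1)"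
      "\<bar>\<mu> * (\<theta> (fst p) * \<psi>'' (snd p))\<bar> \<le> \<mu> * (B4 * B3)"
      using \<mu> by (intro prod_le B1 B3 B4 B5 S1 U.clamp; simp)+
    then show ?thesis unfolding k1_def by linarith
  qed
  have k2b: "\<bar>k2 p\<bar> \<le> S2 * (B4 * B1) + \<bar>\<beta>\<bar> * (B4 * B1)" for p
  proof -
    have "\<bar>deriv (h (U.clamp (fst p))) (snd p) * (\<theta> (fst p) * \<psi> (snd p))\<bar> \<le> S2 * (B4 * B1)"
      "\<bar>\<beta> * (\<theta> (fst p) * \<psi> (snd p))\<bar> \<le> \<bar>\<beta>\<bar> * (B4 * B1)"
      by (intro prod_le B1 B3 B4 S2 U.clamp; simp)+
    then show ?thesis unfolding k2_def by linarith
  qed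
  let ?I = "\<lambda>p. indicator {0<..<T} (fst p) * (u (U.clamp (fst p)) (snd p) * k1 p) + indicator {0<..<T} (fst p) * (h (U.clamp (fst p)) (snd p) * k2 p)"
  have int: "integrable (lborel \<Otimes>\<^sub>M lborel) ?I"
    by (intro Bochner_Integration.integrable_add U.pair_integrable[OF k1m k1b] H.pair_integrable[OF k2m k2b])
  have tf: "test_function T (\<lambda>t x. \<theta> t * \<psi> x)"
    by (rule test_function_product[OF \<theta>(1) \<psi>(1), of c d e f]) (use \<theta> \<psi>0 in auto)
  have "0 = (LINT p:{0<..<T} \<times> UNIV|lborel.
           (case p of (t, x) \<Rightarrow>
              - u t x * (\<theta>' t * \<psi> x)
              + (u t x * deriv (u t) x + h t x * deriv (h t) x) * (\<theta> t * \<psi> x)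
              + \<beta> * h t x * (\<theta> t * \<psi> x)
              - \<mu> * u t x * (\<theta> t * \<psi>'' x)))"
    using eq[OF tf]
    by (simp only: partial_product[OF \<theta>(2)] partial_product[OF \<psi>(2)] partial_product[OF \<psi>(3)])
  also have "\<dots> = (LINT p|(lborel \<Otimes>\<^sub>M lborel). ?I p)"
    unfolding set_lebesgue_integral_def lborel_prod
    by (intro Bochner_Integration.integral_cong refl)
       (auto simp: indicator_def k1_def k2_def U.clamp algebra_simps)
  also have "\<dots> = (LINT t|lborel. LINT x|lborel. ?I (t, x))"
    by (rule lborel_pair.integral_fst'[OF int, symmetric])
  also have "\<dots> = (LINT t:{0<..<T}|lborel. pairing \<psi> \<psi>' \<psi>'' t * \<theta> t - (LINT x|lborel. u t x * \<psi> x) * \<theta>' t)"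
    unfolding set_lebesgue_integral_def
  proof (intro Bochner_Integration.integral_cong refl)
    fix t
    show "(LINT x|lborel. ?I (t, x)) = indicator {0<..<T} t *\<^sub>R (pairing \<psi> \<psi>' \<psi>'' t * \<theta> t - (LINT x|lborel. u t x * \<psi> x) * \<theta>' t)"
    proof (cases "t \<in> {0<..<T}")
      case True
      then have t: "t \<in> {0..T}" and [simp]: "U.clamp t = t" by (auto simp: U.clamp)
      note [measurable] = U.deriv_measurable[OF t] H.deriv_measurable[OF t]
      have i1: "integrable lborel (\<lambda>x. u t x * \<psi> x)" by (rule U.integrable_times[OF t _ B1(2)]) measurable
      have i2: "integrable lborel (\<lambda>x. u t x * (deriv (u t) x * \<psi> x))"
        by (rule U.integrable_times[OF t _ prod_le[OF S1(2)[OF t] B1(2)]]) measurable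
      have i3: "integrable lborel (\<lambda>x. u t x * \<psi>'' x)" by (rule U.integrable_times[OF t _ B3(2)]) measurable
      have i4: "integrable lborel (\<lambda>x. h t x * (deriv (h t) x * \<psi> x))"
        by (rule H.integrable_times[OF t _ prod_le[OF S2(2)[OF t] B1(2)]]) measurable
      have i5: "integrable lborel (\<lambda>x. h t x * \<psi> x)" by (rule H.integrable_times[OF t _ B1(2)]) measurable
      have parts: "(LINT x|lborel. u t x * (deriv (u t) x * \<psi> x)) = - (LINT x|lborel. (u t x)\<^sup>2 * \<psi>' x) / 2"
        "(LINT x|lborel. h t x * (deriv (h t) x * \<psi> x)) = - (LINT x|lborel. (h t x)\<^sup>2 * \<psi>' x) / 2"
        by (rule U.integral_v_deriv[OF t \<psi>(2) cont(2) _ ef] H.integral_v_deriv[OF t \<psi>(2) cont(2) _ ef], erule \<psi>0)+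
      have "(LINT x|lborel. ?I (t, x)) = (LINT x|lborel. - \<theta>' t * (u t x * \<psi> x) + \<theta> t * (u t x * (deriv (u t) x * \<psi> x))
         + (- \<mu> * \<theta> t) * (u t x * \<psi>'' x) + \<theta> t * (h t x * (deriv (h t) x * \<psi> x)) + (\<beta> * \<theta> t) * (h t x * \<psi> x))"
        using True by (intro Bochner_Integration.integral_cong refl) (simp add: k1_def k2_def algebra_simps)
      also have "\<dots> = - \<theta>' t * (LINT x|lborel. u t x * \<psi> x) + \<theta> t * (LINT x|lborel. u t x * (deriv (u t) x * \<psi> x))
         + (- \<mu> * \<theta> t) * (LINT x|lborel. u t x * \<psi>'' x) + \<theta> t * (LINT x|lborel. h t x * (deriv (h t) x * \<psi> x)) + (\<beta> * \<theta> t) * (LINT x|lborel. h t x * \<psi> x)"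
        using i1 i2 i3 i4 i5 by simp
      also have "\<dots> = pairing \<psi> \<psi>' \<psi>'' t * \<theta> t - (LINT x|lborel. u t x * \<psi> x) * \<theta>' t"
        unfolding parts pairing_def
        by (simp add: field_simps)
      finally show ?thesis using True by simp
    qed simp
  qed
  finally show ?thesis by simp
qed

lemma integrated_form_compact:
  assumes \<psi>: "\<psi> \<in> smooth_alg" "\<And>x. (\<psi> has_real_derivative \<psi>' x) (at x)" "\<And>x. (\<psi>' has_real_derivative \<psi>'' x) (at x)"
    and \<psi>0: "\<And>x. x \<notin> {e..f} \<Longrightarrow> \<psi> x = 0" and ef: "e < f"
    and ab: "0 < a" "a < b" "b < T"
  shows "(LINT x|lborel. u b x * \<psi> x) - (LINT x|lborel. u a x * \<psi> x) = - (LINT t:{a<..<b}|lborel. pairing \<psi> \<psi>' \<psi>'' t)"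
proof (rule weak_derivative_imp_integral[where f = "\<lambda>t. LINT x|lborel. u t x * \<psi> x"])
  have alg: "\<psi>' \<in> smooth_alg" "\<psi>'' \<in> smooth_alg"
    using smooth_alg_derivE \<psi> by blast+
  note cont = smooth_alg_continuous[OF \<psi>(1)] smooth_alg_continuous[OF alg(1)] smooth_alg_continuous[OF alg(2)]
  note [measurable] = cont[THEN borel_measurable_continuous_onI]
  have \<psi>'0: "x \<notin> {e..f} \<Longrightarrow> \<psi>' x = 0" for x using deriv_zero_outside[OF \<psi>(2) \<psi>0] by blast
  have \<psi>''0: "x \<notin> {e..f} \<Longrightarrow> \<psi>'' x = 0" for x using deriv_zero_outside[OF \<psi>(3) \<psi>'0] by blast
  obtain B1 where B1: "B1 > 0" "\<And>x. \<bar>\<psi> x\<bar> \<le> B1" using compact_support_bounded[OF cont(1) \<psi>0] by metis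
  obtain B2 where B2: "B2 > 0" "\<And>x. \<bar>\<psi>' x\<bar> \<le> B2" using compact_support_bounded[OF cont(2) \<psi>'0] by metis
  obtain B3 where B3: "B3 > 0" "\<And>x. \<bar>\<psi>'' x\<bar> \<le> B3" using compact_support_bounded[OF cont(3) \<psi>''0] by metis
  show "continuous_on {0..T} (\<lambda>t. LINT x|lborel. u t x * \<psi> x)"
    using U.pairing_continuous(1)[of \<psi> B1] B1 by simp
  show "continuous_on {0..T} (pairing \<psi> \<psi>' \<psi>'')"
    by (rule pairing_continuous[where B = "max B1 (max B2 B3)"]) (use B1 B2 B3 in \<open>auto simp: le_max_iff_disj\<close>)
  show "(LINT t:{0<..<T}|lborel. pairing \<psi> \<psi>' \<psi>'' t * \<theta> t - (LINT x|lborel. u t x * \<psi> x) * \<theta>' t) = 0"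
    if "\<theta> \<in> smooth_alg" "\<And>t. (\<theta> has_real_derivative \<theta>' t) (at t)" "0 < c" "d < T" "\<And>t. t \<notin> {c..d} \<Longrightarrow> \<theta> t = 0"
    for \<theta> \<theta>' c d
    by (rule weak_form[OF \<psi> \<psi>0 ef that(1,2,5,3,4)])
qed (use ab in auto)

text \<open>Integrability of \<open>u\<close> and \<open>h\<close> in space is what admits test
  functions that are merely bounded: pointwise and uniformly bounded convergence, up to two
  derivatives, suffices for dominated convergence in x and then in t.\<close>

lemma integrated_form_limit:
  fixes \<psi> \<psi>' \<psi>'' :: "real \<Rightarrow> real"
  assumes [measurable]: "\<And>n::nat. \<psi>n n \<in> borel_measurable borel" "\<And>n. \<psi>n' n \<in> borel_measurable borel" "\<And>n. \<psi>n'' n \<in> borel_measurable borel"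
    and [measurable]: "\<psi> \<in> borel_measurable borel" "\<psi>' \<in> borel_measurable borel" "\<psi>'' \<in> borel_measurable borel"
    and B: "\<And>n x. \<bar>\<psi>n n x\<bar> \<le> B" "\<And>n x. \<bar>\<psi>n' n x\<bar> \<le> B" "\<And>n x. \<bar>\<psi>n'' n x\<bar> \<le> B"
    and lim: "\<And>x. (\<lambda>n. \<psi>n n x) \<longlonglongrightarrow> \<psi> x" "\<And>x. (\<lambda>n. \<psi>n' n x) \<longlonglongrightarrow> \<psi>' x" "\<And>x. (\<lambda>n. \<psi>n'' n x) \<longlonglongrightarrow> \<psi>'' x"
    and ab: "0 < a" "a < b" "b < T"
    and eq: "\<And>n. (LINT x|lborel. u b x * \<psi>n n x) - (LINT x|lborel. u a x * \<psi>n n x) = - (LINT t:{a<..<b}|lborel. pairing (\<psi>n n) (\<psi>n' n) (\<psi>n'' n) t)"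
  shows "(LINT x|lborel. u b x * \<psi> x) - (LINT x|lborel. u a x * \<psi> x) = - (LINT t:{a<..<b}|lborel. pairing \<psi> \<psi>' \<psi>'' t)"
proof -
  have lim1: "(\<lambda>n. LINT x|lborel. w x * pn n x) \<longlonglongrightarrow> (LINT x|lborel. w x * p x)"
    if w: "integrable lborel w" and [measurable]: "\<And>n. pn n \<in> borel_measurable borel" "p \<in> borel_measurable borel"
      and "\<And>n x. \<bar>pn n x\<bar> \<le> B" "\<And>x. (\<lambda>n. pn n x) \<longlonglongrightarrow> p x"
    for w :: "real \<Rightarrow> real" and pn :: "nat \<Rightarrow> real \<Rightarrow> real" and p
  proof (rule integral_dominated_convergence[where w = "\<lambda>x. B * \<bar>w x\<bar>"])
    show "AE x in lborel. norm (w x * pn n x) \<le> B * \<bar>w x\<bar>" for n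
      by (intro AE_I2) (simp add: abs_mult mult.commute[of B] mult_left_mono that(4))
    show "AE x in lborel. (\<lambda>n. w x * pn n x) \<longlonglongrightarrow> w x * p x" by (intro AE_I2 tendsto_intros that)
  qed (use w in auto)
  have B0: "B \<ge> 0" using order_trans[OF abs_ge_zero B(1)] .
  have le1: "\<bar>LINT x|lborel. w x * p x\<bar> \<le> (LINT x|lborel. \<bar>w x\<bar>) * B"
    if w: "integrable lborel w" and "p \<in> borel_measurable borel" and "\<And>x. \<bar>p x\<bar> \<le> B" for w p :: "real \<Rightarrow> real"
  proof -
    have "\<bar>LINT x|lborel. w x * p x\<bar> \<le> (LINT x|lborel. \<bar>w x * p x\<bar>)"
      using integral_norm_bound[of lborel "\<lambda>x. w x * p x"] by simp
    also have "\<dots> \<le> (LINT x|lborel. \<bar>w x\<bar> * B)"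
      by (intro integral_mono integrable_abs integrable_mult_bounded[OF w, where B = B] integrable_mult_left)
         (use that in \<open>auto simp: abs_mult intro!: mult_left_mono\<close>)
    finally show ?thesis by simp
  qed
  obtain S1 where S1: "S1 > 0" "\<And>t x. t \<in> {0..T} \<Longrightarrow> \<bar>u t x\<bar> \<le> S1" "\<And>t. t \<in> {0..T} \<Longrightarrow> (LINT x|lborel. \<bar>u t x\<bar>) \<le> S1"
    using U.bounded by metis
  obtain S2 where S2: "S2 > 0" "\<And>t x. t \<in> {0..T} \<Longrightarrow> \<bar>h t x\<bar> \<le> S2" "\<And>t. t \<in> {0..T} \<Longrightarrow> (LINT x|lborel. \<bar>h t x\<bar>) \<le> S2"
    using H.bounded by metis
  have sq: "(LINT x|lborel. \<bar>(v x)\<^sup>2\<bar>) \<le> S * S" if "\<And>x. \<bar>v x\<bar> \<le> S" "(LINT x|lborel. \<bar>v x\<bar>) \<le> S" "integrable lborel v"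
      "integrable lborel (\<lambda>x. (v x)\<^sup>2)" "S > 0" for v :: "real \<Rightarrow> real" and S
  proof -
    have "(LINT x|lborel. \<bar>(v x)\<^sup>2\<bar>) \<le> (LINT x|lborel. S * \<bar>v x\<bar>)"
    proof (intro integral_mono integrable_abs integrable_mult_right that)
      fix x
      have "\<bar>(v x)\<^sup>2\<bar> = \<bar>v x\<bar> * \<bar>v x\<bar>" by (simp add: power2_eq_square abs_mult)
      also have "\<dots> \<le> S * \<bar>v x\<bar>" by (intro mult_right_mono that) auto
      finally show "\<bar>(v x)\<^sup>2\<bar> \<le> S * \<bar>v x\<bar>" .
    qed
    also have "\<dots> \<le> S * S" using that by simp
    finally show ?thesis .
  qed
  define K where "K = (S1 * S1 * B + S2 * S2 * B) / 2 + \<bar>\<beta>\<bar> * (S2 * B) + \<mu> * (S1 * B)"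
  have bound: "\<bar>pairing (\<psi>n n) (\<psi>n' n) (\<psi>n'' n) t\<bar> \<le> K" if t: "t \<in> {0..T}" for n t
  proof -
    have 1: "\<bar>LINT x|lborel. (u t x)\<^sup>2 * \<psi>n' n x\<bar> \<le> S1 * S1 * B"
      by (rule order_trans[OF le1 mult_right_mono[OF sq]]) (use t S1 U.integrable U.integrable_sq B B0 in auto)
    have 2: "\<bar>LINT x|lborel. (h t x)\<^sup>2 * \<psi>n' n x\<bar> \<le> S2 * S2 * B"
      by (rule order_trans[OF le1 mult_right_mono[OF sq]]) (use t S2 H.integrable H.integrable_sq B B0 in auto)
    have 3: "\<bar>LINT x|lborel. h t x * \<psi>n n x\<bar> \<le> S2 * B"
      by (rule order_trans[OF le1 mult_right_mono]) (use t S2 H.integrable B B0 in auto)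
    have 4: "\<bar>LINT x|lborel. u t x * \<psi>n'' n x\<bar> \<le> S1 * B"
      by (rule order_trans[OF le1 mult_right_mono]) (use t S1 U.integrable B B0 in auto)
    have b3: "\<bar>\<beta> * (LINT x|lborel. h t x * \<psi>n n x)\<bar> \<le> \<bar>\<beta>\<bar> * (S2 * B)"
      unfolding abs_mult by (intro mult_left_mono 3) auto
    have b4: "\<bar>\<mu> * (LINT x|lborel. u t x * \<psi>n'' n x)\<bar> \<le> \<mu> * (S1 * B)"
      unfolding abs_mult using \<mu> 4 by (simp add: mult_left_mono)
    have "\<bar>- (x + y) / 2 + z - z'\<bar> \<le> (X + Y) / 2 + Z + Z'"
      if "\<bar>x\<bar> \<le> X" "\<bar>y\<bar> \<le> Y" "\<bar>z\<bar> \<le> Z" "\<bar>z'\<bar> \<le> Z'" for x y z z' X Y Z Z' :: real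
    proof -
      have "- X \<le> x" "x \<le> X" "- Y \<le> y" "y \<le> Y" "- Z \<le> z" "z \<le> Z" "- Z' \<le> z'" "z' \<le> Z'"
        using that by (auto simp: abs_le_iff)
      then show ?thesis unfolding abs_le_iff by (intro conjI) (simp_all add: field_simps)
    qed
    from this[OF 1 2 b3 b4] show ?thesis unfolding pairing_def K_def .
  qed
  have plim: "(\<lambda>n. pairing (\<psi>n n) (\<psi>n' n) (\<psi>n'' n) t) \<longlonglongrightarrow> pairing \<psi> \<psi>' \<psi>'' t" if t: "t \<in> {0..T}" for t
    unfolding pairing_def
    by (intro tendsto_intros lim1 U.integrable H.integrable U.integrable_sq H.integrable_sq t B lim) auto
  have Bl: "\<bar>\<psi> x\<bar> \<le> B" "\<bar>\<psi>' x\<bar> \<le> B" "\<bar>\<psi>'' x\<bar> \<le> B" for x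
    using lim[of x, THEN tendsto_rabs] B
    by (auto intro!: LIMSEQ_le_const2)
  have meas: "(\<lambda>t. indicator {a<..<b} t *\<^sub>R g t) \<in> borel_measurable lborel" if "continuous_on {0..T} g" for g :: "real \<Rightarrow> real"
  proof -
    have "{a<..<b} \<subseteq> {0..T}" using ab by auto
    from borel_measurable_continuous_on_indicator[OF _ continuous_on_subset[OF that this]] show ?thesis by simp
  qed
  have "(\<lambda>n. LINT t:{a<..<b}|lborel. pairing (\<psi>n n) (\<psi>n' n) (\<psi>n'' n) t) \<longlonglongrightarrow> (LINT t:{a<..<b}|lborel. pairing \<psi> \<psi>' \<psi>'' t)"
    unfolding set_lebesgue_integral_def
  proof (rule integral_dominated_convergence[where w = "\<lambda>t. indicator {a<..<b} t * K"])
    show "integrable lborel (\<lambda>t. indicator {a<..<b} t * K)"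
      by (intro integrable_mult_left integrable_real_indicator) (use ab in auto)
    show "AE t in lborel. (\<lambda>n. indicator {a<..<b} t *\<^sub>R pairing (\<psi>n n) (\<psi>n' n) (\<psi>n'' n) t) \<longlonglongrightarrow> indicator {a<..<b} t *\<^sub>R pairing \<psi> \<psi>' \<psi>'' t"
      using plim ab by (auto simp: indicator_def)
    show "AE t in lborel. norm (indicator {a<..<b} t *\<^sub>R pairing (\<psi>n n) (\<psi>n' n) (\<psi>n'' n) t) \<le> indicator {a<..<b} t * K" for n
      using bound ab by (auto simp: indicator_def)
  qed (intro meas pairing_continuous[where B = B] B Bl; measurable)+
  then have "(\<lambda>n. - (LINT t:{a<..<b}|lborel. pairing (\<psi>n n) (\<psi>n' n) (\<psi>n'' n) t)) \<longlonglongrightarrow> - (LINT t:{a<..<b}|lborel. pairing \<psi> \<psi>' \<psi>'' t)"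
    by (rule tendsto_minus)
  moreover have "(\<lambda>n. (LINT x|lborel. u b x * \<psi>n n x) - (LINT x|lborel. u a x * \<psi>n n x)) \<longlonglongrightarrow>
      (LINT x|lborel. u b x * \<psi> x) - (LINT x|lborel. u a x * \<psi> x)"
    by (intro tendsto_intros lim1 U.integrable B lim) (use ab in auto)
  ultimately show ?thesis unfolding eq by (rule LIMSEQ_unique[rotated])
qed

end

section \<open>From compactly supported to trigonometric test functions\<close>

context hilbert_flow
begin

lemma integrated_form:
  assumes p: "p \<in> smooth_alg" "\<And>x. (p has_real_derivative p' x) (at x)" "\<And>x. (p' has_real_derivative p'' x) (at x)"
    and B: "\<And>x. \<bar>p x\<bar> \<le> B" "\<And>x. \<bar>p' x\<bar> \<le> B" "\<And>x. \<bar>p'' x\<bar> \<le> B"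
    and ab: "0 < a" "a < b" "b < T"
  shows "(LINT x|lborel. u b x * p x) - (LINT x|lborel. u a x * p x) = - (LINT t:{a<..<b}|lborel. pairing p p' p'' t)"
proof -
  have palg: "p' \<in> smooth_alg" "p'' \<in> smooth_alg" using smooth_alg_derivE p by blast+
  \<comment> \<open>Equal to 1 on [-1, 1] and to 0 outside [-2, 2]. Dilated by \<open>r n\<close>,
    its derivatives gain factors \<open>r n\<close> and \<open>(r n)^2\<close>, so all terms with a
    differentiated cutoff vanish in the limit.\<close>
  define c where "c x = step (x + 2) * step (2 - x)" for x
  have "(\<lambda>x. step (1 * x + 2) * step ((-1) * x + 2)) \<in> smooth_alg" by (intro smooth_alg.intros)
  then have c: "c \<in> smooth_alg" by (simp add: c_def[abs_def])
  obtain c1 where c1: "c1 \<in> smooth_alg" "\<And>x. (c has_real_derivative c1 x) (at x)" using smooth_alg_deriv[OF c] by blast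
  obtain c2 where c2: "c2 \<in> smooth_alg" "\<And>x. (c1 has_real_derivative c2 x) (at x)" using smooth_alg_deriv[OF c1(1)] by blast
  have c0: "x \<notin> {-2..2} \<Longrightarrow> c x = 0" for x by (auto simp: c_def step_props)
  have c10: "x \<notin> {-2..2} \<Longrightarrow> c1 x = 0" for x using deriv_zero_outside[OF c1(2) c0] by blast
  have c20: "x \<notin> {-2..2} \<Longrightarrow> c2 x = 0" for x using deriv_zero_outside[OF c2(2) c10] by blast
  obtain C0 where C0: "C0 > 0" "\<And>x. \<bar>c x\<bar> \<le> C0" using compact_support_bounded[OF smooth_alg_continuous[OF c] c0] by metis
  obtain C1 where C1: "C1 > 0" "\<And>x. \<bar>c1 x\<bar> \<le> C1" using compact_support_bounded[OF smooth_alg_continuous[OF c1(1)] c10] by metis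
  obtain C2 where C2: "C2 > 0" "\<And>x. \<bar>c2 x\<bar> \<le> C2" using compact_support_bounded[OF smooth_alg_continuous[OF c2(1)] c20] by metis
  note cont = smooth_alg_continuous[OF c, of UNIV] smooth_alg_continuous[OF c1(1), of UNIV] smooth_alg_continuous[OF c2(1), of UNIV]
    smooth_alg_continuous[OF p(1), of UNIV] smooth_alg_continuous[OF palg(1), of UNIV] smooth_alg_continuous[OF palg(2), of UNIV]
  note [measurable] = cont[THEN borel_measurable_continuous_onI]
  define r where "r n = inverse (real (Suc n))" for n
  have r: "r n > 0" "r n \<le> 1" for n by (auto simp: r_def divide_simps)
  have r0: "r \<longlonglongrightarrow> 0" unfolding r_def using LIMSEQ_inverse_real_of_nat .
  have cc: "(\<lambda>n. g (r n * x)) \<longlonglongrightarrow> g 0" if "continuous_on UNIV g" for g :: "real \<Rightarrow> real" and x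
  proof (rule isCont_tendsto_compose[of 0 g "\<lambda>n. r n * x"])
    show "isCont g 0" using that by (simp add: continuous_on_eq_continuous_at)
    show "(\<lambda>n. r n * x) \<longlonglongrightarrow> 0" using tendsto_mult[OF r0 tendsto_const[of x]] by simp
  qed
  define q where "q n x = c (r n * x) * p x" for n x
  define q' where "q' n x = r n * c1 (r n * x) * p x + c (r n * x) * p' x" for n x
  define q'' where "q'' n x = (r n)\<^sup>2 * c2 (r n * x) * p x + 2 * r n * c1 (r n * x) * p' x + c (r n * x) * p'' x" for n x
  have dc: "((\<lambda>x. c (r n * x)) has_real_derivative c1 (r n * x) * r n) (at x)"
    and dc1: "((\<lambda>x. c1 (r n * x)) has_real_derivative c2 (r n * x) * r n) (at x)" for n x
    by (rule DERIV_chain2[OF c1(2)] DERIV_chain2[OF c2(2)], auto intro!: derivative_eq_intros)+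
  have qd: "(q n has_real_derivative q' n x) (at x)" "(q' n has_real_derivative q'' n x) (at x)" for n x
    unfolding q_def[abs_def] q'_def[abs_def] q''_def
    by ((rule derivative_eq_intros dc dc1 p refl)+, simp add: algebra_simps power2_eq_square)+
  have qalg: "q n \<in> smooth_alg" for n
  proof -
    have "(\<lambda>x. (step (r n * x + 2) * step ((- r n) * x + 2)) * p x) \<in> smooth_alg" by (intro smooth_alg.intros p)
    then show ?thesis by (simp add: q_def[abs_def] c_def)
  qed
  have q0: "q n x = 0" if "x \<notin> {- 2 / r n..2 / r n}" for n x
  proof -
    have "r n * x \<notin> {-2..2}" using that r(1)[of n] by (auto simp: field_simps)
    then show ?thesis by (simp add: q_def c0)
  qed
  have B0: "B \<ge> 0" using order_trans[OF abs_ge_zero B(1)] .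
  have r2: "(r n)\<^sup>2 \<le> 1" for n using r[of n] by (simp add: power_le_one)
  have prod: "\<bar>x * y * z\<bar> \<le> X * Y * Z" if "\<bar>x\<bar> \<le> X" "\<bar>y\<bar> \<le> Y" "\<bar>z\<bar> \<le> Z" for x y z X Y Z :: real
    unfolding abs_mult using that by (intro mult_mono mult_nonneg_nonneg) (auto intro: order_trans[OF abs_ge_zero])
  define K where "K = C0 * B + 2 * C1 * B + C2 * B"
  have bounds: "\<bar>q n x\<bar> \<le> K" "\<bar>q' n x\<bar> \<le> K" "\<bar>q'' n x\<bar> \<le> K" for n x
  proof -
    have 1: "\<bar>1 * c (r n * x) * p x\<bar> \<le> 1 * C0 * B" "\<bar>1 * c (r n * x) * p' x\<bar> \<le> 1 * C0 * B" "\<bar>1 * c (r n * x) * p'' x\<bar> \<le> 1 * C0 * B"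
      "\<bar>r n * c1 (r n * x) * p x\<bar> \<le> 1 * C1 * B" "\<bar>(2 * r n) * c1 (r n * x) * p' x\<bar> \<le> 2 * C1 * B"
      "\<bar>(r n)\<^sup>2 * c2 (r n * x) * p x\<bar> \<le> 1 * C2 * B"
      by (rule prod; use r[of n] r2[of n] B C0 C1 C2 in simp)+
    have 2: "C0 * B \<ge> 0" "C1 * B \<ge> 0" "C2 * B \<ge> 0" using C0 C1 C2 B0 by auto
    show "\<bar>q n x\<bar> \<le> K" "\<bar>q' n x\<bar> \<le> K" "\<bar>q'' n x\<bar> \<le> K"
      unfolding q_def q'_def q''_def K_def using 1 2 by linarith+
  qed
  have c00: "c 0 = 1" by (simp add: c_def step_props)
  show ?thesis
  proof (rule integrated_form_limit[where B = K])
    fix x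
    show "(\<lambda>n. q n x) \<longlonglongrightarrow> p x"
      using tendsto_mult[OF cc[OF cont(1), of x] tendsto_const[of "p x"]] by (simp add: q_def c00)
    have "(\<lambda>n. q' n x) \<longlonglongrightarrow> 0 * c1 0 * p x + c 0 * p' x"
      unfolding q'_def by (intro tendsto_intros r0 cc cont)
    then show "(\<lambda>n. q' n x) \<longlonglongrightarrow> p' x" by (simp add: c00)
    have "(\<lambda>n. q'' n x) \<longlonglongrightarrow> 0\<^sup>2 * c2 0 * p x + 2 * 0 * c1 0 * p' x + c 0 * p'' x"
      unfolding q''_def by (intro tendsto_intros r0 cc cont)
    then show "(\<lambda>n. q'' n x) \<longlonglongrightarrow> p'' x" by (simp add: c00)
  next
    fix n
    show "q n \<in> borel_measurable borel" "q' n \<in> borel_measurable borel" "q'' n \<in> borel_measurable borel"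
      unfolding q_def[abs_def] q'_def[abs_def] q''_def[abs_def] by measurable
    show "(LINT x|lborel. u b x * q n x) - (LINT x|lborel. u a x * q n x) = - (LINT t:{a<..<b}|lborel. pairing (q n) (q' n) (q'' n) t)"
      by (rule integrated_form_compact[OF qalg qd, where e = "- 2 / r n" and f = "2 / r n"])
         (use q0[of _ n] ab r(1)[of n] in \<open>auto simp: divide_strict_right_mono\<close>)
  qed (use bounds ab in \<open>auto intro!: borel_measurable_continuous_onI cont\<close>)
qed

text \<open>The analytic signal $u + i\mathcal{H}u$: its Fourier transform is $2\hat u$ on positive and 0 on negative frequencies.\<close>
definition w :: "real \<Rightarrow> real \<Rightarrow> complex" where "w t x = Complex (u t x) (h t x)"

text \<open>The square modulus of \<open>w\<close>. Since u u_x + h h_x is half its derivative, the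
  two nonlinear terms act as one.\<close>

definition q :: "real \<Rightarrow> real \<Rightarrow> real" where "q t x = (u t x)\<^sup>2 + (h t x)\<^sup>2"

lemma ft_cx:
  assumes f: "integrable lborel f"
  shows "ft (cx f) \<xi> = of_real (LINT x|lborel. f x * cos (\<xi> * x)) - \<i> * of_real (LINT x|lborel. f x * sin (\<xi> * x))"
proof -
  have i: "integrable lborel (\<lambda>x. f x * cos (\<xi> * x))" "integrable lborel (\<lambda>x. f x * sin (\<xi> * x))"
    by (rule integrable_mult_bounded[OF f, where B = 1]; simp)+
  have "ft (cx f) \<xi> = (LINT x|lborel. of_real (f x * cos (\<xi> * x)) - \<i> * of_real (f x * sin (\<xi> * x)))"
    unfolding ft_def by (intro Bochner_Integration.integral_cong refl) (simp add: complex_eq_iff mult.commute)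
  also have "\<dots> = (LINT x|lborel. complex_of_real (f x * cos (\<xi> * x))) - (LINT x|lborel. \<i> * of_real (f x * sin (\<xi> * x)))"
    by (intro Bochner_Integration.integral_diff integrable_mult_right integrable_of_real i)
  also have "(LINT x|lborel. \<i> * of_real (f x * sin (\<xi> * x))) = \<i> * (LINT x|lborel. complex_of_real (f x * sin (\<xi> * x)))"
    by (rule integral_mult_right_zero)
  finally show ?thesis by (simp only: integral_complex_of_real)
qed

lemma integrable_q: "t \<in> {0..T} \<Longrightarrow> integrable lborel (q t)"
  unfolding q_def[abs_def] by (intro Bochner_Integration.integrable_add U.integrable_sq H.integrable_sq)

lemma ft_continuous_in_time:
  "continuous_on {0..T} (\<lambda>t. ft (cx (u t)) \<xi>)" "continuous_on {0..T} (\<lambda>t. ft (cx (h t)) \<xi>)"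
  "continuous_on {0..T} (\<lambda>t. ft (cx (q t)) \<xi>)"
proof -
  have e: "(\<lambda>x. cis (- (x * \<xi>))) \<in> borel_measurable borel" "\<And>x. norm (cis (- (x * \<xi>))) \<le> 1" by auto
  note U = U.pairing_continuous[OF e] and H = H.pairing_continuous[OF e]
  show "continuous_on {0..T} (\<lambda>t. ft (cx (u t)) \<xi>)" "continuous_on {0..T} (\<lambda>t. ft (cx (h t)) \<xi>)"
    using U(1) H(1) by (simp_all add: ft_def scaleR_conv_of_real)
  have "continuous_on {0..T} (\<lambda>t. (LINT x|lborel. (u t x)\<^sup>2 *\<^sub>R cis (- (x * \<xi>))) + (LINT x|lborel. (h t x)\<^sup>2 *\<^sub>R cis (- (x * \<xi>))))"
    by (intro continuous_intros U(2) H(2))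
  also have "?this \<longleftrightarrow> continuous_on {0..T} (\<lambda>t. ft (cx (q t)) \<xi>)"
  proof (rule continuous_on_cong[OF refl])
    fix t assume t: "t \<in> {0..T}"
    have "(LINT x|lborel. (u t x)\<^sup>2 *\<^sub>R cis (- (x * \<xi>))) + (LINT x|lborel. (h t x)\<^sup>2 *\<^sub>R cis (- (x * \<xi>))) =
      (LINT x|lborel. (u t x)\<^sup>2 *\<^sub>R cis (- (x * \<xi>)) + (h t x)\<^sup>2 *\<^sub>R cis (- (x * \<xi>)))"
      unfolding scaleR_conv_of_real
      by (intro Bochner_Integration.integral_add[symmetric] integrable_mult_cis integrable_of_real U.integrable_sq H.integrable_sq t) auto
    then show "(LINT x|lborel. (u t x)\<^sup>2 *\<^sub>R cis (- (x * \<xi>))) + (LINT x|lborel. (h t x)\<^sup>2 *\<^sub>R cis (- (x * \<xi>))) = ft (cx (q t)) \<xi>"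
      by (simp add: ft_def q_def scaleR_conv_of_real algebra_simps)
  qed
  finally show "continuous_on {0..T} (\<lambda>t. ft (cx (q t)) \<xi>)" .
qed

lemma set_integrable_continuous:
  fixes g :: "real \<Rightarrow> 'b::{banach, second_countable_topology}"
  assumes "continuous_on {0..T} g" "0 \<le> a" "b \<le> T"
  shows "set_integrable lborel {a<..<b} g"
  by (rule set_integrable_subset[OF borel_integrable_compact[of "{0..T}" g, folded set_integrable_def]])
     (use assms in auto)

text \<open>Cosine and sine are tested separately because test functions are real; the first minus i
  times the second gives the transform. Integration by parts turns half the derivative of
  \<open>q\<close> into the factor i \<xi> / 2.\<close>

lemma ft_integrated:
  assumes ab: "0 < a" "a < b" "b < T"
  shows "ft (cx (u b)) \<xi> - ft (cx (u a)) \<xi> =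
    - (LINT t:{a<..<b}|lborel. \<i> * of_real \<xi> / 2 * ft (cx (q t)) \<xi> + of_real \<beta> * ft (cx (h t)) \<xi> + of_real (\<mu> * \<xi>\<^sup>2) * ft (cx (u t)) \<xi>)"
proof -
  \<comment> \<open>A common bound for both trigonometric functions and their first two
    derivatives.\<close>
  let ?B = "1 + \<bar>\<xi>\<bar> + \<xi>\<^sup>2"
  have bnd: "\<bar>k * x\<bar> \<le> \<bar>k\<bar>" if "\<bar>x\<bar> \<le> 1" for k x :: real
    using mult_left_mono[OF that, of "\<bar>k\<bar>"] by (simp add: abs_mult)
  let ?c = "\<lambda>x. cos (\<xi> * x)" and ?s = "\<lambda>x. sin (\<xi> * x)"
  let ?C = "\<lambda>f. LINT x|lborel. f x * cos (\<xi> * x)" and ?S = "\<lambda>f. LINT x|lborel. f x * sin (\<xi> * x)"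
  have le: "\<bar>?c x\<bar> \<le> ?B" "\<bar>?s x\<bar> \<le> ?B" "\<bar>(- \<xi>) * ?s x\<bar> \<le> ?B" "\<bar>\<xi> * ?c x\<bar> \<le> ?B" "\<bar>(- (\<xi>\<^sup>2)) * ?c x\<bar> \<le> ?B" "\<bar>(- (\<xi>\<^sup>2)) * ?s x\<bar> \<le> ?B" for x
    using bnd[OF abs_sin_le_one[of "\<xi> * x"], of "- \<xi>"] bnd[OF abs_cos_le_one[of "\<xi> * x"], of \<xi>]
      bnd[OF abs_cos_le_one[of "\<xi> * x"], of "- (\<xi>\<^sup>2)"] bnd[OF abs_sin_le_one[of "\<xi> * x"], of "- (\<xi>\<^sup>2)"]
      abs_cos_le_one[of "\<xi> * x"] abs_sin_le_one[of "\<xi> * x"] zero_le_power2[of \<xi>] abs_ge_zero[of \<xi>]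
    unfolding abs_minus_cancel abs_power2 by linarith+
  have 1: "?C (u b) - ?C (u a) = - (LINT t:{a<..<b}|lborel. pairing ?c (\<lambda>x. (- \<xi>) * ?s x) (\<lambda>x. (- (\<xi>\<^sup>2)) * ?c x) t)"
    by (rule integrated_form[where B = ?B]) (use le ab in \<open>auto intro!: smooth_alg.intros derivative_eq_intros simp: power2_eq_square\<close>)
  have 2: "?S (u b) - ?S (u a) = - (LINT t:{a<..<b}|lborel. pairing ?s (\<lambda>x. \<xi> * ?c x) (\<lambda>x. (- (\<xi>\<^sup>2)) * ?s x) t)"
    by (rule integrated_form[where B = ?B]) (use le ab in \<open>auto intro!: smooth_alg.intros derivative_eq_intros simp: power2_eq_square\<close>)
  have pc: "continuous_on {0..T} (pairing ?c (\<lambda>x. (- \<xi>) * ?s x) (\<lambda>x. (- (\<xi>\<^sup>2)) * ?c x))"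
    "continuous_on {0..T} (pairing ?s (\<lambda>x. \<xi> * ?c x) (\<lambda>x. (- (\<xi>\<^sup>2)) * ?s x))"
    by (rule pairing_continuous[where B = ?B]; (rule le | measurable))+
  have u: "integrable lborel (u t)" "integrable lborel (h t)" if "t \<in> {0..T}" for t using that U.integrable H.integrable by auto
  have ptw: "\<i> * of_real \<xi> / 2 * ft (cx (q t)) \<xi> + of_real \<beta> * ft (cx (h t)) \<xi> + of_real (\<mu> * \<xi>\<^sup>2) * ft (cx (u t)) \<xi> =
     of_real (pairing ?c (\<lambda>x. (- \<xi>) * ?s x) (\<lambda>x. (- (\<xi>\<^sup>2)) * ?c x) t) - \<i> * of_real (pairing ?s (\<lambda>x. \<xi> * ?c x) (\<lambda>x. (- (\<xi>\<^sup>2)) * ?s x) t)"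
    if t: "t \<in> {0..T}" for t
  proof -
    have i: "integrable lborel (\<lambda>x. (u t x)\<^sup>2 * ?c x)" "integrable lborel (\<lambda>x. (u t x)\<^sup>2 * ?s x)"
      "integrable lborel (\<lambda>x. (h t x)\<^sup>2 * ?c x)" "integrable lborel (\<lambda>x. (h t x)\<^sup>2 * ?s x)"
      by (rule integrable_mult_bounded[OF U.integrable_sq[OF t], where B = 1] integrable_mult_bounded[OF H.integrable_sq[OF t], where B = 1]; simp)+
    have qC: "?C (q t) = (LINT x|lborel. (u t x)\<^sup>2 * ?c x) + (LINT x|lborel. (h t x)\<^sup>2 * ?c x)"
      "?S (q t) = (LINT x|lborel. (u t x)\<^sup>2 * ?s x) + (LINT x|lborel. (h t x)\<^sup>2 * ?s x)"
      using i by (simp_all add: q_def distrib_right)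
    have pull: "(LINT x|lborel. f x * (k * g x)) = k * (LINT x|lborel. f x * g x)" for f g :: "real \<Rightarrow> real" and k
      by (simp add: mult.left_commute)
    show ?thesis
      unfolding ft_cx[OF integrable_q[OF t]] ft_cx[OF U.integrable[OF t]] ft_cx[OF H.integrable[OF t]] qC pairing_def pull
      by (simp add: complex_eq_iff field_simps)
  qed
  have "ft (cx (u b)) \<xi> - ft (cx (u a)) \<xi> = of_real (?C (u b) - ?C (u a)) - \<i> * of_real (?S (u b) - ?S (u a))"
    using u ab by (simp add: ft_cx algebra_simps)
  also have "\<dots> = - ((LINT t:{a<..<b}|lborel. complex_of_real (pairing ?c (\<lambda>x. (- \<xi>) * ?s x) (\<lambda>x. (- (\<xi>\<^sup>2)) * ?c x) t))
      - (LINT t:{a<..<b}|lborel. \<i> * complex_of_real (pairing ?s (\<lambda>x. \<xi> * ?c x) (\<lambda>x. (- (\<xi>\<^sup>2)) * ?s x) t)))"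
    unfolding 1 2 by (simp add: set_integral_complex_of_real algebra_simps)
  also have "\<dots> = - (LINT t:{a<..<b}|lborel. of_real (pairing ?c (\<lambda>x. (- \<xi>) * ?s x) (\<lambda>x. (- (\<xi>\<^sup>2)) * ?c x) t)
      - \<i> * of_real (pairing ?s (\<lambda>x. \<xi> * ?c x) (\<lambda>x. (- (\<xi>\<^sup>2)) * ?s x) t))"
    by (subst set_integral_diff) (auto intro!: set_integrable_continuous continuous_intros pc pc[simplified] simp: ab less_imp_le)
  also have "\<dots> = - (LINT t:{a<..<b}|lborel. \<i> * of_real \<xi> / 2 * ft (cx (q t)) \<xi> + of_real \<beta> * ft (cx (h t)) \<xi> + of_real (\<mu> * \<xi>\<^sup>2) * ft (cx (u t)) \<xi>)"
    by (intro arg_cong[where f = uminus] set_lebesgue_integral_cong allI impI ptw[symmetric]) (use ab in auto)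
  finally show ?thesis .
qed

end

section \<open>The Duhamel formula and its kernel\<close>

text \<open>The integral equation with continuous data makes \<open>f\<close> differentiable, and
  \<open>exp (t *\<^sub>R l)\<close> is an integrating factor.\<close>

lemma linear_ode_solution:
  fixes f G :: "real \<Rightarrow> complex" and l :: complex
  assumes f: "continuous_on {a..b} f" and G: "continuous_on {a..b} G" and ab: "a < b"
    and eq: "\<And>t. a < t \<Longrightarrow> t \<le> b \<Longrightarrow> f t - f a = - (LINT s:{a<..<t}|lborel. G s + l * f s)"
  shows "f b = exp (- (l * of_real (b - a))) * f a - (LINT t:{a<..<b}|lborel. exp (- (l * of_real (b - t))) * G t)"
proof -
  have conv: "(LINT s:{a<..<t}|lborel. k s) = integral {a..t} k" if "continuous_on {a..b} k" "t \<le> b" for k :: "real \<Rightarrow> complex" and t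
  proof -
    have "set_integrable lborel {a..b} k"
      unfolding set_integrable_def using that(1) by (intro borel_integrable_compact) auto
    then have "set_integrable lborel {a<..<t} k"
      by (rule set_integrable_subset) (use that in auto)
    then show ?thesis by (simp add: set_borel_integral_eq_integral integral_open_interval_real)
  qed
  let ?k = "\<lambda>s. G s + l * f s"
  have kc: "continuous_on {a..b} ?k" by (intro continuous_intros f G)
  have f_eq: "f t = f a - integral {a..t} ?k" if "t \<in> {a..b}" for t
    using eq[of t] conv[OF kc, of t] that by (cases "t = a") (auto simp: algebra_simps)
  have fd: "(f has_vector_derivative - ?k t) (at t within {a..b})" if t: "t \<in> {a..b}" for t
  proof -
    have "((\<lambda>t. f a - integral {a..t} ?k) has_vector_derivative 0 - ?k t) (at t within {a..b})"
      by (intro derivative_intros integral_has_vector_derivative kc t)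
    then have "((\<lambda>t. f a - integral {a..t} ?k) has_vector_derivative - ?k t) (at t within {a..b})" by simp
    from has_vector_derivative_transform[OF t f_eq this] show ?thesis .
  qed
  define E where "E t = exp (t *\<^sub>R l) * f t" for t
  have "((\<lambda>t. - (exp (t *\<^sub>R l) * G t)) has_integral (E b - E a)) {a..b}"
  proof (rule fundamental_theorem_of_calculus)
    fix t assume t: "t \<in> {a..b}"
    have "(E has_vector_derivative (exp (t *\<^sub>R l) * (- ?k t) + (exp (t *\<^sub>R l) * l) * f t)) (at t within {a..b})"
      unfolding E_def[abs_def]
      by (rule has_vector_derivative_mult[OF exp_scaleR_has_vector_derivative_right fd[OF t]])
    moreover have "exp (t *\<^sub>R l) * (- ?k t) + (exp (t *\<^sub>R l) * l) * f t = - (exp (t *\<^sub>R l) * G t)"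
      by (simp add: algebra_simps)
    ultimately show "(E has_vector_derivative - (exp (t *\<^sub>R l) * G t)) (at t within {a..b})" by simp
  qed (use ab in simp)
  then have "((\<lambda>t. exp (- (b *\<^sub>R l)) * - (exp (t *\<^sub>R l) * G t)) has_integral exp (- (b *\<^sub>R l)) * (E b - E a)) {a..b}"
    by (rule has_integral_mult_right)
  then have a1: "integral {a..b} (\<lambda>t. exp (- (b *\<^sub>R l)) * - (exp (t *\<^sub>R l) * G t)) = exp (- (b *\<^sub>R l)) * (E b - E a)"
    by (rule integral_unique)
  have a2: "exp (- (b *\<^sub>R l)) * - (exp (t *\<^sub>R l) * G t) = - (exp (- (l * of_real (b - t))) * G t)" for t
  proof -
    have "exp (- (l * of_real (b - t))) = exp (- (b *\<^sub>R l)) * exp (t *\<^sub>R l)"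
      unfolding exp_add[symmetric] mult_exp_exp by (simp add: scaleR_conv_of_real algebra_simps)
    then show ?thesis by simp
  qed
  have a3: "exp (- (b *\<^sub>R l)) * (E b - E a) = f b - exp (- (l * of_real (b - a))) * f a"
  proof -
    have "exp (- (b *\<^sub>R l)) * exp (b *\<^sub>R l) = 1" unfolding mult_exp_exp by simp
    moreover have "exp (- (b *\<^sub>R l)) * exp (a *\<^sub>R l) = exp (- (l * of_real (b - a)))"
      unfolding mult_exp_exp by (simp add: scaleR_conv_of_real algebra_simps)
    ultimately show ?thesis unfolding E_def by (simp add: right_diff_distrib mult.assoc[symmetric])
  qed
  have "- integral {a..b} (\<lambda>t. exp (- (l * of_real (b - t))) * G t) = f b - exp (- (l * of_real (b - a))) * f a"
    using a1 unfolding a2 a3 Henstock_Kurzweil_Integration.integral_neg .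
  moreover have "continuous_on {a..b} (\<lambda>t. exp (- (l * of_real (b - t))) * G t)" by (intro continuous_intros G)
  from conv[OF this order_refl]
  have "(LINT t:{a<..<b}|lborel. exp (- (l * of_real (b - t))) * G t) = integral {a..b} (\<lambda>t. exp (- (l * of_real (b - t))) * G t)" .
  ultimately show ?thesis by (simp add: algebra_simps)
qed

section \<open>The Duhamel kernel and the integrals that bound it\<close>

lemma gaussian_moment_half:
  fixes r :: real
  assumes r: "r > 0"
  shows "has_bochner_integral lborel (\<lambda>x. indicator {0..} x * (x * exp (- (r * x\<^sup>2)))) (1 / (2 * r))"
    and "has_bochner_integral lborel (\<lambda>x. indicator {0..} x * (x ^ 3 * exp (- (r * x\<^sup>2)))) (1 / (2 * r\<^sup>2))"
proof -
  have A: "has_bochner_integral lborel (\<lambda>x. indicator {0..} x * f x) (- F 0)"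
    if f: "f \<in> borel_measurable borel" "\<And>x. x \<ge> 0 \<Longrightarrow> (F has_real_derivative f x) (at x)" "\<And>x. x \<ge> 0 \<Longrightarrow> f x \<ge> 0"
      "(F \<longlongrightarrow> 0) at_top" "F 0 \<le> 0" for f F :: "real \<Rightarrow> real"
  proof (rule has_bochner_integral_nn_integral)
    have "(\<integral>\<^sup>+x. ennreal (f x) * indicator {0 ..} x \<partial>lborel) = ennreal (0 - F 0)"
      by (rule nn_integral_FTC_atLeast) (use f in auto)
    also have "(\<integral>\<^sup>+x. ennreal (f x) * indicator {0 ..} x \<partial>lborel) = (\<integral>\<^sup>+x. ennreal (indicator {0..} x * f x) \<partial>lborel)"
      by (intro nn_integral_cong) (auto simp: indicator_def)
    finally show "(\<integral>\<^sup>+x. ennreal (indicator {0..} x * f x) \<partial>lborel) = ennreal (- F 0)" by simp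
  qed (use f in \<open>auto simp: indicator_def\<close>)
  have 1: "((\<lambda>x. - exp (- (r * x\<^sup>2)) / (2 * r)) \<longlongrightarrow> 0) at_top" using r by real_asymp
  have 2: "((\<lambda>x. - ((x\<^sup>2 / (2 * r) + 1 / (2 * r\<^sup>2)) * exp (- (r * x\<^sup>2)))) \<longlongrightarrow> 0) at_top" using r by real_asymp
  show "has_bochner_integral lborel (\<lambda>x. indicator {0..} x * (x * exp (- (r * x\<^sup>2)))) (1 / (2 * r))"
  proof -
    have "((\<lambda>x. - exp (- (r * x\<^sup>2)) / (2 * r)) has_real_derivative x * exp (- (r * x\<^sup>2))) (at x)" for x
      using r by (auto intro!: derivative_eq_intros)
    from A[OF _ this _ 1] r show ?thesis by simp
  qed
  show "has_bochner_integral lborel (\<lambda>x. indicator {0..} x * (x ^ 3 * exp (- (r * x\<^sup>2)))) (1 / (2 * r\<^sup>2))"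
  proof -
    have "((\<lambda>x. - ((x\<^sup>2 / (2 * r) + 1 / (2 * r\<^sup>2)) * exp (- (r * x\<^sup>2)))) has_real_derivative x ^ 3 * exp (- (r * x\<^sup>2))) (at x)" for x
      using r by (auto intro!: derivative_eq_intros simp: field_simps power2_eq_square power3_eq_cube)
    from A[OF _ this _ 2] r show ?thesis by simp
  qed
qed

text \<open>The inverse transform, without the factor 1 / (2 pi), of \<xi> exp(-r \<xi>^2) on
  positive frequencies. It combines the derivative in the nonlinearity, the projection on positive
  frequencies and the heat flow.\<close>

definition half_kernel :: "real \<Rightarrow> real \<Rightarrow> complex" where
  "half_kernel r z = (LINT \<xi>|lborel. of_real (indicator {0<..} \<xi> * (\<xi> * exp (- (r * \<xi>\<^sup>2)))) * cis (z * \<xi>))"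

lemma integrable_half:
  fixes r :: real
  assumes r: "r > 0"
  shows "integrable lborel (\<lambda>x. indicator {0<..} x * (x * exp (- (r * x\<^sup>2))))"
    and "(LINT x|lborel. indicator {0<..} x * (x * exp (- (r * x\<^sup>2)))) = 1 / (2 * r)"
    and "integrable lborel (\<lambda>x. indicator {0<..} x * (x ^ 3 * exp (- (r * x\<^sup>2))))"
    and "(LINT x|lborel. indicator {0<..} x * (x ^ 3 * exp (- (r * x\<^sup>2)))) = 1 / (2 * r\<^sup>2)"
proof -
  have "indicator {0..} x * (x * exp (- (r * x\<^sup>2))) = indicator {0<..} x * (x * exp (- (r * x\<^sup>2)))"
    "indicator {0..} x * (x ^ 3 * exp (- (r * x\<^sup>2))) = indicator {0<..} x * (x ^ 3 * exp (- (r * x\<^sup>2)))" for x :: real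
    by (auto simp: indicator_def less_le)
  note * = gaussian_moment_half[OF r, unfolded this]
  show "integrable lborel (\<lambda>x. indicator {0<..} x * (x * exp (- (r * x\<^sup>2))))"
    "(LINT x|lborel. indicator {0<..} x * (x * exp (- (r * x\<^sup>2)))) = 1 / (2 * r)"
    "integrable lborel (\<lambda>x. indicator {0<..} x * (x ^ 3 * exp (- (r * x\<^sup>2))))"
    "(LINT x|lborel. indicator {0<..} x * (x ^ 3 * exp (- (r * x\<^sup>2)))) = 1 / (2 * r\<^sup>2)"
    using * by (auto simp: has_bochner_integral_iff)
qed

text \<open>Two bounds are added. The \<open>L1\<close> norm of the symbol gives 1 / (2 r).
  Integrating by parts twice bounds z^2 times the kernel by a boundary term 1, from the corner of
  the symbol at 0, plus the \<open>L1\<close> norm of the second derivative, at most 3 + 2.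
  Altogether 1/2 + 1 + 5 \<le> 7.\<close>

lemma half_kernel_bound:
  assumes r: "r > 0"
  shows "cmod (half_kernel r z) \<le> 7 / (r + z\<^sup>2)"
proof -
  define \<phi> where "\<phi> \<xi> = \<xi> * exp (- (r * \<xi>\<^sup>2))" for \<xi> :: real
  define \<phi>' where "\<phi>' \<xi> = (1 - 2 * r * \<xi>\<^sup>2) * exp (- (r * \<xi>\<^sup>2))" for \<xi> :: real
  define \<phi>'' where "\<phi>'' \<xi> = (- 6 * r * \<xi> + 4 * r\<^sup>2 * \<xi> ^ 3) * exp (- (r * \<xi>\<^sup>2))" for \<xi> :: real
  have d: "(\<phi> has_real_derivative \<phi>' \<xi>) (at \<xi>)" "(\<phi>' has_real_derivative \<phi>'' \<xi>) (at \<xi>)" for \<xi>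
    unfolding \<phi>_def \<phi>'_def \<phi>''_def
    by (auto intro!: derivative_eq_intros simp: algebra_simps power2_eq_square power3_eq_cube)
  note H = integrable_half[OF r]
  let ?i = "indicator {0<..} :: real \<Rightarrow> real"
  have J: "cmod (half_kernel r z) \<le> 1 / (2 * r)"
  proof -
    have "cmod (half_kernel r z) \<le> (LINT \<xi>|lborel. cmod (of_real (?i \<xi> * (\<xi> * exp (- (r * \<xi>\<^sup>2)))) * cis (z * \<xi>)))"
      unfolding half_kernel_def by (rule integral_norm_bound)
    also have "\<dots> = (LINT \<xi>|lborel. ?i \<xi> * (\<xi> * exp (- (r * \<xi>\<^sup>2))))"
      by (intro Bochner_Integration.integral_cong refl) (auto simp: norm_mult indicator_def)
    finally show ?thesis using H by simp
  qed
  have int1: "integrable lborel (\<lambda>\<xi>. ?i \<xi> * \<phi> \<xi>)" using H(1) by (simp add: \<phi>_def)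
  have le2: "\<bar>?i \<xi> * \<phi>'' \<xi>\<bar> \<le> 6 * r * (?i \<xi> * (\<xi> * exp (- (r * \<xi>\<^sup>2)))) + 4 * r\<^sup>2 * (?i \<xi> * (\<xi> ^ 3 * exp (- (r * \<xi>\<^sup>2))))" for \<xi>
  proof (cases "\<xi> > 0")
    case True
    have "\<bar>- 6 * r * \<xi> + 4 * r\<^sup>2 * \<xi> ^ 3\<bar> \<le> 6 * r * \<xi> + 4 * r\<^sup>2 * \<xi> ^ 3"
      using True r mult_pos_pos[OF r True] by (simp add: abs_le_iff)
    then show ?thesis using True by (simp add: \<phi>''_def abs_mult mult_right_mono flip: distrib_right mult.assoc)
  qed simp
  have int2b: "integrable lborel (\<lambda>\<xi>. 6 * r * (?i \<xi> * (\<xi> * exp (- (r * \<xi>\<^sup>2)))) + 4 * r\<^sup>2 * (?i \<xi> * (\<xi> ^ 3 * exp (- (r * \<xi>\<^sup>2)))))"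
    using H by (intro Bochner_Integration.integrable_add integrable_mult_right) auto
  have int2: "integrable lborel (\<lambda>\<xi>. ?i \<xi> * \<phi>'' \<xi>)"
    by (rule Bochner_Integration.integrable_bound[OF int2b])
       (use le2 in \<open>auto simp: \<phi>''_def intro: order_trans[OF _ abs_ge_self]\<close>)
  have bound2: "(LINT \<xi>|lborel. \<bar>?i \<xi> * \<phi>'' \<xi>\<bar>) \<le> 5"
  proof -
    have "(LINT \<xi>|lborel. \<bar>?i \<xi> * \<phi>'' \<xi>\<bar>) \<le> (LINT \<xi>|lborel. 6 * r * (?i \<xi> * (\<xi> * exp (- (r * \<xi>\<^sup>2)))) + 4 * r\<^sup>2 * (?i \<xi> * (\<xi> ^ 3 * exp (- (r * \<xi>\<^sup>2)))))"
      by (intro integral_mono integrable_abs int2 int2b le2)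
    also have "\<dots> = 6 * r * (1 / (2 * r)) + 4 * r\<^sup>2 * (1 / (2 * r\<^sup>2))"
      unfolding H(2,4)[symmetric] using H
      by (subst Bochner_Integration.integral_add) (auto intro!: integrable_mult_right)
    also have "\<dots> = 5" using r by (simp add: power2_eq_square)
    finally show ?thesis .
  qed
  \<comment> \<open>Both integrations by parts at once: \<open>D\<close> is an antiderivative of
    \<open>D'\<close>, with value 1 at 0 and limit 0 at infinity.\<close>
  define D where "D \<xi> = (of_real (\<phi>' \<xi>) - \<i> * of_real (z * \<phi> \<xi>)) * cis (z * \<xi>)" for \<xi>
  define D' where "D' \<xi> = of_real (\<phi>'' \<xi>) * cis (z * \<xi>) + of_real (z\<^sup>2) * (of_real (\<phi> \<xi>) * cis (z * \<xi>))" for \<xi>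
  have i1: "integrable lborel (\<lambda>\<xi>. of_real (?i \<xi> * \<phi>'' \<xi>) * cis (z * \<xi>))" and i2: "integrable lborel (\<lambda>\<xi>. of_real (?i \<xi> * \<phi> \<xi>) * cis (z * \<xi>))"
    by (intro integrable_mult_cis integrable_of_real int1 int2; measurable)+
  have "(LBINT \<xi>=0..\<infinity>. D' \<xi>) = 0 - 1"
  proof (rule interval_integral_FTC_integrable)
    fix \<xi> :: real
    have cisd: "((\<lambda>\<xi>. cis (z * \<xi>)) has_vector_derivative \<i> * of_real z * cis (z * \<xi>)) (at \<xi>)"
    proof -
      have "((\<lambda>\<xi>. exp (\<xi> *\<^sub>R (\<i> * of_real z))) has_vector_derivative exp (\<xi> *\<^sub>R (\<i> * of_real z)) * (\<i> * of_real z)) (at \<xi>)"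
        by (rule exp_scaleR_has_vector_derivative_right)
      then show ?thesis by (simp add: cis_conv_exp scaleR_conv_of_real mult_ac)
    qed
    have "((\<lambda>\<xi>. of_real (\<phi>' \<xi>) - \<i> * of_real (z * \<phi> \<xi>)) has_vector_derivative (of_real (\<phi>'' \<xi>) - \<i> * of_real (z * \<phi>' \<xi>))) (at \<xi>)"
      using d by (intro derivative_intros has_vector_derivative_of_real has_vector_derivative_mult_right DERIV_cmult)
    from has_vector_derivative_mult[OF this cisd]
    have "(D has_vector_derivative ((of_real (\<phi>' \<xi>) - \<i> * of_real (z * \<phi> \<xi>)) * (\<i> * of_real z * cis (z * \<xi>)) +
       (of_real (\<phi>'' \<xi>) - \<i> * of_real (z * \<phi>' \<xi>)) * cis (z * \<xi>))) (at \<xi>)"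
      unfolding D_def[abs_def] .
    moreover have "(of_real (\<phi>' \<xi>) - \<i> * of_real (z * \<phi> \<xi>)) * (\<i> * of_real z * cis (z * \<xi>)) +
       (of_real (\<phi>'' \<xi>) - \<i> * of_real (z * \<phi>' \<xi>)) * cis (z * \<xi>) = D' \<xi>"
      unfolding D'_def by (simp add: algebra_simps power2_eq_square)
    ultimately show "(D has_vector_derivative D' \<xi>) (at \<xi>)" by simp
    have "continuous_on UNIV D'"
      unfolding D'_def[abs_def] \<phi>_def \<phi>''_def by (intro continuous_intros)
    then show "isCont D' \<xi>" by (simp add: continuous_on_eq_continuous_at)
  next
    have e: "einterval 0 \<infinity> = {0<..}" by (auto simp: einterval_def zero_ereal_def)
    have "integrable lborel (\<lambda>\<xi>. of_real (?i \<xi> * \<phi>'' \<xi>) * cis (z * \<xi>) + of_real (z\<^sup>2) * (of_real (?i \<xi> * \<phi> \<xi>) * cis (z * \<xi>)))"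
      using i1 i2 by (intro Bochner_Integration.integrable_add integrable_mult_right) auto
    then show "set_integrable lborel (einterval 0 \<infinity>) D'"
      unfolding set_integrable_def e D'_def by (simp add: scaleR_conv_of_real algebra_simps)
    have "continuous_on UNIV D" unfolding D_def[abs_def] \<phi>_def \<phi>'_def by (intro continuous_intros)
    then have "(D \<longlongrightarrow> D 0) (at 0)" by (simp add: continuous_on_eq_continuous_at isCont_def)
    then have "(D \<longlongrightarrow> 1) (at_right 0)" by (simp add: D_def \<phi>_def \<phi>'_def filterlim_at_split)
    then show "((D \<circ> real_of_ereal) \<longlongrightarrow> 1) (at_right 0)"
      by (simp add: zero_ereal_def ereal_tendsto_simps)
    have "((\<lambda>\<xi>. \<bar>\<phi>' \<xi>\<bar> + \<bar>z\<bar> * \<bar>\<phi> \<xi>\<bar>) \<longlongrightarrow> \<bar>0\<bar> + \<bar>z\<bar> * \<bar>0\<bar>) at_top"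
    proof (intro tendsto_intros)
      show "(\<phi>' \<longlongrightarrow> 0) at_top" unfolding \<phi>'_def using r by real_asymp
      show "(\<phi> \<longlongrightarrow> 0) at_top" unfolding \<phi>_def using r by real_asymp
    qed
    then have "(D \<longlongrightarrow> 0) at_top"
    proof (intro Lim_null_comparison[of D])
      show "\<forall>\<^sub>F \<xi> in at_top. norm (D \<xi>) \<le> \<bar>\<phi>' \<xi>\<bar> + \<bar>z\<bar> * \<bar>\<phi> \<xi>\<bar>"
      proof (intro always_eventually allI)
        fix \<xi>
        have "norm (D \<xi>) = norm (complex_of_real (\<phi>' \<xi>) - \<i> * of_real (z * \<phi> \<xi>))" by (simp add: D_def norm_mult)
        also have "\<dots> \<le> \<bar>\<phi>' \<xi>\<bar> + \<bar>z\<bar> * \<bar>\<phi> \<xi>\<bar>"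
          by (rule order_trans[OF norm_triangle_ineq4]) (simp add: norm_mult abs_mult)
        finally show "norm (D \<xi>) \<le> \<bar>\<phi>' \<xi>\<bar> + \<bar>z\<bar> * \<bar>\<phi> \<xi>\<bar>" .
      qed
    qed simp
    then show "((D \<circ> real_of_ereal) \<longlongrightarrow> 0) (at_left \<infinity>)" by (simp add: ereal_tendsto_simps)
  qed simp
  also have "(LBINT \<xi>=0..\<infinity>. D' \<xi>) = (LINT \<xi>|lborel. of_real (?i \<xi> * \<phi>'' \<xi>) * cis (z * \<xi>) + of_real (z\<^sup>2) * (of_real (?i \<xi> * \<phi> \<xi>) * cis (z * \<xi>)))"
    unfolding zero_ereal_def interval_integral_to_infinity_eq set_lebesgue_integral_def
    by (intro Bochner_Integration.integral_cong refl) (simp add: D'_def scaleR_conv_of_real algebra_simps)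
  also have "\<dots> = (LINT \<xi>|lborel. of_real (?i \<xi> * \<phi>'' \<xi>) * cis (z * \<xi>)) + of_real (z\<^sup>2) * half_kernel r z"
    unfolding half_kernel_def \<phi>_def[symmetric] integral_mult_right_zero[symmetric]
    by (intro Bochner_Integration.integral_add i1 integrable_mult_right i2)
  finally have "of_real (z\<^sup>2) * half_kernel r z = - 1 - (LINT \<xi>|lborel. of_real (?i \<xi> * \<phi>'' \<xi>) * cis (z * \<xi>))"
    by (simp add: algebra_simps)
  then have "cmod (of_real (z\<^sup>2) * half_kernel r z) \<le> 1 + cmod (LINT \<xi>|lborel. of_real (?i \<xi> * \<phi>'' \<xi>) * cis (z * \<xi>))"
    using norm_triangle_ineq4[of "- 1" "LINT \<xi>|lborel. of_real (?i \<xi> * \<phi>'' \<xi>) * cis (z * \<xi>)"] by simp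
  also have "cmod (LINT \<xi>|lborel. of_real (?i \<xi> * \<phi>'' \<xi>) * cis (z * \<xi>)) \<le> (LINT \<xi>|lborel. cmod (of_real (?i \<xi> * \<phi>'' \<xi>) * cis (z * \<xi>)))"
    by (rule integral_norm_bound)
  also have "\<dots> = (LINT \<xi>|lborel. \<bar>?i \<xi> * \<phi>'' \<xi>\<bar>)" by (simp only: norm_mult norm_cis norm_of_real mult_1_right)
  also have "\<dots> \<le> 5" by (rule bound2)
  finally have Z: "z\<^sup>2 * cmod (half_kernel r z) \<le> 6" by (simp add: norm_mult norm_power)
  have R: "r * cmod (half_kernel r z) \<le> 1 / 2"
    using mult_left_mono[OF J, of r] r by simp
  have "(r + z\<^sup>2) * cmod (half_kernel r z) \<le> 7" using Z R by (simp add: distrib_right)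
  moreover have "r + z\<^sup>2 > 0" using r by (simp add: add_pos_nonneg)
  ultimately show ?thesis by (simp add: le_divide_eq mult.commute)
qed

lemma cauchy_kernel:
  fixes r x :: real
  assumes r: "r > 0"
  shows "integrable lborel (\<lambda>y. 1 / (r + (x - y)\<^sup>2))" and "(LINT y|lborel. 1 / (r + (x - y)\<^sup>2)) = pi / sqrt r"
proof -
  have 0: "has_bochner_integral lborel (\<lambda>y::real. inverse (1 + y\<^sup>2)) pi"
    using integrable_inverse_1_plus_square LBINT_inverse_1_plus_square
    by (simp add: has_bochner_integral_iff set_integrable_def interval_lebesgue_integral_def set_lebesgue_integral_def einterval_def)
  have "has_bochner_integral lborel (\<lambda>y. 1 / (r + (x - y)\<^sup>2)) (pi / sqrt r)"
  proof (subst lborel_has_bochner_integral_real_affine_iff[where c = "sqrt r" and t = x])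
    have "(\<lambda>y. 1 / (r + (x - (x + sqrt r * y))\<^sup>2)) = (\<lambda>y. inverse (1 + y\<^sup>2) / r)"
    proof
      fix y
      have "r + (x - (x + sqrt r * y))\<^sup>2 = r * (1 + y\<^sup>2)"
        using r by (simp add: power_mult_distrib algebra_simps)
      then show "1 / (r + (x - (x + sqrt r * y))\<^sup>2) = inverse (1 + y\<^sup>2) / r"
        by (simp add: inverse_eq_divide)
    qed
    moreover have "(pi / sqrt r) /\<^sub>R \<bar>sqrt r\<bar> = pi / r"
      using r by (simp add: divide_inverse mult.assoc flip: inverse_mult_distrib)
    ultimately show "has_bochner_integral lborel (\<lambda>y. 1 / (r + (x - (x + sqrt r * y))\<^sup>2)) ((pi / sqrt r) /\<^sub>R \<bar>sqrt r\<bar>)"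
      using has_bochner_integral_divide_zero[of r lborel, OF 0] by simp
  qed (use r in simp)
  then show "integrable lborel (\<lambda>y. 1 / (r + (x - y)\<^sup>2))" "(LINT y|lborel. 1 / (r + (x - y)\<^sup>2)) = pi / sqrt r"
    by (auto simp: has_bochner_integral_iff)
qed

text \<open>The time singularity of the Duhamel integral, reflected to the origin. The exponents 1/2
  and 3/4 occur in the weighted estimate.\<close>

lemma powr_singularity:
  fixes p a b :: real
  assumes p: "p < 1" and ab: "a < b"
  shows "integrable lborel (\<lambda>t. indicator {a<..<b} t * (b - t) powr (- p))"
    and "(LINT t|lborel. indicator {a<..<b} t * (b - t) powr (- p)) = (b - a) powr (1 - p) / (1 - p)"
proof -
  let ?g = "\<lambda>x. indicator {0<..<b - a} x * x powr (- p)"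
  have "((\<lambda>x. x powr (- p)) has_integral ((b - a) powr (1 - p) / (1 - p))) {0..b - a}"
    using has_integral_powr_from_0[of "- p" "b - a"] p ab by simp
  then have "((\<lambda>x. x powr (- p)) has_integral ((b - a) powr (1 - p) / (1 - p))) {0<..<b - a}"
    by (simp only: has_integral_Icc_iff_Ioo)
  then have hi: "(?g has_integral ((b - a) powr (1 - p) / (1 - p))) UNIV"
  proof -
    assume "((\<lambda>x. x powr (- p)) has_integral ((b - a) powr (1 - p) / (1 - p))) {0<..<b - a}"
    moreover have "?g = (\<lambda>x. if x \<in> {0<..<b - a} then x powr (- p) else 0)" by (auto simp: indicator_def)
    ultimately show ?thesis by (simp only: has_integral_restrict_UNIV)
  qed
  have "integral\<^sup>N lborel ?g = ennreal ((b - a) powr (1 - p) / (1 - p))"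
    by (rule nn_integral_has_integral_lborel[OF _ _ hi]) auto
  then have g: "integrable lborel ?g" by (intro integrableI_nonneg) auto
  have gv: "(LINT x|lborel. ?g x) = (b - a) powr (1 - p) / (1 - p)"
    using has_integral_integral_lborel[OF g] hi by (rule has_integral_unique)
  have eq: "?g (b + -1 * t) = indicator {a<..<b} t * (b - t) powr (- p)" for t
    by (auto simp: indicator_def)
  show "integrable lborel (\<lambda>t. indicator {a<..<b} t * (b - t) powr (- p))"
    using lborel_integrable_real_affine[OF g, of "-1" b] unfolding eq by simp
  show "(LINT t|lborel. indicator {a<..<b} t * (b - t) powr (- p)) = (b - a) powr (1 - p) / (1 - p)"
    using lborel_integral_real_affine[of "-1" ?g b] gv unfolding eq by simp
qed

text \<open>Half of the Gaussian exponent is spent on absorbing the factor |z|; the other half is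
  the Gaussian of doubled time. The factor \<open>sqrt r\<close> is the length scale of the
  kernel.\<close>

lemma abs_gauss_le:
  assumes r: "r > 0"
  shows "\<bar>z\<bar> * gauss r z \<le> 4 * sqrt r * gauss (2 * r) z"
proof -
  define y where "y = \<bar>z\<bar> / sqrt r"
  have z: "\<bar>z\<bar> = y * sqrt r" using r by (simp add: y_def)
  then have z2: "z\<^sup>2 = y\<^sup>2 * r" using r by (metis power2_abs power_mult_distrib real_sqrt_pow2 less_imp_le)
  have y0: "y \<ge> 0" unfolding y_def using r by (intro divide_nonneg_nonneg) auto
  \<comment> \<open>A weakened form of (y - 2)^2 \<ge> 0; combined with 1 + x \<le> exp x it bounds
    y exp(-y^2 / 8) by 2.\<close>
  have "y \<le> 2 * (1 + y\<^sup>2 / 8)" using zero_le_power2[of "y - 2"] by (simp add: power2_diff)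
  also have "\<dots> \<le> 2 * exp (y\<^sup>2 / 8)" by (intro mult_left_mono exp_ge_add_one_self) simp
  finally have "y * exp (- (y\<^sup>2 / 8)) \<le> 2 * exp (y\<^sup>2 / 8) * exp (- (y\<^sup>2 / 8))" by (rule mult_right_mono) simp
  moreover have "2 * exp (y\<^sup>2 / 8) * exp (- (y\<^sup>2 / 8)) = 2" by (simp add: mult.assoc mult_exp_exp)
  ultimately have le: "y * exp (- (y\<^sup>2 / 8)) \<le> 2" by (simp only:)
  have e: "exp (- z\<^sup>2 / (4 * r)) = exp (- (y\<^sup>2 / 8)) * exp (- (y\<^sup>2 / 8))" "exp (- z\<^sup>2 / (4 * (2 * r))) = exp (- (y\<^sup>2 / 8))"
    unfolding z2 mult_exp_exp using r by simp_all
  have s: "sqrt (4 * pi * (2 * r)) = sqrt 2 * sqrt (4 * pi * r)" by (simp flip: real_sqrt_mult)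
  have s2: "sqrt 2 \<le> 2" by (rule real_le_lsqrt) auto
  define Q where "Q = sqrt r * exp (- (y\<^sup>2 / 8)) / sqrt (4 * pi * r)"
  have Q: "Q \<ge> 0" unfolding Q_def using r by simp
  have "\<bar>z\<bar> * gauss r z = (y * exp (- (y\<^sup>2 / 8))) * Q"
    unfolding gauss_def e z Q_def by simp
  also have "\<dots> \<le> 2 * Q" by (intro mult_right_mono le Q)
  also have "\<dots> \<le> (4 / sqrt 2) * Q" using s2 Q by (intro mult_right_mono) (simp_all add: le_divide_eq)
  also have "\<dots> = 4 * sqrt r * gauss (2 * r) z" unfolding gauss_def e s Q_def by simp
  finally show ?thesis .
qed

section \<open>The Duhamel formula for the analytic signal\<close>

context hilbert_flow
begin

lemma w_eq: "w t x = of_real (u t x) + \<i> * of_real (h t x)"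
  by (simp add: w_def Complex_eq)

lemma w_integrable: "t \<in> {0..T} \<Longrightarrow> integrable lborel (w t)"
  unfolding w_eq[abs_def]
  by (intro Bochner_Integration.integrable_add integrable_mult_right integrable_of_real U.integrable H.integrable)

lemma w_continuous: "t \<in> {0..T} \<Longrightarrow> isCont (w t) x"
  using U.cont[of t] H.cont[of t] unfolding w_eq[abs_def]
  by (intro continuous_intros) (auto simp: continuous_on_eq_continuous_at)

lemma q_eq: "q t x = (cmod (w t x))\<^sup>2"
  by (simp add: q_def w_def cmod_power2)

lemma w_bounded:
  obtains S where "S > 0" "\<And>t x. t \<in> {0..T} \<Longrightarrow> cmod (w t x) \<le> S" "\<And>t. t \<in> {0..T} \<Longrightarrow> (LINT x|lborel. cmod (w t x)) \<le> S"
proof -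
  obtain S1 where S1: "S1 > 0" "\<And>t x. t \<in> {0..T} \<Longrightarrow> \<bar>u t x\<bar> \<le> S1" "\<And>t. t \<in> {0..T} \<Longrightarrow> (LINT x|lborel. \<bar>u t x\<bar>) \<le> S1"
    using U.bounded by metis
  obtain S2 where S2: "S2 > 0" "\<And>t x. t \<in> {0..T} \<Longrightarrow> \<bar>h t x\<bar> \<le> S2" "\<And>t. t \<in> {0..T} \<Longrightarrow> (LINT x|lborel. \<bar>h t x\<bar>) \<le> S2"
    using H.bounded by metis
  have le: "cmod (w t x) \<le> \<bar>u t x\<bar> + \<bar>h t x\<bar>" for t x
    using cmod_le[of "w t x"] by (simp add: w_def)
  show ?thesis
  proof (rule that[of "S1 + S2"])
    show "cmod (w t x) \<le> S1 + S2" if "t \<in> {0..T}" for t x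
      using le[of t x] S1(2)[OF that, of x] S2(2)[OF that, of x] by linarith
    fix t assume t: "t \<in> {0..T}"
    have "(LINT x|lborel. cmod (w t x)) \<le> (LINT x|lborel. \<bar>u t x\<bar> + \<bar>h t x\<bar>)"
      by (intro integral_mono integrable_norm w_integrable t Bochner_Integration.integrable_add integrable_abs U.integrable H.integrable le)
    also have "\<dots> = (LINT x|lborel. \<bar>u t x\<bar>) + (LINT x|lborel. \<bar>h t x\<bar>)"
      by (intro Bochner_Integration.integral_add integrable_abs U.integrable H.integrable t)
    also have "\<dots> \<le> S1 + S2" using S1(3)[OF t] S2(3)[OF t] by simp
    finally show "(LINT x|lborel. cmod (w t x)) \<le> S1 + S2" .
  qed (use S1 S2 in simp)
qed

lemma ft_w:
  assumes t: "t \<in> {0..T}" and \<xi>: "\<xi> \<noteq> 0"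
  shows "ft (w t) \<xi> = of_real (1 + sgn \<xi>) * ft (cx (u t)) \<xi>"
proof -
  have "ft (w t) \<xi> = (LINT x|lborel. cx (u t) x * cis (- (x * \<xi>)) + \<i> * (cx (h t) x * cis (- (x * \<xi>))))"
    unfolding ft_def w_eq by (intro Bochner_Integration.integral_cong refl) (simp add: algebra_simps)
  also have "\<dots> = ft (cx (u t)) \<xi> + (LINT x|lborel. \<i> * (cx (h t) x * cis (- (x * \<xi>))))"
    unfolding ft_def
    by (intro Bochner_Integration.integral_add integrable_mult_right integrable_mult_cis integrable_of_real U.integrable H.integrable t) auto
  also have "(LINT x|lborel. \<i> * (cx (h t) x * cis (- (x * \<xi>)))) = \<i> * ft (cx (h t)) \<xi>"
    unfolding ft_def by (rule integral_mult_right_zero)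
  also have "\<dots> = of_real (sgn \<xi>) * ft (cx (u t)) \<xi>"
    unfolding ft_h[OF t \<xi>] by (simp add: mult.assoc[symmetric])
  finally show ?thesis by (simp add: algebra_simps)
qed

text \<open>On negative frequencies both sides vanish. On positive ones the transform of
  \<open>h\<close> is -i times that of \<open>u\<close>, so the two linear terms merge into
  multiplication by \<open>l\<close>, and each frequency carries a scalar linear equation.\<close>

lemma ft_w_duhamel:
  assumes ab: "0 < a" "a < b" "b < T" and \<xi>: "\<xi> \<noteq> 0"
  defines "l \<equiv> complex_of_real (\<mu> * \<xi>\<^sup>2) - \<i> * of_real \<beta>"
  shows "ft (w b) \<xi> = exp (- (l * of_real (b - a))) * ft (w a) \<xi>
    - of_real (indicator {0<..} \<xi>) * (LINT t:{a<..<b}|lborel. exp (- (l * of_real (b - t))) * (\<i> * of_real \<xi> * ft (cx (q t)) \<xi>))"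
proof (cases "\<xi> > 0")
  case False
  then have "sgn \<xi> = -1" using \<xi> by simp
  then show ?thesis using False ab \<xi> by (simp add: ft_w)
next
  case True
  let ?f = "\<lambda>t. 2 * ft (cx (u t)) \<xi>" and ?G = "\<lambda>t. \<i> * of_real \<xi> * ft (cx (q t)) \<xi>"
  have sub: "{a..b} \<subseteq> {0..T}" using ab by auto
  have "?f b = exp (- (l * of_real (b - a))) * ?f a - (LINT t:{a<..<b}|lborel. exp (- (l * of_real (b - t))) * ?G t)"
  proof (rule linear_ode_solution)
    show "continuous_on {a..b} ?f" "continuous_on {a..b} ?G"
      by (intro continuous_intros continuous_on_subset[OF ft_continuous_in_time(1) sub] continuous_on_subset[OF ft_continuous_in_time(3) sub])+
    fix t assume t: "a < t" "t \<le> b"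
    have "?f t - ?f a = 2 * (ft (cx (u t)) \<xi> - ft (cx (u a)) \<xi>)" by (simp add: algebra_simps)
    also have "\<dots> = - (LINT s:{a<..<t}|lborel. 2 * (\<i> * of_real \<xi> / 2 * ft (cx (q s)) \<xi> + of_real \<beta> * ft (cx (h s)) \<xi> + of_real (\<mu> * \<xi>\<^sup>2) * ft (cx (u s)) \<xi>))"
    proof -
      have "ft (cx (u t)) \<xi> - ft (cx (u a)) \<xi> = - (LINT s:{a<..<t}|lborel. \<i> * of_real \<xi> / 2 * ft (cx (q s)) \<xi> + of_real \<beta> * ft (cx (h s)) \<xi> + of_real (\<mu> * \<xi>\<^sup>2) * ft (cx (u s)) \<xi>)"
        by (rule ft_integrated) (use t ab in auto)
      then show ?thesis by (simp only: mult_minus_right set_integral_mult_right)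
    qed
    also have "\<dots> = - (LINT s:{a<..<t}|lborel. ?G s + l * ?f s)"
    proof (intro arg_cong[where f = uminus] set_lebesgue_integral_cong allI impI)
      fix s assume "s \<in> {a<..<t}"
      then have s: "s \<in> {0..T}" using t ab by auto
      show "2 * (\<i> * of_real \<xi> / 2 * ft (cx (q s)) \<xi> + of_real \<beta> * ft (cx (h s)) \<xi> + of_real (\<mu> * \<xi>\<^sup>2) * ft (cx (u s)) \<xi>) = ?G s + l * ?f s"
        using True \<xi> unfolding ft_h[OF s \<xi>] l_def by (simp add: algebra_simps)
    qed simp
    finally show "?f t - ?f a = - (LINT s:{a<..<t}|lborel. ?G s + l * ?f s)" .
  qed (use ab in simp)
  then show ?thesis using True ab \<xi> by (simp add: ft_w)
qed

lemma ft_q_measurable: "(\<lambda>p. ft (cx (q (U.clamp (fst p)))) (snd p)) \<in> borel_measurable (lborel \<Otimes>\<^sub>M lborel)"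
proof -
  have c: "(\<lambda>z. (fst (fst z), snd z)) \<in> ((lborel \<Otimes>\<^sub>M lborel) \<Otimes>\<^sub>M lborel) \<rightarrow>\<^sub>M (lborel \<Otimes>\<^sub>M lborel :: (real \<times> real) measure)"
    by measurable
  have [measurable]: "(\<lambda>z. u (U.clamp (fst (fst z))) (snd z)) \<in> borel_measurable ((lborel \<Otimes>\<^sub>M lborel) \<Otimes>\<^sub>M lborel)"
    "(\<lambda>z. h (U.clamp (fst (fst z))) (snd z)) \<in> borel_measurable ((lborel \<Otimes>\<^sub>M lborel) \<Otimes>\<^sub>M lborel)"
    using measurable_compose[OF c U.clamped_measurable] measurable_compose[OF c H.clamped_measurable] by simp_all
  have "(\<lambda>z. complex_of_real (q (U.clamp (fst (fst z))) (snd z)) * cis (- (snd z * snd (fst z)))) \<in> borel_measurable ((lborel \<Otimes>\<^sub>M lborel) \<Otimes>\<^sub>M lborel)"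
    unfolding q_def by measurable
  then show ?thesis
    unfolding ft_def by (intro lborel.borel_measurable_lebesgue_integral) (simp add: case_prod_unfold)
qed

text \<open>
  The Gaussian regularisation makes the integrand absolutely integrable in time and frequency
  jointly; for $\epsilon = 0$ this fails as $t \to b$, and Fubini's theorem would not apply.
\<close>
lemma regularised_duhamel:
  assumes ab: "0 < a" "a < b" "b < T" and \<epsilon>: "\<epsilon> > 0"
  shows "2 * pi * (LINT y|lborel. w b y * gauss \<epsilon> (x - y)) =
      cis (\<beta> * (b - a)) * (2 * pi * (LINT y|lborel. w a y * gauss (\<epsilon> + \<mu> * (b - a)) (x - y)))
      - (LINT t|lborel. of_real (indicator {a<..<b} t) * (\<i> * cis (\<beta> * (b - t)) *
           (LINT y|lborel. of_real (q t y) * half_kernel (\<epsilon> + \<mu> * (b - t)) (x - y))))"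
proof -
  have aT: "a \<in> {0..T}" and bT: "b \<in> {0..T}" using ab by auto
  let ?e = "\<lambda>\<xi>. complex_of_real (exp (- (\<epsilon> * \<xi>\<^sup>2))) * cis (x * \<xi>)"
  let ?g = "\<lambda>\<xi>. complex_of_real (indicator {0<..} \<xi> * (\<xi> * exp (- (\<epsilon> * \<xi>\<^sup>2))))"
  let ?i = "\<lambda>t. complex_of_real (indicator {a<..<b} t)"
  \<comment> \<open>The absolute value of \<open>b - fst p\<close> keeps the exponential at most 1
    for times beyond \<open>b\<close>, and \<open>clamp\<close> keeps the transform bounded, so that
    \<open>?K\<close> is bounded on the whole plane.\<close>
  let ?K = "\<lambda>p. \<i> * complex_of_real (exp (- (\<mu> * \<bar>b - fst p\<bar> * (snd p)\<^sup>2))) * cis (\<beta> * (b - fst p)) * cis (x * snd p) * ft (cx (q (U.clamp (fst p)))) (snd p)"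
  obtain S where S: "S > 0" "\<And>t x. t \<in> {0..T} \<Longrightarrow> cmod (w t x) \<le> S" "\<And>t. t \<in> {0..T} \<Longrightarrow> (LINT x|lborel. cmod (w t x)) \<le> S"
    using w_bounded by metis
  have qS: "(LINT x|lborel. q t x) \<le> S * S" if t: "t \<in> {0..T}" for t
  proof -
    have "(LINT x|lborel. q t x) \<le> (LINT x|lborel. S * cmod (w t x))"
      by (intro integral_mono integrable_q t integrable_mult_right integrable_norm w_integrable)
         (auto simp: q_eq power2_eq_square intro!: mult_right_mono S t)
    also have "\<dots> \<le> S * S" using S(1) S(3)[OF t] by simp
    finally show ?thesis .
  qed
  have Kb: "cmod (?K p) \<le> S * S" for p
  proof -
    have "cmod (ft (cx (q (U.clamp (fst p)))) (snd p)) \<le> (LINT x|lborel. cmod (cx (q (U.clamp (fst p))) x))" by (rule norm_ft_le)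
    also have "\<dots> = (LINT x|lborel. q (U.clamp (fst p)) x)" by (simp add: q_eq norm_power)
    also have "\<dots> \<le> S * S" by (intro qS U.clamp)
    finally have 1: "cmod (ft (cx (q (U.clamp (fst p)))) (snd p)) \<le> S * S" .
    have "exp (- (\<mu> * \<bar>b - fst p\<bar> * (snd p)\<^sup>2)) \<le> 1" using \<mu> by simp
    from mult_mono[OF this 1] show ?thesis by (simp add: norm_mult)
  qed
  have gi: "integrable lborel ?g" by (intro integrable_of_real integrable_half \<epsilon>)
  have ii: "integrable lborel ?i" by (intro integrable_of_real integrable_real_indicator) (use ab in auto)
  have Km: "?K \<in> borel_measurable (lborel \<Otimes>\<^sub>M lborel)"
    by (intro borel_measurable_times ft_q_measurable; measurable)
  have int: "integrable (lborel \<Otimes>\<^sub>M lborel) (\<lambda>(t, \<xi>). ?i t * ?g \<xi> * ?K (t, \<xi>))"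
    by (rule integrable_pair_mult[OF sigma_finite_lborel sigma_finite_lborel ii gi Km Kb])
  define R where "R \<xi> = (LINT t|lborel. ?i t * ?g \<xi> * ?K (t, \<xi>))" for \<xi>
  have Ri: "integrable lborel R"
    unfolding R_def using lborel_pair.integrable_snd[OF int] by simp
  have fub: "(LINT \<xi>|lborel. R \<xi>) = (LINT t|lborel. LINT \<xi>|lborel. ?i t * ?g \<xi> * ?K (t, \<xi>))"
    unfolding R_def using lborel_pair.Fubini_integral[OF int] by simp
  have inner: "(LINT \<xi>|lborel. ?i t * ?g \<xi> * ?K (t, \<xi>)) = ?i t * (\<i> * cis (\<beta> * (b - t)) *
           (LINT y|lborel. of_real (q t y) * half_kernel (\<epsilon> + \<mu> * (b - t)) (x - y)))" for t
  proof (cases "t \<in> {a<..<b}")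
    case True
    then have t: "t \<in> {0..T}" and cl: "U.clamp t = t" using ab by (auto simp: U.clamp)
    let ?r = "\<epsilon> + \<mu> * (b - t)"
    have r: "?r > 0" using True \<mu> \<epsilon> by (simp add: add_pos_nonneg)
    let ?k = "\<lambda>\<xi>. complex_of_real (indicator {0<..} \<xi> * (\<xi> * exp (- (?r * \<xi>\<^sup>2)))) * cis (x * \<xi>)"
    have k: "integrable lborel ?k" by (intro integrable_mult_cis integrable_of_real integrable_half r) auto
    have "(LINT \<xi>|lborel. ?i t * ?g \<xi> * ?K (t, \<xi>)) = (LINT \<xi>|lborel. (\<i> * cis (\<beta> * (b - t))) * (ft (cx (q t)) \<xi> * ?k \<xi>))"
    proof (intro Bochner_Integration.integral_cong refl)
      fix \<xi>
      have "exp (- (\<epsilon> * \<xi>\<^sup>2)) * exp (- (\<mu> * \<bar>b - t\<bar> * \<xi>\<^sup>2)) = exp (- (?r * \<xi>\<^sup>2))"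
        using True by (simp add: mult_exp_exp algebra_simps)
      then have "complex_of_real (exp (- (?r * \<xi>\<^sup>2))) = of_real (exp (- (\<epsilon> * \<xi>\<^sup>2))) * of_real (exp (- (\<mu> * \<bar>b - t\<bar> * \<xi>\<^sup>2)))"
        by (metis of_real_mult)
      then show "?i t * ?g \<xi> * ?K (t, \<xi>) = (\<i> * cis (\<beta> * (b - t))) * (ft (cx (q t)) \<xi> * ?k \<xi>)"
        using True by (simp only: of_real_mult fst_conv snd_conv cl) (simp add: mult_ac)
    qed
    also have "\<dots> = (\<i> * cis (\<beta> * (b - t))) * (LINT \<xi>|lborel. ft (cx (q t)) \<xi> * ?k \<xi>)"
      by (rule integral_mult_right_zero)
    also have "(LINT \<xi>|lborel. ft (cx (q t)) \<xi> * ?k \<xi>) = (LINT y|lborel. cx (q t) y * ft ?k y)"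
      by (rule ft_mult_formula[OF integrable_of_real[OF integrable_q[OF t]] k])
    also have "\<dots> = (LINT y|lborel. of_real (q t y) * half_kernel ?r (x - y))"
    proof -
      have "ft ?k y = half_kernel ?r (x - y)" for y
        unfolding ft_def half_kernel_def
        by (intro Bochner_Integration.integral_cong refl) (simp add: mult.assoc cis_mult algebra_simps)
      then show ?thesis by (simp only:)
    qed
    finally show ?thesis using True by simp
  qed simp
  have ei: "integrable lborel (\<lambda>\<xi>. ft (w t) \<xi> * (complex_of_real (exp (- (r * \<xi>\<^sup>2))) * cis (x * \<xi>)))" if "t \<in> {0..T}" "r > 0" for t r
  proof -
    have "integrable lborel (\<lambda>\<xi>. (complex_of_real (exp (- (r * \<xi>\<^sup>2))) * cis (x * \<xi>)) * ft (w t) \<xi>)"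
      by (rule integrable_mult_bounded[OF integrable_gauss_cis[OF that(2)] _ norm_ft_le])
         (use borel_measurable_ft[OF w_integrable[OF that(1)]] in simp)
    then show ?thesis by (simp add: mult.commute)
  qed
  let ?r = "\<epsilon> + \<mu> * (b - a)"
  have r: "?r > 0" using ab \<mu> \<epsilon> by (simp add: add_pos_pos)
  have "(LINT \<xi>|lborel. ft (w b) \<xi> * ?e \<xi>) =
      (LINT \<xi>|lborel. cis (\<beta> * (b - a)) * (ft (w a) \<xi> * (complex_of_real (exp (- (?r * \<xi>\<^sup>2))) * cis (x * \<xi>))) - R \<xi>)"
  proof (rule integral_cong_AE)
    \<comment> \<open>Frequency 0, which \<open>ft_w_duhamel\<close> excludes, is a null
      set.\<close>
    show "AE \<xi> in lborel. ft (w b) \<xi> * ?e \<xi> = cis (\<beta> * (b - a)) * (ft (w a) \<xi> * (complex_of_real (exp (- (?r * \<xi>\<^sup>2))) * cis (x * \<xi>))) - R \<xi>"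
      using AE_lborel_singleton[of "0 :: real"]
    proof (rule eventually_mono)
      fix \<xi> :: real assume \<xi>: "\<xi> \<noteq> 0"
      define l where "l = complex_of_real (\<mu> * \<xi>\<^sup>2) - \<i> * of_real \<beta>"
      have el: "exp (- (l * of_real c)) = complex_of_real (exp (- (\<mu> * c * \<xi>\<^sup>2))) * cis (\<beta> * c)" for c
        unfolding cis_conv_exp exp_of_real[symmetric] mult_exp_exp l_def by (simp add: algebra_simps)
      have "of_real (indicator {0<..} \<xi>) * (LINT t:{a<..<b}|lborel. exp (- (l * of_real (b - t))) * (\<i> * of_real \<xi> * ft (cx (q t)) \<xi>)) * ?e \<xi>
          = (LINT t|lborel. (of_real (indicator {0<..} \<xi>) * (of_real (indicator {a<..<b} t) * (exp (- (l * of_real (b - t))) * (\<i> * of_real \<xi> * ft (cx (q t)) \<xi>)))) * ?e \<xi>)"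
        unfolding set_lebesgue_integral_def scaleR_conv_of_real by (simp only: integral_mult_left_zero integral_mult_right_zero)
      also have "\<dots> = R \<xi>"
        unfolding R_def
      proof (intro Bochner_Integration.integral_cong refl)
        fix t
        show "(of_real (indicator {0<..} \<xi>) * (of_real (indicator {a<..<b} t) * (exp (- (l * of_real (b - t))) * (\<i> * of_real \<xi> * ft (cx (q t)) \<xi>)))) * ?e \<xi> = ?i t * ?g \<xi> * ?K (t, \<xi>)"
        proof (cases "t \<in> {a<..<b}")
          case True
          then have cl: "U.clamp t = t" and ab': "\<bar>b - t\<bar> = b - t" using ab by (auto simp: U.clamp)
          show ?thesis unfolding el fst_conv snd_conv cl ab' by (simp only: of_real_mult mult_ac)
        qed simp
      qed
      finally have 1: "of_real (indicator {0<..} \<xi>) * (LINT t:{a<..<b}|lborel. exp (- (l * of_real (b - t))) * (\<i> * of_real \<xi> * ft (cx (q t)) \<xi>)) * ?e \<xi> = R \<xi>" .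
      have "exp (- (?r * \<xi>\<^sup>2)) = exp (- (\<mu> * (b - a) * \<xi>\<^sup>2)) * exp (- (\<epsilon> * \<xi>\<^sup>2))"
        by (simp add: mult_exp_exp algebra_simps)
      then have 2: "exp (- (l * of_real (b - a))) * ft (w a) \<xi> * ?e \<xi> = cis (\<beta> * (b - a)) * (ft (w a) \<xi> * (complex_of_real (exp (- (?r * \<xi>\<^sup>2))) * cis (x * \<xi>)))"
        unfolding el by (simp only: of_real_mult mult_ac)
      show "ft (w b) \<xi> * ?e \<xi> = cis (\<beta> * (b - a)) * (ft (w a) \<xi> * (complex_of_real (exp (- (?r * \<xi>\<^sup>2))) * cis (x * \<xi>))) - R \<xi>"
        unfolding ft_w_duhamel[OF ab \<xi>, folded l_def] left_diff_distrib 1 2 ..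
    qed
    show "(\<lambda>\<xi>. ft (w b) \<xi> * ?e \<xi>) \<in> borel_measurable lborel" using ei[OF bT \<epsilon>] by auto
    show "(\<lambda>\<xi>. cis (\<beta> * (b - a)) * (ft (w a) \<xi> * (complex_of_real (exp (- (?r * \<xi>\<^sup>2))) * cis (x * \<xi>))) - R \<xi>) \<in> borel_measurable lborel"
      using ei[OF aT r] Ri by auto
  qed
  also have "\<dots> = (LINT \<xi>|lborel. cis (\<beta> * (b - a)) * (ft (w a) \<xi> * (complex_of_real (exp (- (?r * \<xi>\<^sup>2))) * cis (x * \<xi>)))) - (LINT \<xi>|lborel. R \<xi>)"
    by (intro Bochner_Integration.integral_diff integrable_mult_right ei aT r Ri)
  also have "(LINT \<xi>|lborel. cis (\<beta> * (b - a)) * (ft (w a) \<xi> * (complex_of_real (exp (- (?r * \<xi>\<^sup>2))) * cis (x * \<xi>)))) =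
     cis (\<beta> * (b - a)) * (2 * pi * (LINT y|lborel. w a y * gauss ?r (x - y)))"
    unfolding integral_mult_right_zero integral_ft_gauss[OF w_integrable[OF aT] r] ..
  finally show ?thesis
    unfolding integral_ft_gauss[OF w_integrable[OF bT] \<epsilon>] fub inner .
qed

end

section \<open>The weighted estimate\<close>

text \<open>If \<open>f\<close> is not integrable its integral is 0 and the bound survives, since
  \<open>g\<close> is nonnegative. In the weighted estimates only the majorants then have to be
  shown integrable.\<close>

lemma norm_integral_le:
  fixes f :: "'a \<Rightarrow> 'b::{banach, second_countable_topology}"
  assumes "integrable M g" "\<And>x. norm (f x) \<le> g x"
  shows "norm (integral\<^sup>L M f) \<le> integral\<^sup>L M g"
proof (cases "integrable M f")
  case True
  have "norm (integral\<^sup>L M f) \<le> (LINT x|M. norm (f x))" by (rule integral_norm_bound)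
  also have "\<dots> \<le> integral\<^sup>L M g" by (intro integral_mono integrable_norm True assms)
  finally show ?thesis .
next
  case False
  have "0 \<le> integral\<^sup>L M g" by (intro integral_nonneg_AE AE_I2 order_trans[OF norm_ge_zero assms(2)])
  then show ?thesis by (simp add: False not_integrable_integral_eq)
qed

text \<open>The part of the weight at \<open>y\<close> meets a Gaussian of mass 1 and keeps the
  bound \<open>M\<close> unchanged; the factor |x - y| costs \<open>sqrt r\<close> and a doubling of
  the time, against the unweighted bound \<open>S\<close>.\<close>

lemma weighted_gauss_le:
  fixes f :: "real \<Rightarrow> complex" and \<omega> :: "real \<Rightarrow> real"
  assumes lip: "\<And>x y. \<omega> x \<le> \<omega> y + \<bar>x - y\<bar>" and \<omega>0: "\<And>x. \<omega> x \<ge> 0"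
    and M: "\<And>y. \<omega> y * cmod (f y) \<le> M" and S: "\<And>y. cmod (f y) \<le> S" and r: "r > 0"
  shows "\<omega> x * cmod (LINT y|lborel. f y * gauss r (x - y)) \<le> M + 4 * S * sqrt r"
proof -
  have S0: "S \<ge> 0" using order_trans[OF norm_ge_zero S] .
  have "\<omega> x * cmod (LINT y|lborel. f y * gauss r (x - y)) = norm (LINT y|lborel. \<omega> x *\<^sub>R (f y * gauss r (x - y)))"
    using \<omega>0[of x] by (simp only: integral_scaleR_right norm_scaleR abs_of_nonneg)
  also have "\<dots> \<le> (LINT y|lborel. M * gauss r (x - y) + (4 * S * sqrt r) * gauss (2 * r) (x - y))"
  proof (rule norm_integral_le)
    show "integrable lborel (\<lambda>y. M * gauss r (x - y) + (4 * S * sqrt r) * gauss (2 * r) (x - y))"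
      using r by (intro Bochner_Integration.integrable_add integrable_mult_right integrable_gauss_shift) auto
    fix y
    have g0: "gauss r (x - y) \<ge> 0" using gauss_pos[OF r] by (simp add: less_imp_le)
    have "norm (\<omega> x *\<^sub>R (f y * gauss r (x - y))) = (\<omega> x * cmod (f y)) * gauss r (x - y)"
      using g0 \<omega>0[of x] by (simp add: norm_mult)
    also have "\<dots> \<le> (M + \<bar>x - y\<bar> * S) * gauss r (x - y)"
    proof (intro mult_right_mono g0)
      have "\<omega> x * cmod (f y) \<le> (\<omega> y + \<bar>x - y\<bar>) * cmod (f y)" by (intro mult_right_mono lip) auto
      also have "\<dots> = \<omega> y * cmod (f y) + \<bar>x - y\<bar> * cmod (f y)" by (simp add: distrib_right)
      also have "\<dots> \<le> M + \<bar>x - y\<bar> * S" by (intro add_mono M mult_left_mono S) auto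
      finally show "\<omega> x * cmod (f y) \<le> M + \<bar>x - y\<bar> * S" .
    qed
    also have "\<dots> = M * gauss r (x - y) + S * (\<bar>x - y\<bar> * gauss r (x - y))" by (simp add: algebra_simps)
    also have "\<dots> \<le> M * gauss r (x - y) + S * (4 * sqrt r * gauss (2 * r) (x - y))"
      by (intro add_left_mono mult_left_mono abs_gauss_le r S0)
    finally show "norm (\<omega> x *\<^sub>R (f y * gauss r (x - y))) \<le> M * gauss r (x - y) + (4 * S * sqrt r) * gauss (2 * r) (x - y)"
      by (simp add: mult_ac)
  qed
  also have "\<dots> = M * 1 + (4 * S * sqrt r) * 1"
    using integral_gauss_shift[of r x] integral_gauss_shift[of "2 * r" x] r
    by (subst Bochner_Integration.integral_add) (auto intro!: integrable_mult_right integrable_gauss_shift)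
  finally show ?thesis by simp
qed

text \<open>Used with y = l (b - t): it yields the small factor l^(-1/4) at the price of a further
  quarter power of the time singularity, whose exponent rises from 1/2 to 3/4 and stays below
  1.\<close>

lemma exp_minus_le_powr:
  fixes y :: real
  assumes "y > 0"
  shows "exp (- y) \<le> y powr (- 1 / 4)"
proof -
  have "ln y \<le> 4 * y" using ln_le_minus_one[OF assms] assms by linarith
  then show ?thesis using assms by (simp add: powr_def)
qed

context hilbert_flow
begin

text \<open>Of the two factors |w| in \<open>q\<close>, one carries the weight or is integrated, and
  the other is bounded by \<open>S\<close>. The lower bound \<open>\<rho>\<close> of
  \<open>r\<close> frees the estimate from the regularisation parameter; the 28 is 7 * 4 with pi <
  4.\<close>

lemma weighted_kernel_le:
  fixes \<omega> :: "real \<Rightarrow> real"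
  assumes lip: "\<And>x y. \<omega> x \<le> \<omega> y + \<bar>x - y\<bar>" and \<omega>0: "\<And>x. \<omega> x \<ge> 0"
    and M: "\<And>y. \<omega> y * cmod (w t y) \<le> M" and S: "\<And>y. cmod (w t y) \<le> S" "(LINT y|lborel. cmod (w t y)) \<le> S"
    and t: "t \<in> {0..T}" and r: "\<rho> > 0" "r \<ge> \<rho>"
  shows "\<omega> x * cmod (LINT y|lborel. of_real (q t y) * half_kernel r (x - y)) \<le> (28 * S + 7 * S\<^sup>2) * (M + 1) / sqrt \<rho>"
proof -
  have r0: "r > 0" using r by simp
  have S0: "S \<ge> 0" using order_trans[OF norm_ge_zero S(1)] .
  have M0: "M \<ge> 0" using order_trans[OF mult_nonneg_nonneg[OF \<omega>0 norm_ge_zero] M] .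
  have "\<omega> x * cmod (LINT y|lborel. of_real (q t y) * half_kernel r (x - y)) = norm (LINT y|lborel. \<omega> x *\<^sub>R (of_real (q t y) * half_kernel r (x - y)))"
    using \<omega>0[of x] by (simp only: integral_scaleR_right norm_scaleR abs_of_nonneg)
  also have "\<dots> \<le> (LINT y|lborel. (7 * S * M) * (1 / (r + (x - y)\<^sup>2)) + (7 * S / sqrt r) * cmod (w t y))"
  proof (rule norm_integral_le)
    show "integrable lborel (\<lambda>y. (7 * S * M) * (1 / (r + (x - y)\<^sup>2)) + (7 * S / sqrt r) * cmod (w t y))"
      by (intro Bochner_Integration.integrable_add integrable_mult_right cauchy_kernel r0 integrable_norm w_integrable t)
    fix y
    let ?z = "x - y" and ?W = "cmod (w t y)"
    have pos: "r + ?z\<^sup>2 > 0" using r0 by (simp add: add_pos_nonneg)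
    \<comment> \<open>|z| times the kernel bound is not integrable in z. Its supremum is used
      instead, from 2 |z| sqrt r \<le> z^2 + r, and integrability is left to |w|.\<close>
    have zk: "\<bar>?z\<bar> * (7 / (r + ?z\<^sup>2)) \<le> 7 / sqrt r"
    proof -
      have "2 * (\<bar>?z\<bar> * sqrt r) \<le> ?z\<^sup>2 + r"
        using sum_squares_bound[of "\<bar>?z\<bar>" "sqrt r"] r0 by (simp add: mult.assoc)
      moreover have "0 \<le> \<bar>?z\<bar> * sqrt r" using r0 by simp
      ultimately have "\<bar>?z\<bar> * sqrt r \<le> r + ?z\<^sup>2" by linarith
      then show ?thesis using pos r0 by (simp add: divide_simps mult.commute)
    qed
    have "norm (\<omega> x *\<^sub>R (of_real (q t y) * half_kernel r ?z)) = \<omega> x * (?W * ?W) * cmod (half_kernel r ?z)"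
      using \<omega>0[of x] by (simp add: norm_mult q_eq power2_eq_square)
    also have "\<dots> \<le> \<omega> x * (?W * ?W) * (7 / (r + ?z\<^sup>2))"
      by (intro mult_left_mono half_kernel_bound r0 mult_nonneg_nonneg \<omega>0) auto
    also have "\<dots> \<le> ((\<omega> y + \<bar>?z\<bar>) * (?W * ?W)) * (7 / (r + ?z\<^sup>2))"
      using pos by (intro mult_right_mono lip) auto
    also have "\<dots> = (\<omega> y * ?W) * ?W * (7 / (r + ?z\<^sup>2)) + ?W * ?W * (\<bar>?z\<bar> * (7 / (r + ?z\<^sup>2)))"
    proof -
      have "(c + d) * (e * e) * k = c * e * e * k + e * e * (d * k)" for c d e k :: real
        by (simp add: algebra_simps)
      then show ?thesis .
    qed
    also have "\<dots> \<le> M * S * (7 / (r + ?z\<^sup>2)) + S * ?W * (7 / sqrt r)"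
      using pos M0 S0 r0 \<omega>0[of y]
      by (intro add_mono mult_mono M S zk mult_nonneg_nonneg) auto
    finally show "norm (\<omega> x *\<^sub>R (of_real (q t y) * half_kernel r ?z)) \<le> (7 * S * M) * (1 / (r + ?z\<^sup>2)) + (7 * S / sqrt r) * ?W"
      by (simp add: mult_ac)
  qed
  also have "\<dots> = (7 * S * M) * (pi / sqrt r) + (7 * S / sqrt r) * (LINT y|lborel. cmod (w t y))"
    unfolding cauchy_kernel(2)[OF r0, of x, symmetric] integral_mult_right_zero[symmetric]
    by (intro Bochner_Integration.integral_add integrable_mult_right cauchy_kernel r0 integrable_norm w_integrable t)
  also have "\<dots> \<le> (7 * S * M) * (4 / sqrt r) + (7 * S / sqrt r) * S"
    using r0 S0 M0 S(2) pi_less_4 by (intro add_mono mult_left_mono divide_right_mono) auto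
  also have "\<dots> = (28 * S * M + 7 * S\<^sup>2) / sqrt r" by (simp add: add_divide_distrib power2_eq_square)
  also have "\<dots> \<le> ((28 * S + 7 * S\<^sup>2) * (M + 1)) / sqrt r"
    using S0 M0 r0 by (intro divide_right_mono) (auto simp: algebra_simps)
  also have "\<dots> \<le> ((28 * S + 7 * S\<^sup>2) * (M + 1)) / sqrt \<rho>"
    using S0 M0 r by (intro divide_left_mono) auto
  finally show ?thesis .
qed

text \<open>The regularised formula is weighted, estimated uniformly in the regularisation parameter
  and passed to the limit. The hypothesis enters with exp(l t) for t < b, while the conclusion has
  exp(l b) with a factor that is small for large \<open>l\<close>.\<close>

lemma weighted_step:
  fixes \<omega> :: "real \<Rightarrow> real"
  assumes lip: "\<And>x y. \<omega> x \<le> \<omega> y + \<bar>x - y\<bar>" and \<omega>0: "\<And>x. \<omega> x \<ge> 0"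
    and ab: "0 < a" "a < b" "b < T" and l: "l > 0"
    and N: "\<And>t y. t \<in> {a..b} \<Longrightarrow> \<omega> y * cmod (w t y) \<le> N * exp (l * t)"
    and Ma: "\<And>y. \<omega> y * cmod (w a y) \<le> Ma"
    and S: "\<And>t x. t \<in> {0..T} \<Longrightarrow> cmod (w t x) \<le> S" "\<And>t. t \<in> {0..T} \<Longrightarrow> (LINT x|lborel. cmod (w t x)) \<le> S"
  defines "C \<equiv> (28 * S + 7 * S\<^sup>2) / sqrt \<mu>"
  shows "\<omega> x * cmod (w b x) \<le> Ma + 4 * S * sqrt (1 + \<mu> * T) + C * (2 * T powr (1 / 2))
           + C * (4 * T powr (1 / 4)) * l powr (- 1 / 4) * (N * exp (l * b))"
proof -
  have aT: "a \<in> {0..T}" and bT: "b \<in> {0..T}" using ab by auto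
  have S0: "S \<ge> 0" using order_trans[OF norm_ge_zero S(1)[OF aT]] .
  have C0: "C \<ge> 0" unfolding C_def using S0 \<mu> by simp
  have Ma0: "Ma \<ge> 0" using order_trans[OF mult_nonneg_nonneg[OF \<omega>0 norm_ge_zero] Ma] .
  have N0: "N \<ge> 0"
  proof -
    have "0 \<le> N * exp (l * a)"
      using order_trans[OF mult_nonneg_nonneg[OF \<omega>0 norm_ge_zero] N[of a]] ab by auto
    then show ?thesis by (simp add: zero_le_mult_iff)
  qed
  let ?c1 = "C" and ?c2 = "C * (N * exp (l * b) * l powr (- 1 / 4))"
  have c2: "?c2 \<ge> 0" using C0 N0 by simp
  define D where "D = Ma + 4 * S * sqrt (1 + \<mu> * T) + C * (2 * T powr (1 / 2)) + C * (4 * T powr (1 / 4)) * l powr (- 1 / 4) * (N * exp (l * b))"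
  let ?P = "\<lambda>p t. indicator {a<..<b} t * (b - t) powr (- p)"
  \<comment> \<open>The restriction \<epsilon> \<le> 1 makes the constant under the root independent
    of \<epsilon>.\<close>
  have step: "\<omega> x * cmod (LINT y|lborel. w b y * gauss \<epsilon> (x - y)) \<le> D" if \<epsilon>: "\<epsilon> > 0" "\<epsilon> \<le> 1" for \<epsilon>
  proof -
    let ?A = "LINT y|lborel. w a y * gauss (\<epsilon> + \<mu> * (b - a)) (x - y)"
    let ?F = "\<lambda>t. of_real (indicator {a<..<b} t) * (\<i> * cis (\<beta> * (b - t)) * (LINT y|lborel. of_real (q t y) * half_kernel (\<epsilon> + \<mu> * (b - t)) (x - y)))"
    have r: "\<epsilon> + \<mu> * (b - a) > 0" using \<epsilon> ab \<mu> by (simp add: add_pos_pos)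
    have "\<omega> x * cmod ?A \<le> Ma + 4 * S * sqrt (\<epsilon> + \<mu> * (b - a))"
      by (rule weighted_gauss_le[OF lip \<omega>0 Ma S(1)[OF aT] r])
    also have "\<dots> \<le> Ma + 4 * S * sqrt (1 + \<mu> * T)"
      using S0 \<epsilon> ab \<mu> by (intro add_left_mono mult_left_mono real_sqrt_le_mono add_mono) auto
    finally have A: "\<omega> x * cmod ?A \<le> Ma + 4 * S * sqrt (1 + \<mu> * T)" .
    have "\<omega> x * cmod (LINT t|lborel. ?F t) = norm (LINT t|lborel. \<omega> x *\<^sub>R ?F t)"
      using \<omega>0[of x] by (simp only: integral_scaleR_right norm_scaleR abs_of_nonneg)
    also have "\<dots> \<le> (LINT t|lborel. ?c1 * ?P (1 / 2) t + ?c2 * ?P (3 / 4) t)"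
    proof (rule norm_integral_le)
      show "integrable lborel (\<lambda>t. ?c1 * ?P (1 / 2) t + ?c2 * ?P (3 / 4) t)"
        using ab by (intro Bochner_Integration.integrable_add integrable_mult_right powr_singularity) auto
      fix t
      show "norm (\<omega> x *\<^sub>R ?F t) \<le> ?c1 * ?P (1 / 2) t + ?c2 * ?P (3 / 4) t"
      proof (cases "t \<in> {a<..<b}")
        case True
        then have t: "t \<in> {0..T}" "t \<in> {a..b}" and bt: "b - t > 0" using ab by auto
        have \<rho>: "\<mu> * (b - t) > 0" "\<epsilon> + \<mu> * (b - t) \<ge> \<mu> * (b - t)" using bt \<mu> \<epsilon> by auto
        have "norm (\<omega> x *\<^sub>R ?F t) = \<omega> x * cmod (LINT y|lborel. of_real (q t y) * half_kernel (\<epsilon> + \<mu> * (b - t)) (x - y))"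
          using True \<omega>0[of x] by (simp add: norm_mult)
        also have "\<dots> \<le> (28 * S + 7 * S\<^sup>2) * (N * exp (l * t) + 1) / sqrt (\<mu> * (b - t))"
          by (rule weighted_kernel_le[OF lip \<omega>0 N[OF t(2)] S(1)[OF t(1)] S(2)[OF t(1)] t(1) \<rho>])
        also have "\<dots> = C * (b - t) powr (- (1 / 2)) + C * (N * (exp (l * t) * (b - t) powr (- (1 / 2))))"
        proof -
          have X: "(b - t) powr (- (1 / 2)) = 1 / sqrt (b - t)" using bt by (simp add: powr_minus_divide powr_half_sqrt)
          have "c * (n * e + 1) / (m * k) = c / m * (1 / k) + c / m * (n * (e * (1 / k)))" for c n e m k :: real
            by (simp add: add_divide_distrib distrib_left mult_ac)
          then show ?thesis unfolding X C_def real_sqrt_mult .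
        qed
        also have "\<dots> \<le> C * (b - t) powr (- (1 / 2)) + C * (N * (exp (l * b) * (l powr (- 1 / 4) * (b - t) powr (- (3 / 4)))))"
        proof (intro add_left_mono mult_left_mono C0 N0)
          \<comment> \<open>The growth still missing between t and b, exp(-l (b - t)), is converted
            into powers of \<open>l\<close> and of \<open>b - t\<close>.\<close>
          have "exp (l * t) = exp (l * b) * exp (- (l * (b - t)))" by (simp add: mult_exp_exp algebra_simps)
          also have "\<dots> \<le> exp (l * b) * (l * (b - t)) powr (- 1 / 4)"
            using l bt by (intro mult_left_mono exp_minus_le_powr) auto
          also have "(l * (b - t)) powr (- 1 / 4) = l powr (- 1 / 4) * (b - t) powr (- 1 / 4)"
            using l bt by (simp add: powr_mult)
          finally have "exp (l * t) * (b - t) powr (- (1 / 2)) \<le> exp (l * b) * (l powr (- 1 / 4) * (b - t) powr (- 1 / 4)) * (b - t) powr (- (1 / 2))"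
            by (rule mult_right_mono) simp
          also have "\<dots> = exp (l * b) * (l powr (- 1 / 4) * ((b - t) powr (- 1 / 4) * (b - t) powr (- (1 / 2))))" by (simp only: mult.assoc)
          also have "(b - t) powr (- 1 / 4) * (b - t) powr (- (1 / 2)) = (b - t) powr (- (3 / 4))"
            by (simp flip: powr_add)
          finally show "exp (l * t) * (b - t) powr (- (1 / 2)) \<le> exp (l * b) * (l powr (- 1 / 4) * (b - t) powr (- (3 / 4)))" .
        qed
        also have "\<dots> = ?c1 * ?P (1 / 2) t + ?c2 * ?P (3 / 4) t" using True by (simp add: mult_ac)
        finally show ?thesis .
      qed simp
    qed
    also have "\<dots> = ?c1 * ((b - a) powr (1 / 2) / (1 / 2)) + ?c2 * ((b - a) powr (1 / 4) / (1 / 4))"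
    proof -
      have "(LINT t|lborel. ?c1 * ?P (1 / 2) t + ?c2 * ?P (3 / 4) t) = ?c1 * (LINT t|lborel. ?P (1 / 2) t) + ?c2 * (LINT t|lborel. ?P (3 / 4) t)"
        unfolding integral_mult_right_zero[symmetric]
        by (rule Bochner_Integration.integral_add) (use ab in \<open>auto intro!: integrable_mult_right powr_singularity\<close>)
      then show ?thesis
        using powr_singularity(2)[of "1 / 2" a b] powr_singularity(2)[of "3 / 4" a b] ab by simp
    qed
    also have "\<dots> \<le> ?c1 * (T powr (1 / 2) / (1 / 2)) + ?c2 * (T powr (1 / 4) / (1 / 4))"
      using ab C0 c2 by (intro add_mono mult_left_mono divide_right_mono powr_mono2) auto
    finally have F: "\<omega> x * cmod (LINT t|lborel. ?F t) \<le> ?c1 * (T powr (1 / 2) / (1 / 2)) + ?c2 * (T powr (1 / 4) / (1 / 4))" .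
    have "2 * pi * (\<omega> x * cmod (LINT y|lborel. w b y * gauss \<epsilon> (x - y))) = \<omega> x * cmod (2 * pi * (LINT y|lborel. w b y * gauss \<epsilon> (x - y)))"
      by (simp add: norm_mult)
    also have "\<dots> \<le> \<omega> x * (2 * pi * cmod ?A + cmod (LINT t|lborel. ?F t))"
    proof (intro mult_left_mono \<omega>0)
      have "cmod (cis (\<beta> * (b - a)) * (2 * pi * ?A) - (LINT t|lborel. ?F t)) \<le> cmod (cis (\<beta> * (b - a)) * (2 * pi * ?A)) + cmod (LINT t|lborel. ?F t)"
        by (rule norm_triangle_ineq4)
      then show "cmod (2 * pi * (LINT y|lborel. w b y * gauss \<epsilon> (x - y))) \<le> 2 * pi * cmod ?A + cmod (LINT t|lborel. ?F t)"
        unfolding regularised_duhamel[OF ab \<epsilon>(1)] by (simp add: norm_mult)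
    qed
    also have "\<dots> = 2 * pi * (\<omega> x * cmod ?A) + \<omega> x * cmod (LINT t|lborel. ?F t)" by (simp add: algebra_simps)
    also have "\<dots> \<le> 2 * pi * (Ma + 4 * S * sqrt (1 + \<mu> * T)) + 2 * pi * (?c1 * (T powr (1 / 2) / (1 / 2)) + ?c2 * (T powr (1 / 4) / (1 / 4)))"
    proof (intro add_mono mult_left_mono A)
      \<comment> \<open>In the Duhamel identity the time integral is the one term without the factor
        2 pi; enlarging it by this factor lets 2 pi cancel throughout.\<close>
      have "0 \<le> ?c1 * (T powr (1 / 2) / (1 / 2)) + ?c2 * (T powr (1 / 4) / (1 / 4))" using C0 N0 by (intro add_nonneg_nonneg mult_nonneg_nonneg) auto
      then have "1 * (?c1 * (T powr (1 / 2) / (1 / 2)) + ?c2 * (T powr (1 / 4) / (1 / 4))) \<le> 2 * pi * (?c1 * (T powr (1 / 2) / (1 / 2)) + ?c2 * (T powr (1 / 4) / (1 / 4)))"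
        using pi_gt3 by (intro mult_right_mono) auto
      with F show "\<omega> x * cmod (LINT t|lborel. ?F t) \<le> 2 * pi * (?c1 * (T powr (1 / 2) / (1 / 2)) + ?c2 * (T powr (1 / 4) / (1 / 4)))" by simp
    qed auto
    also have "\<dots> = 2 * pi * D" unfolding D_def by (simp add: algebra_simps)
    finally show ?thesis by simp
  qed
  have "(\<lambda>n. \<omega> x * cmod (LINT y|lborel. w b y * gauss (inverse (real (Suc n))) (x - y))) \<longlonglongrightarrow> \<omega> x * cmod (w b x)"
    by (intro tendsto_intros gauss_approx_identity w_integrable w_continuous bT LIMSEQ_inverse_real_of_nat) simp
  then have "\<omega> x * cmod (w b x) \<le> D"
    by (rule LIMSEQ_le_const2) (auto intro!: exI[of _ 0] step simp: inverse_le_1_iff)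
  then show ?thesis unfolding D_def .
qed

text \<open>\<open>K\<close> is chosen before the weight, so it does not depend on the bound
  \<open>R\<close> of \<omega>; \<open>R\<close> serves to make the supremum in the Gronwall
  argument finite.\<close>

lemma decay:
  assumes a: "0 < a" "a < T"
  shows "\<exists>K. \<forall>\<omega>. (\<forall>x y. \<omega> x \<le> \<omega> y + \<bar>x - y\<bar>) \<and> (\<forall>x. \<omega> x \<ge> 0) \<and> (\<exists>R. \<forall>x. \<omega> x \<le> R) \<and> (\<forall>x. \<omega> x * cmod (w a x) \<le> Ma) \<longrightarrow>
    (\<forall>t\<in>{a..<T}. \<forall>x. \<omega> x * cmod (w t x) \<le> K)"
proof -
  obtain S where S: "S > 0" "\<And>t x. t \<in> {0..T} \<Longrightarrow> cmod (w t x) \<le> S" "\<And>t. t \<in> {0..T} \<Longrightarrow> (LINT x|lborel. cmod (w t x)) \<le> S"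
    using w_bounded by metis
  have T: "T > 0" using a by simp
  define C where "C = (28 * S + 7 * S\<^sup>2) / sqrt \<mu>"
  have C: "C > 0" unfolding C_def using S \<mu> by (intro divide_pos_pos add_pos_pos) auto
  define A where "A = \<bar>Ma\<bar> + 4 * S * sqrt (1 + \<mu> * T) + C * (2 * T powr (1 / 2))"
  have A: "A \<ge> \<bar>Ma\<bar>" unfolding A_def using S C T \<mu> by (simp add: add_nonneg_nonneg)
  \<comment> \<open>Chosen, with \<open>l = k powr 4\<close>, so that the coefficient of the
    supremum in \<open>weighted_step\<close> is exactly 1/2.\<close>
  define k where "k = 8 * C * T powr (1 / 4)"
  have k: "k > 0" unfolding k_def using C T by simp
  define l where "l = k powr 4"
  have l: "l > 0" unfolding l_def using k by simp
  have lk: "C * (4 * T powr (1 / 4)) * l powr (- 1 / 4) = 1 / 2"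
  proof -
    have "l powr (- 1 / 4) = k powr (- 1)" unfolding l_def powr_powr by simp
    also have "\<dots> = 1 / k" using k by (rule powr_neg_one)
    finally have "l powr (- 1 / 4) = 1 / k" .
    then show ?thesis using C T by (simp add: k_def)
  qed
  show ?thesis
  proof (intro exI[of _ "2 * A * exp (l * T)"] allI impI ballI)
    fix \<omega> :: "real \<Rightarrow> real" and t x
    assume "(\<forall>x y. \<omega> x \<le> \<omega> y + \<bar>x - y\<bar>) \<and> (\<forall>x. \<omega> x \<ge> 0) \<and> (\<exists>R. \<forall>x. \<omega> x \<le> R) \<and> (\<forall>x. \<omega> x * cmod (w a x) \<le> Ma)"
    then obtain R where lip: "\<And>x y. \<omega> x \<le> \<omega> y + \<bar>x - y\<bar>" and \<omega>0: "\<And>x. \<omega> x \<ge> 0" and R: "\<And>x. \<omega> x \<le> R" and Ma: "\<And>x. \<omega> x * cmod (w a x) \<le> Ma"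
      by blast
    assume t: "t \<in> {a..<T}"
    \<comment> \<open>The damped weighted values are collected over times up to \<open>t\<close> and
      not up to \<open>T\<close>, because \<open>weighted_step\<close> works strictly below
      \<open>T\<close>.\<close>
    define Z where "Z = (\<lambda>(s, y). exp (- (l * s)) * (\<omega> y * cmod (w s y))) ` ({a..t} \<times> UNIV)"
    have R0: "R \<ge> 0" using order_trans[OF \<omega>0 R] .
    have ZE: "\<exists>s y. s \<in> {a..t} \<and> z = exp (- (l * s)) * (\<omega> y * cmod (w s y))" if "z \<in> Z" for z
      using that unfolding Z_def by force
    have "z \<le> R * S" if "z \<in> Z" for z
    proof -
      obtain s y where s: "s \<in> {a..t}" "z = exp (- (l * s)) * (\<omega> y * cmod (w s y))" using ZE[OF \<open>z \<in> Z\<close>] by blast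
      have "exp (- (l * s)) \<le> 1" using l s a by simp
      moreover have "\<omega> y * cmod (w s y) \<le> R * S" using s t a R0 by (intro mult_mono R S) auto
      ultimately have "exp (- (l * s)) * (\<omega> y * cmod (w s y)) \<le> 1 * (R * S)"
        by (rule mult_mono) (use \<omega>0[of y] in auto)
      then show ?thesis using s by simp
    qed
    then have bdd: "bdd_above Z" by (rule bdd_aboveI)
    have Zne: "Z \<noteq> {}" using t by (auto simp: Z_def)
    define N where "N = Sup Z"
    have N: "\<omega> y * cmod (w s y) \<le> N * exp (l * s)" if "s \<in> {a..t}" for s y
    proof -
      have "exp (- (l * s)) * (\<omega> y * cmod (w s y)) \<le> N"
        unfolding N_def using that by (intro cSup_upper bdd) (auto simp: Z_def)
      then have "exp (l * s) * (exp (- (l * s)) * (\<omega> y * cmod (w s y))) \<le> exp (l * s) * N" by (rule mult_left_mono) simp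
      moreover have "exp (l * s) * (exp (- (l * s)) * k) = k" for k :: real
        unfolding mult.assoc[symmetric] mult_exp_exp by simp
      ultimately show ?thesis by (simp only: mult.commute[of N])
    qed
    have N0: "N \<ge> 0"
    proof -
      have "0 \<le> exp (- (l * a)) * (\<omega> x * cmod (w a x))" using \<omega>0 by simp
      also have "\<dots> \<le> N" unfolding N_def using t by (intro cSup_upper bdd) (auto simp: Z_def)
      finally show ?thesis .
    qed
    \<comment> \<open>\<open>N\<close> is the supremum of a bounded set, hence a real number, and
      the half on the right can be absorbed.\<close>
    have "N \<le> A + N / 2"
      unfolding N_def
    proof (rule cSup_least[OF Zne])
      fix z assume "z \<in> Z"
      then obtain s y where s: "s \<in> {a..t}" "z = exp (- (l * s)) * (\<omega> y * cmod (w s y))" using ZE by blast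
      have "\<omega> y * cmod (w s y) \<le> A + N * exp (l * s) / 2"
      \<comment> \<open>At the initial time there is no interval to integrate over, and the bound is
        the hypothesis on \<open>w a\<close>.\<close>
      proof (cases "s = a")
        case True
        then show ?thesis using Ma[of y] A N0 by (smt (verit) divide_nonneg_pos exp_ge_zero mult_nonneg_nonneg)
      next
        case False
        then have ab: "0 < a" "a < s" "s < T" using s t a by auto
        have "\<omega> y * cmod (w s y) \<le> Ma + 4 * S * sqrt (1 + \<mu> * T) + C * (2 * T powr (1 / 2))
           + C * (4 * T powr (1 / 4)) * l powr (- 1 / 4) * (N * exp (l * s))"
          unfolding C_def by (rule weighted_step[OF lip \<omega>0 ab l N Ma S(2,3)]) (use s in auto)
        also have "\<dots> \<le> A + N * exp (l * s) / 2" unfolding lk A_def by simp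
        finally show ?thesis .
      qed
      then have "z \<le> exp (- (l * s)) * (A + N * exp (l * s) / 2)" unfolding s(2) by (intro mult_left_mono) auto
      also have "\<dots> = exp (- (l * s)) * A + N / 2"
      proof -
        have "exp (- (l * s)) * exp (l * s) = 1" by (simp add: mult_exp_exp)
        then show ?thesis by (simp add: distrib_left mult.left_commute)
      qed
      also have "\<dots> \<le> 1 * A + N / 2" using l s a A by (intro add_right_mono mult_right_mono) auto
      finally show "z \<le> A + Sup Z / 2" by (simp add: N_def)
    qed
    then have N2: "N \<le> 2 * A" by simp
    have "\<omega> x * cmod (w t x) \<le> N * exp (l * t)" by (rule N) (use t in auto)
    also have "\<dots> \<le> (2 * A) * exp (l * T)" using N2 A l t by (intro mult_mono) auto
    finally show "\<omega> x * cmod (w t x) \<le> 2 * A * exp (l * T)" .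
  qed
qed

end

section \<open>Polynomial weights and the conclusion\<close>

lemma weight_lipschitz:
  fixes x y p :: real
  assumes p: "0 < p" "p \<le> 1"
  shows "(1 + \<bar>x\<bar>) powr p \<le> (1 + \<bar>y\<bar>) powr p + \<bar>x - y\<bar>"
proof (cases "\<bar>x\<bar> \<le> \<bar>y\<bar>")
  case True
  then have "(1 + \<bar>x\<bar>) powr p \<le> (1 + \<bar>y\<bar>) powr p" using p by (intro powr_mono2) auto
  then show ?thesis by simp
next
  case False
  define m n where "m = 1 + \<bar>x\<bar>" and "n = 1 + \<bar>y\<bar>"
  have mn: "n \<ge> 1" "m > n" using False by (auto simp: m_def n_def)
  \<comment> \<open>For p \<le> 1 the ratio m / n > 1 only grows when the power is dropped, and the
    resulting slope n^(p - 1) is at most 1 because n \<ge> 1.\<close>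
  have np: "n powr p \<le> n" using mn p powr_mono[of p 1 n] by simp
  have "m powr p = n powr p * (m / n) powr p" using mn by (simp add: powr_mult[symmetric])
  also have "\<dots> \<le> n powr p * (m / n)"
    using mn p powr_mono[of p 1 "m / n"] by (intro mult_left_mono) auto
  also have "\<dots> = n powr p + (n powr p / n) * (m - n)" using mn by (simp add: field_simps)
  also have "\<dots> \<le> n powr p + 1 * (m - n)" using mn np by (intro add_left_mono mult_right_mono) auto
  also have "m - n \<le> \<bar>x - y\<bar>" by (simp add: m_def n_def)
  finally show ?thesis by (simp add: m_def n_def)
qed

theorem proposition1p3:
  fixes \<beta> \<mu> s \<gamma> C0 T0 Ts :: real
    and u0 :: "real \<Rightarrow> real"
    and u :: "real \<Rightarrow> real \<Rightarrow> real"
  assumes "\<beta> \<noteq> 0" and "\<mu> > 0" and "s > 3/2" and "\<gamma> > 0" and "C0 > 0"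
    and "u0 \<in> sobolev s"
    and "\<forall>x. \<bar>u0 x\<bar> \<le> C0 * (1 + \<bar>x\<bar>) powr (- (1 + \<gamma>))"
    and "local_solution \<beta> \<mu> s \<gamma> u0 T0 u"
    and "T0 < Ts"
    and "solution \<beta> \<mu> s u0 Ts u"
    and "curve_sobolev s Ts u" and "curve_L1 Ts u"
    and "curve_sobolev s Ts (\<lambda>t. hilbert (u t))" and "curve_L1 Ts (\<lambda>t. hilbert (u t))"
  shows "\<exists>C>0. \<forall>t x. 0 < t \<and> t < Ts \<longrightarrow>
    \<bar>u t x\<bar> + \<bar>hilbert (u t) x\<bar> \<le> C / (t powr (1/2) * (1 + \<bar>x\<bar>) powr (min 1 \<gamma>))"
proof -
  have T0: "T0 > 0" using assms(8) by (simp add: local_solution_def)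
  have Ts: "Ts > 0" using T0 assms(9) by simp
  obtain C1 where C1: "\<And>t x. 0 < t \<Longrightarrow> t \<le> T0 \<Longrightarrow>
      \<bar>u t x\<bar> + \<bar>hilbert (u t) x\<bar> \<le> C1 * t powr (-1/2) * (1 + \<bar>x\<bar>) powr (- min 1 \<gamma>)"
    using assms(8) unfolding local_solution_def by blast
  have u: "u t \<in> sobolev s" "integrable lborel (u t)" "integrable lborel (hilbert (u t))" if "t \<in> {0..Ts}" for t
    using that assms(11,12,14) by (auto simp: curve_sobolev_def curve_L1_def)
  interpret hilbert_flow s Ts u "\<lambda>t. hilbert (u t)" \<beta> \<mu>
  proof
    show "continuous_on UNIV (u t)" if "t \<in> {0..Ts}" for t using assms(10) that by (simp add: solution_def)
    show "continuous_on UNIV (hilbert (u t))" if "t \<in> {0..Ts}" for t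
      using hilbert_props(2)[OF assms(3) u(1,2)[OF that]] .
    show "ft (cx (hilbert (u t))) \<xi> = - \<i> * of_real (sgn \<xi>) * ft (cx (u t)) \<xi>" if "t \<in> {0..Ts}" "\<xi> \<noteq> 0" for t \<xi>
      by (rule ft_hilbert[OF assms(3) u[OF that(1)] that(2)])
    show "(LINT p:{0<..<Ts} \<times> UNIV|lborel.
           (case p of (t, x) \<Rightarrow>
              - u t x * partial_t \<phi> t x
              + (u t x * deriv (u t) x + hilbert (u t) x * deriv (hilbert (u t)) x) * \<phi> t x
              + \<beta> * hilbert (u t) x * \<phi> t x
              - \<mu> * u t x * partial_x (partial_x \<phi>) t x)) = 0" if "test_function Ts \<phi>" for \<phi>
      using assms(10) that by (simp only: solution_def distributional_eq_def)
  qed (use assms Ts in auto)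
  define p where "p = min 1 \<gamma>"
  have p: "0 < p" "p \<le> 1" using assms(4) by (auto simp: p_def)
  have wle: "cmod (w t x) \<le> \<bar>u t x\<bar> + \<bar>hilbert (u t) x\<bar>" "\<bar>u t x\<bar> + \<bar>hilbert (u t) x\<bar> \<le> 2 * cmod (w t x)" for t x
    using cmod_le[of "w t x"] abs_Re_le_cmod[of "w t x"] abs_Im_le_cmod[of "w t x"] by (auto simp: w_def)
  \<comment> \<open>The local bound at its final time is the initial bound of the weighted argument;
    its singular factor is a constant there.\<close>
  define Ma where "Ma = C1 * T0 powr (-1/2)"
  have at_T0: "(1 + \<bar>x\<bar>) powr p * cmod (w T0 x) \<le> Ma" for x
  proof -
    have "(1 + \<bar>x\<bar>) powr p * cmod (w T0 x) \<le> (1 + \<bar>x\<bar>) powr p * (C1 * T0 powr (-1/2) * (1 + \<bar>x\<bar>) powr (- p))"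
      using order_trans[OF wle(1) C1[OF T0 order_refl, of x]] by (intro mult_left_mono) (auto simp: p_def)
    also have "\<dots> = Ma * ((1 + \<bar>x\<bar>) powr p * (1 + \<bar>x\<bar>) powr (- p))" by (simp add: Ma_def mult_ac)
    also have "(1 + \<bar>x\<bar>) powr p * (1 + \<bar>x\<bar>) powr (- p) = 1" by (simp flip: powr_add)
    finally show ?thesis by simp
  qed
  obtain K where K: "\<And>\<omega> t x. \<lbrakk>\<forall>x y. \<omega> x \<le> \<omega> y + \<bar>x - y\<bar>; \<forall>x. \<omega> x \<ge> 0; \<exists>R. \<forall>x. \<omega> x \<le> R; \<forall>x. \<omega> x * cmod (w T0 x) \<le> Ma; t \<in> {T0..<Ts}\<rbrakk>
      \<Longrightarrow> \<omega> x * cmod (w t x) \<le> K"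
    using decay[OF T0 assms(9), of Ma] by blast
  have late: "(1 + \<bar>x\<bar>) powr p * cmod (w t x) \<le> K" if t: "t \<in> {T0..<Ts}" for t x
  proof -
    \<comment> \<open>The truncation level is the value of the weight at the given point, so the
      truncated weight agrees with the full one at \<open>x\<close>, while \<open>K\<close> is the
      same for every such level.\<close>
    define R where "R = (1 + \<bar>x\<bar>) powr p"
    let ?\<omega> = "\<lambda>y. min R ((1 + \<bar>y\<bar>) powr p)"
    have "?\<omega> x * cmod (w t x) \<le> K"
    proof (rule K[of ?\<omega>])
      show "\<forall>y z. ?\<omega> y \<le> ?\<omega> z + \<bar>y - z\<bar>"
      proof (intro allI)
        fix y z show "?\<omega> y \<le> ?\<omega> z + \<bar>y - z\<bar>" using weight_lipschitz[OF p, of y z] by linarith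
      qed
      show "\<forall>y. ?\<omega> y * cmod (w T0 y) \<le> Ma"
        by (intro allI order_trans[OF mult_right_mono at_T0]) auto
      show "\<exists>R. \<forall>y. ?\<omega> y \<le> R" by (intro exI[of _ R]) auto
    qed (use t in \<open>auto simp: R_def\<close>)
    then show ?thesis by (simp add: R_def)
  qed
  \<comment> \<open>The 1 makes \<open>C\<close> positive, and \<open>C1\<close> serves times up to
    \<open>T0\<close>. Afterwards the bound carries no power of t, so t^(1/2) \<le> Ts^(1/2)
    supplies it; the 2 comes from comparing the sum of the two moduli with |w|.\<close>
  define C where "C = max 1 (max C1 (2 * K * Ts powr (1/2)))"
  have "\<bar>u t x\<bar> + \<bar>hilbert (u t) x\<bar> \<le> C / (t powr (1/2) * (1 + \<bar>x\<bar>) powr p)" if t: "0 < t" "t < Ts" for t x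
  proof -
    let ?W = "(1 + \<bar>x\<bar>) powr p"
    have W: "?W > 0" by simp
    have pos: "t powr (1/2) * ?W > 0" using t by simp
    have "(\<bar>u t x\<bar> + \<bar>hilbert (u t) x\<bar>) * (t powr (1/2) * ?W) \<le> C"
    proof (cases "t \<le> T0")
      case True
      have "(\<bar>u t x\<bar> + \<bar>hilbert (u t) x\<bar>) * (t powr (1/2) * ?W) \<le> (C1 * t powr (-1/2) * (1 + \<bar>x\<bar>) powr (- p)) * (t powr (1/2) * ?W)"
        using C1[OF t(1) True, of x] pos by (intro mult_right_mono) (auto simp: p_def)
      also have "\<dots> = C1 * (t powr (-1/2) * t powr (1/2)) * ((1 + \<bar>x\<bar>) powr (- p) * ?W)" by (simp only: mult_ac)
      also have "\<dots> = C1" using t by (simp flip: powr_add)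
      also have "\<dots> \<le> C" by (simp add: C_def)
      finally show ?thesis .
    next
      case False
      have l: "?W * cmod (w t x) \<le> K" by (rule late) (use t False in auto)
      have "(\<bar>u t x\<bar> + \<bar>hilbert (u t) x\<bar>) * (t powr (1/2) * ?W) \<le> (2 * cmod (w t x)) * (t powr (1/2) * ?W)"
        using pos by (intro mult_right_mono wle) auto
      also have "\<dots> = (2 * (?W * cmod (w t x))) * t powr (1/2)" by (simp only: mult_ac)
      also have "\<dots> \<le> (2 * K) * Ts powr (1/2)"
        using l t order_trans[OF mult_nonneg_nonneg[OF less_imp_le[OF W] norm_ge_zero] l] by (intro mult_mono powr_mono2) auto
      also have "\<dots> \<le> C" by (simp add: C_def)
      finally show ?thesis .
    qed
    then show ?thesis using pos by (simp add: pos_le_divide_eq)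
  qed
  moreover have "C > 0" by (simp add: C_def)
  ultimately show ?thesis unfolding p_def by blast
qed

end
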